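(* Let $\Theta$ be an inner function in the unit disc $\mathbb{D}$ such that there exists a point $\zeta\in\sigma(\Theta)$ which is a Carathéodory point for $\Theta$. Then there exists an exact system of reproducing kernels in $K_\Theta$ such that its biorthogonal system is not complete in $K_\Theta$.
   Context: $H^2$ is the Hardy space of the unit disc $\mathbb{D}$, $\mathbb{T}=\partial\mathbb{D}$, and $K_\Theta=H^2\ominus\Theta H^2$ for an inner function $\Theta$ in $\mathbb{D}$. The reproducing kernel of $K_\Theta$ at $\lambda\in\mathbb{D}$ is the function $k_\lambda\in K_\Theta$ with $\langle f,k_\lambda\rangle=f(\lambda)$ for all $f\in K_\Theta$. The boundary spectrum $\sigma(\Theta)$ is the set of $\zeta\in\mathbb{T}$ such that $\liminf_{z\to\zeta,\,z\in\mathbb{D}}|\Theta(z)|=0$. A point $\zeta\in\mathbb{T}$ is a Carathéodory point for $\Theta$ if $\Theta$ has an angular derivative at $\zeta$, that is, the nontangential limit $\Theta(\zeta)$ exists with $|\Theta(\zeta)|=1$, and the nontangential limit $\Theta'(\zeta)=\lim_{z\to\zeta}\frac{\Theta(z)-\Theta(\zeta)}{z-\zeta}$ exists (and is finite). A system of vectors in a Hilbert space is complete if its closed linear span is the whole space; it is exact if it is complete and fails to be complete when any one vector is removed. An exact system $\{v_n\}$ has a unique biorthogonal system $\{w_m\}$, $\langle v_n,w_m\rangle=\delta_{nm}$. *)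

theory Defs
  imports "HOL-Complex_Analysis.Complex_Analysis"
begin

abbreviation unit_disc :: "complex set" where
  "unit_disc \<equiv> ball 0 1"

section \<open>The Hardy space\<close>

definition taylor_coeff :: "(complex \<Rightarrow> complex) \<Rightarrow> nat \<Rightarrow> complex" where
  "taylor_coeff f n = (deriv ^^ n) f 0 / fact n"

text \<open>
  Elements of the Hardy space are represented by total functions that are zero outside
  the disc, so that equality of functions is equality in the space. The scalar product is the
  usual one: by Parseval it equals the limit, as r tends to 1 from below, of the means of
  f times the conjugate of g over the circle of radius r.
\<close>

definition hardy_space :: "(complex \<Rightarrow> complex) set" where
  "hardy_space = {f. f holomorphic_on unit_disc \<and> (\<forall>z. z \<notin> unit_disc \<longrightarrow> f z = 0) \<and>
                     summable (\<lambda>n. (cmod (taylor_coeff f n))\<^sup>2)}"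

definition hardy_inner :: "(complex \<Rightarrow> complex) \<Rightarrow> (complex \<Rightarrow> complex) \<Rightarrow> complex" where
  "hardy_inner f g = (\<Sum>n. taylor_coeff f n * cnj (taylor_coeff g n))"

definition hardy_norm :: "(complex \<Rightarrow> complex) \<Rightarrow> real" where
  "hardy_norm f = sqrt (Re (hardy_inner f f))"

section \<open>Inner functions and model spaces\<close>

text \<open>Only the values of \<open>\<Theta>\<close> in the disc matter, here and below.\<close>

definition inner_function :: "(complex \<Rightarrow> complex) \<Rightarrow> bool" where
  "inner_function \<Theta> \<longleftrightarrow>
     \<Theta> holomorphic_on unit_disc \<and> (\<forall>z\<in>unit_disc. cmod (\<Theta> z) \<le> 1) \<and>
     (AE t in lebesgue_on {0..2 * pi}.
        \<exists>w. cmod w = 1 \<and> ((\<lambda>r. \<Theta> (of_real r * cis t)) \<longlongrightarrow> w) (at_left (1::real)))"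

definition model_space :: "(complex \<Rightarrow> complex) \<Rightarrow> (complex \<Rightarrow> complex) set" where
  "model_space \<Theta> =
     {f \<in> hardy_space. \<forall>g\<in>hardy_space. hardy_inner f (\<lambda>z. \<Theta> z * g z) = 0}"

definition is_reproducing_kernel ::
    "(complex \<Rightarrow> complex) \<Rightarrow> complex \<Rightarrow> (complex \<Rightarrow> complex) \<Rightarrow> bool" where
  "is_reproducing_kernel \<Theta> z k \<longleftrightarrow>
     z \<in> unit_disc \<and> k \<in> model_space \<Theta> \<and> (\<forall>f\<in>model_space \<Theta>. hardy_inner f k = f z)"

section \<open>Boundary behaviour\<close>

definition boundary_spectrum :: "(complex \<Rightarrow> complex) \<Rightarrow> complex set" where
  "boundary_spectrum \<Theta> =
     {\<zeta> \<in> sphere 0 1. Liminf (at \<zeta> within unit_disc) (\<lambda>z. ereal (cmod (\<Theta> z))) = 0}"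

definition stolz_region :: "complex \<Rightarrow> real \<Rightarrow> complex set" where
  "stolz_region \<zeta> a = {z \<in> unit_disc. cmod (z - \<zeta>) < a * (1 - cmod z)}"

definition nontangential_limit ::
    "(complex \<Rightarrow> complex) \<Rightarrow> complex \<Rightarrow> complex \<Rightarrow> bool" where
  "nontangential_limit f \<zeta> l \<longleftrightarrow>
     (\<forall>a>1. (f \<longlongrightarrow> l) (at \<zeta> within stolz_region \<zeta> a))"

definition caratheodory_point :: "(complex \<Rightarrow> complex) \<Rightarrow> complex \<Rightarrow> bool" where
  "caratheodory_point \<Theta> \<zeta> \<longleftrightarrow>
     \<zeta> \<in> sphere 0 1 \<and>
     (\<exists>w. cmod w = 1 \<and> nontangential_limit \<Theta> \<zeta> w \<and>
          (\<exists>d. nontangential_limit (\<lambda>z. (\<Theta> z - w) / (z - \<zeta>)) \<zeta> d))"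

section \<open>Systems of vectors\<close>

text \<open>
  Systems are indexed families; \<open>H\<close> is a closed subspace of the Hardy space containing
  the members of the family.
\<close>

definition closed_lin_span ::
    "'i set \<Rightarrow> ('i \<Rightarrow> complex \<Rightarrow> complex) \<Rightarrow> (complex \<Rightarrow> complex) set" where
  "closed_lin_span I v =
     {f \<in> hardy_space. \<forall>e>0. \<exists>J c. finite J \<and> J \<subseteq> I \<and>
        hardy_norm (\<lambda>z. f z - (\<Sum>i\<in>J. c i * v i z)) < e}"

definition complete_system ::
    "(complex \<Rightarrow> complex) set \<Rightarrow> 'i set \<Rightarrow> ('i \<Rightarrow> complex \<Rightarrow> complex) \<Rightarrow> bool" where
  "complete_system H I v \<longleftrightarrow> closed_lin_span I v = H"

definition exact_system ::
    "(complex \<Rightarrow> complex) set \<Rightarrow> 'i set \<Rightarrow> ('i \<Rightarrow> complex \<Rightarrow> complex) \<Rightarrow> bool" where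
  "exact_system H I v \<longleftrightarrow>
     complete_system H I v \<and> (\<forall>i\<in>I. \<not> complete_system H (I - {i}) v)"

definition biorthogonal_system ::
    "(complex \<Rightarrow> complex) set \<Rightarrow> 'i set \<Rightarrow> ('i \<Rightarrow> complex \<Rightarrow> complex) \<Rightarrow>
     ('i \<Rightarrow> complex \<Rightarrow> complex) \<Rightarrow> bool" where
  "biorthogonal_system H I v w \<longleftrightarrow>
     (\<forall>i\<in>I. w i \<in> H) \<and>
     (\<forall>i\<in>I. \<forall>j\<in>I. hardy_inner (v i) (w j) = (if i = j then 1 else 0))"

end

theory Submission
  imports Defs
begin

text \<open>
  At a Caratheodory point \<open>\<zeta>\<close> the functions of \<open>K\<^sub>\<Theta>\<close> have radial limits \<open>f(\<zeta>) = \<langle>f, h\<rangle>\<close> for some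
  \<open>h \<noteq> 0\<close> in \<open>K\<^sub>\<Theta>\<close>. The members of the biorthogonal system of the kernels at the points \<open>p\<^sub>n\<close> are the
  functions of \<open>K\<^sub>\<Theta>\<close> that vanish at all \<open>p\<^sub>m\<close> but one, so it suffices to find an exact system for which
  these functions vanish at \<open>\<zeta>\<close> as well: then \<open>h\<close> is orthogonal to all of them.

  Moving zeros is harmless in \<open>K\<^sub>\<Theta>\<close>: if \<open>f(\<mu>) = 0\<close>, then \<open>f (z - \<lambda>) / (z - \<mu>)\<close> is again in \<open>K\<^sub>\<Theta>\<close>. By
  Frostman's theorem some \<open>\<Theta> - c\<close> with \<open>\<bar>c\<bar> < 1\<close> has simple zeros which form a uniqueness set for
  \<open>K\<^sub>\<Theta>\<close> and, as \<open>\<zeta>\<close> lies in the spectrum, accumulate at \<open>\<zeta>\<close>. Two of these zeros are traded for one zero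
  at \<open>\<zeta>\<close>, which gives \<open>f = (z - \<zeta>) g\<close> determined up to a factor, among the functions vanishing at \<open>\<zeta>\<close>, by its
  remaining zeros. But \<open>g\<close> vanishes there too, so these zeros and one further point are not a uniqueness set.
  To repair this, zeros \<open>\<mu>\<close> close to \<open>\<zeta>\<close> are moved one after another by small amounts: since
  \<open>g / (z - \<zeta>)\<close> is not in \<open>H\<^sup>2\<close>, the norm of \<open>g / (z - \<mu>)\<close> is unbounded as \<open>\<mu>\<close> approaches \<open>\<zeta>\<close>, so a
  move can make the norm of \<open>f / (z - \<zeta>)\<close> as large as desired while \<open>f\<close> hardly changes. In the limit
  \<open>f / (z - \<zeta>)\<close> is no longer in \<open>H\<^sup>2\<close>, and the zeros of \<open>f\<close> with one further point are as required.
\<close>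

section \<open>The Hardy space as a Hilbert space\<close>

text \<open>Why the size of \<open>f / (z - \<zeta>)\<close> decides: if \<open>u\<close> in
  \<open>K\<close> vanishes at the selected zeros of \<open>f\<close> and at a further point
  \<open>a\<close>, write \<open>u = (z - a) q\<close>. Then \<open>(z - \<zeta>) q\<close> lies in
  \<open>K\<close>, vanishes at \<open>\<zeta>\<close> and at these zeros, hence equals
  \<open>c f\<close>. With \<open>c \<noteq> 0\<close> this would put
  \<open>f / (z - \<zeta>)\<close> into H^2, so \<open>c = 0\<close> and \<open>u = 0\<close>.

  The obstacle is the passage to the limit, since being determined up to a factor by a set of zeros
  is not preserved by limits. Dually it says that \<open>h\<close>, \<open>f\<close> and the kernels
  at the zeros span a dense subspace of \<open>K\<close>. This is split into countably many
  approximations, each made with finitely many zeros and stable under small changes of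
  \<open>f\<close>. Every step freezes the zeros it has used and a ball in which all later functions
  must stay.

  Boundary functions are avoided: quotients and limits are controlled by means over circles, and
  that \<open>\<Theta>\<close> is inner enters through its means tending to 1.\<close>

lemma taylor_coeff_sums:
  assumes "f holomorphic_on unit_disc" "z \<in> unit_disc"
  shows "(\<lambda>n. taylor_coeff f n * z ^ n) sums f z"
  using holomorphic_power_series[OF assms] by (simp add: taylor_coeff_def)

lemma taylor_coeff_unique:
  assumes "\<And>z. z \<in> unit_disc \<Longrightarrow> (\<lambda>n. a n * z ^ n) sums f z"
  shows "taylor_coeff f n = a n"
proof -
  have "conv_radius a \<ge> 1"
  proof (rule conv_radius_geI_ex)
    fix r :: real assume r: "0 < r" "ereal r < 1"
    then have "(\<lambda>n. a n * of_real r ^ n) sums f (of_real r)"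
      by (intro assms) (auto simp: one_ereal_def)
    then show "\<exists>z. norm z = r \<and> summable (\<lambda>n. a n * z ^ n)"
      using r by (intro exI[of _ "of_real r"]) (auto simp: sums_iff)
  qed
  then have "fps_conv_radius (Abs_fps a) \<ge> 1"
    by (simp add: fps_conv_radius_def)
  moreover have "\<forall>\<^sub>F z in nhds 0. eval_fps (Abs_fps a) z = f z"
  proof (rule eventually_mono[OF eventually_nhds_in_open[of unit_disc 0]])
    fix z :: complex assume "z \<in> unit_disc"
    then show "eval_fps (Abs_fps a) z = f z"
      using assms[of z] by (simp add: eval_fps_def sums_iff)
  qed auto
  ultimately have "f has_fps_expansion Abs_fps a"
    by (auto simp: has_fps_expansion_def intro: less_le_trans[of _ 1])
  from fps_nth_fps_expansion[OF this, of n] show ?thesis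
    by (simp add: taylor_coeff_def)
qed

lemma taylor_coeff_add:
  assumes "f holomorphic_on unit_disc" "g holomorphic_on unit_disc"
  shows "taylor_coeff (\<lambda>z. f z + g z) n = taylor_coeff f n + taylor_coeff g n"
  by (rule taylor_coeff_unique)
     (use sums_add[OF taylor_coeff_sums[OF assms(1)] taylor_coeff_sums[OF assms(2)]]
       in \<open>simp add: algebra_simps\<close>)

lemma taylor_coeff_cmult:
  assumes "f holomorphic_on unit_disc"
  shows "taylor_coeff (\<lambda>z. c * f z) n = c * taylor_coeff f n"
  by (rule taylor_coeff_unique)
     (use sums_mult[OF taylor_coeff_sums[OF assms], of _ c] in \<open>simp add: algebra_simps\<close>)

lemma taylor_coeff_0 [simp]: "taylor_coeff f 0 = f 0"
  by (simp add: taylor_coeff_def)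

definition square_summable :: "(nat \<Rightarrow> complex) \<Rightarrow> bool" where
  "square_summable a \<longleftrightarrow> summable (\<lambda>n. (cmod (a n))\<^sup>2)"

lemma square_summable_mult:
  assumes "square_summable a" "square_summable b"
  shows "summable (\<lambda>n. cmod (a n * cnj (b n)))"
proof (rule summable_comparison_test')
  show "summable (\<lambda>n. (cmod (a n))\<^sup>2 + (cmod (b n))\<^sup>2)"
    using assms by (intro summable_add) (auto simp: square_summable_def)
  fix n :: nat
  have "2 * (cmod (a n) * cmod (b n)) \<le> (cmod (a n))\<^sup>2 + (cmod (b n))\<^sup>2"
    using sum_squares_bound[of "cmod (a n)" "cmod (b n)"] by (simp add: mult.assoc)
  moreover have "0 \<le> cmod (a n) * cmod (b n)" by simp
  ultimately have "cmod (a n) * cmod (b n) \<le> (cmod (a n))\<^sup>2 + (cmod (b n))\<^sup>2"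
    by linarith
  then show "norm (cmod (a n * cnj (b n))) \<le> (cmod (a n))\<^sup>2 + (cmod (b n))\<^sup>2"
    by (simp add: norm_mult)
qed

lemma square_summable_add:
  assumes "square_summable a" "square_summable b"
  shows "square_summable (\<lambda>n. a n + b n)"
  unfolding square_summable_def
proof (rule summable_comparison_test')
  show "summable (\<lambda>n. 2 * (cmod (a n))\<^sup>2 + 2 * (cmod (b n))\<^sup>2)"
    using assms by (intro summable_add summable_mult) (auto simp: square_summable_def)
  fix n :: nat
  have "(cmod (a n + b n))\<^sup>2 \<le> (cmod (a n) + cmod (b n))\<^sup>2"
    by (intro power_mono norm_triangle_ineq) auto
  also have "\<dots> \<le> 2 * (cmod (a n))\<^sup>2 + 2 * (cmod (b n))\<^sup>2"
    using sum_squares_bound[of "cmod (a n)" "cmod (b n)"] by (simp add: power2_sum)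
  finally show "norm ((cmod (a n + b n))\<^sup>2) \<le> 2 * (cmod (a n))\<^sup>2 + 2 * (cmod (b n))\<^sup>2"
    by simp
qed

lemma square_summable_cmult:
  assumes "square_summable a"
  shows "square_summable (\<lambda>n. c * a n)"
  using assms unfolding square_summable_def
  by (simp add: norm_mult power_mult_distrib summable_mult)

lemma square_summable_geometric:
  assumes "z \<in> unit_disc"
  shows "square_summable (\<lambda>n. z ^ n)"
proof -
  have "(cmod (z ^ n))\<^sup>2 = ((cmod z)\<^sup>2) ^ n" for n
    by (simp add: norm_power flip: power_mult) (simp add: mult.commute)
  then show ?thesis
    using assms unfolding square_summable_def
    by (simp add: summable_geometric abs_square_less_1)
qed

lemma square_summable_sums:
  assumes "square_summable a" "z \<in> unit_disc"
  shows "summable (\<lambda>n. a n * z ^ n)"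
proof -
  have "square_summable (\<lambda>n. cnj (z ^ n))"
    using square_summable_geometric[of "cnj z"] assms(2) by simp
  from square_summable_mult[OF assms(1) this] show ?thesis
    by (auto intro: summable_norm_cancel[of "\<lambda>n. a n * z ^ n"] simp: norm_mult norm_power)
qed

text \<open>On a separate type, \<open>norm\<close>, \<open>closure\<close> and
  \<open>Cauchy\<close> come from the classes \<open>real_inner\<close> and
  \<open>complete_space\<close>. Their scalar product is the real part of \<open>cinner\<close>; the
  complex structure is carried by \<open>scaleC\<close> and \<open>cinner\<close>.\<close>

typedef hardy = hardy_space
  morphisms fn Hardy
proof
  have "taylor_coeff (\<lambda>z. 0) n = 0" for n
    by (rule taylor_coeff_unique) simp
  then show "(\<lambda>z. 0) \<in> hardy_space"
    by (simp add: hardy_space_def)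
qed

definition cf :: "hardy \<Rightarrow> nat \<Rightarrow> complex" where
  "cf f n = taylor_coeff (fn f) n"

lemma fn_holomorphic: "fn f holomorphic_on unit_disc"
  and fn_outside: "z \<notin> unit_disc \<Longrightarrow> fn f z = 0"
  and square_summable_cf: "square_summable (cf f)"
  using fn[of f] by (auto simp: hardy_space_def cf_def square_summable_def)

lemma cf_sums: "z \<in> unit_disc \<Longrightarrow> (\<lambda>n. cf f n * z ^ n) sums fn f z"
  unfolding cf_def by (rule taylor_coeff_sums[OF fn_holomorphic])

lemma cf_0: "cf f 0 = fn f 0"
  by (simp add: cf_def)

lemma hardy_eqI:
  assumes "\<And>z. z \<in> unit_disc \<Longrightarrow> fn f z = fn g z"
  shows "f = g"
proof -
  have "fn f = fn g"
    using assms fn_outside by (metis ext)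
  then show ?thesis by (simp add: fn_inject)
qed

lemma hardy_eqI_cf:
  assumes "\<And>n. cf f n = cf g n"
  shows "f = g"
proof (rule hardy_eqI)
  fix z :: complex assume z: "z \<in> unit_disc"
  show "fn f z = fn g z"
    by (rule sums_unique2[OF cf_sums[OF z]]) (use cf_sums[OF z, of g] assms in simp)
qed

definition of_cf :: "(nat \<Rightarrow> complex) \<Rightarrow> hardy" where
  "of_cf a = Hardy (\<lambda>z. if z \<in> unit_disc then \<Sum>n. a n * z ^ n else 0)"

lemma
  assumes "square_summable a"
  shows cf_of_cf: "cf (of_cf a) n = a n"
    and fn_of_cf: "z \<in> unit_disc \<Longrightarrow> fn (of_cf a) z = (\<Sum>n. a n * z ^ n)"
proof -
  let ?f = "\<lambda>z. if z \<in> unit_disc then \<Sum>n. a n * z ^ n else 0"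
  have s: "(\<lambda>n. a n * z ^ n) sums ?f z" if "z \<in> unit_disc" for z
    using square_summable_sums[OF assms that] that by (simp add: summable_sums)
  have t: "taylor_coeff ?f n = a n" for n
    by (rule taylor_coeff_unique) (rule s)
  have "?f holomorphic_on unit_disc"
    by (rule power_series_holomorphic[of 0 1 a]) (use s in simp)
  then have f: "?f \<in> hardy_space"
    using assms t by (auto simp: hardy_space_def square_summable_def)
  then have fn: "fn (of_cf a) = ?f"
    unfolding of_cf_def by (rule Hardy_inverse)
  show "cf (of_cf a) n = a n"
    unfolding cf_def fn by (rule t)
  show "z \<in> unit_disc \<Longrightarrow> fn (of_cf a) z = (\<Sum>n. a n * z ^ n)"
    by (simp add: fn)
qed

lemma fn_of_cf_sums:
  assumes "square_summable a" "z \<in> unit_disc" "(\<lambda>n. a n * z ^ n) sums w"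
  shows "fn (of_cf a) z = w"
  using fn_of_cf[OF assms(1,2)] assms(3) by (simp add: sums_iff)

definition cinner :: "hardy \<Rightarrow> hardy \<Rightarrow> complex" where
  "cinner f g = (\<Sum>n. cf f n * cnj (cf g n))"

definition scaleC :: "complex \<Rightarrow> hardy \<Rightarrow> hardy"  (infixr "*\<^sub>h" 75) where
  "c *\<^sub>h f = of_cf (\<lambda>n. c * cf f n)"

lemma cf_scaleC [simp]: "cf (c *\<^sub>h f) n = c * cf f n"
  unfolding scaleC_def by (simp add: cf_of_cf square_summable_cmult square_summable_cf)

lemma fn_scaleC [simp]: "fn (c *\<^sub>h f) z = c * fn f z"
proof (cases "z \<in> unit_disc")
  case True
  show ?thesis
    by (rule sums_unique2[OF cf_sums[OF True]])
       (use sums_mult[OF cf_sums[OF True, of f], of c] in \<open>simp add: mult.assoc\<close>)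
qed (simp add: fn_outside)

lemma cinner_sums: "(\<lambda>n. cf f n * cnj (cf g n)) sums cinner f g"
  unfolding cinner_def
  by (rule summable_sums, rule summable_norm_cancel)
     (intro square_summable_mult square_summable_cf)

instantiation hardy :: real_inner
begin

definition "0 = of_cf (\<lambda>n. 0)"
definition "f + g = of_cf (\<lambda>n. cf f n + cf g n)"
definition "- f = (-1) *\<^sub>h f" for f :: hardy
definition "f - g = f + (-1) *\<^sub>h g" for f :: hardy
definition "r *\<^sub>R f = of_real r *\<^sub>h f" for f :: hardy
definition "inner f g = Re (cinner f g)"
definition "norm f = sqrt (inner f f)" for f :: hardy
definition "dist f g = norm (f - g)" for f :: hardy
definition "sgn f = inverse (norm f) *\<^sub>R f" for f :: hardy
definition "uniformity = (INF e\<in>{0 <..}. principal {(x, y::hardy). dist x y < e})"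
definition "open (U :: hardy set) \<longleftrightarrow>
  (\<forall>x\<in>U. eventually (\<lambda>(x', y). x' = x \<longrightarrow> y \<in> U) uniformity)"

lemma cf_simps_raw:
  "cf 0 n = 0" "cf (f + g) n = cf f n + cf g n" "cf (- f) n = - cf f n"
  "cf (f - g) n = cf f n - cf g n" "cf (r *\<^sub>R f) n = of_real r * cf f n"
proof -
  show *: "cf (f + g) n = cf f n + cf g n" for f g
    by (simp add: plus_hardy_def cf_of_cf square_summable_add square_summable_cf)
  show "cf 0 n = 0"
    by (simp add: zero_hardy_def cf_of_cf square_summable_def)
  show "cf (- f) n = - cf f n" "cf (f - g) n = cf f n - cf g n"
    "cf (r *\<^sub>R f) n = of_real r * cf f n"
    by (simp_all add: uminus_hardy_def minus_hardy_def * scaleR_hardy_def)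
qed

lemma inner_sums_raw: "(\<lambda>n. Re (cf f n * cnj (cf g n))) sums inner f g"
  unfolding inner_hardy_def by (rule sums_Re[OF cinner_sums])

instance
proof
  fix x y z :: hardy and r s :: real
  note cf_simps_raw [simp]
  show "x + y + z = x + (y + z)" "x + y = y + x" "0 + x = x" "- x + x = 0" "x - y = x + - y"
    "r *\<^sub>R (x + y) = r *\<^sub>R x + r *\<^sub>R y" "(r + s) *\<^sub>R x = r *\<^sub>R x + s *\<^sub>R x"
    "r *\<^sub>R s *\<^sub>R x = (r * s) *\<^sub>R x" "1 *\<^sub>R x = x"
    by (rule hardy_eqI_cf; simp add: algebra_simps)+
  show "inner x y = inner y x"
    by (rule sums_unique2[OF inner_sums_raw]) (use inner_sums_raw[of y x] in \<open>simp add: mult.commute\<close>)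
  show "inner (x + y) z = inner x z + inner y z"
    by (rule sums_unique2[OF inner_sums_raw])
       (use sums_add[OF inner_sums_raw[of x z] inner_sums_raw[of y z]] in \<open>simp add: algebra_simps\<close>)
  show "inner (r *\<^sub>R x) y = r * inner x y"
    by (rule sums_unique2[OF inner_sums_raw])
       (use sums_mult[OF inner_sums_raw[of x y], of r] in \<open>simp add: algebra_simps\<close>)
  have s: "(\<lambda>n. (cmod (cf x n))\<^sup>2) sums inner x x"
    using inner_sums_raw[of x x] by (simp add: complex_mult_cnj cmod_power2)
  show "0 \<le> inner x x"
    by (rule sums_le[OF _ sums_zero s]) simp
  show "(inner x x = 0) = (x = 0)"
  proof
    assume "inner x x = 0"
    then have "(cmod (cf x n))\<^sup>2 = 0" for n
      using s suminf_eq_zero_iff[of "\<lambda>n. (cmod (cf x n))\<^sup>2"] by (auto simp: sums_iff)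
    then show "x = 0"
      by (intro hardy_eqI_cf) simp
  next
    assume "x = 0"
    then have "(\<lambda>n. 0) sums inner x x"
      using s by simp
    then show "inner x x = 0"
      using sums_unique2 sums_zero by blast
  qed
qed (simp_all add: dist_hardy_def norm_hardy_def sgn_hardy_def uniformity_hardy_def open_hardy_def)

end

lemma cf_simps [simp]:
  "cf 0 n = 0" "cf (f + g) n = cf f n + cf g n" "cf (- f) n = - cf f n"
  "cf (f - g) n = cf f n - cf g n" "cf (r *\<^sub>R f) n = of_real r * cf f n"
  by (rule cf_simps_raw)+

lemma fn_add [simp]: "fn (f + g) z = fn f z + fn g z"
proof (cases "z \<in> unit_disc")
  case True
  show ?thesis
    by (rule sums_unique2[OF cf_sums[OF True]])
       (use sums_add[OF cf_sums[OF True, of f] cf_sums[OF True, of g]] in \<open>simp add: algebra_simps\<close>)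
qed (simp add: fn_outside)

lemma hardy_uminus_eq: "- f = (-1) *\<^sub>h f"
  by (rule hardy_eqI_cf) simp

lemma fn_simps [simp]:
  "fn 0 z = 0" "fn (- f) z = - fn f z" "fn (f - g) z = fn f z - fn g z"
  "fn (r *\<^sub>R f) z = of_real r * fn f z"
proof -
  show "fn (- f) z = - fn f z" for f
    by (simp add: hardy_uminus_eq)
  then show "fn (f - g) z = fn f z - fn g z"
    by (metis add_uminus_conv_diff fn_add)
  show "fn (r *\<^sub>R f) z = of_real r * fn f z"
    by (simp add: scaleR_hardy_def)
  show "fn 0 z = 0"
    by (metis fn_add add_cancel_right_left)
qed

lemma fn_sum [simp]: "fn (\<Sum>i\<in>I. f i) z = (\<Sum>i\<in>I. fn (f i) z)"
  by (induction I rule: infinite_finite_induct) auto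

lemma cf_sum [simp]: "cf (\<Sum>i\<in>I. f i) n = (\<Sum>i\<in>I. cf (f i) n)"
  by (induction I rule: infinite_finite_induct) auto

lemma scaleC_simps [simp]:
  "0 *\<^sub>h f = 0" "1 *\<^sub>h f = f" "c *\<^sub>h 0 = 0" "c *\<^sub>h d *\<^sub>h f = (c * d) *\<^sub>h f"
  by (rule hardy_eqI_cf; simp)+

lemma scaleC_distribs:
  "c *\<^sub>h (f + g) = c *\<^sub>h f + c *\<^sub>h g" "c *\<^sub>h (f - g) = c *\<^sub>h f - c *\<^sub>h g"
  "(c + d) *\<^sub>h f = c *\<^sub>h f + d *\<^sub>h f" "(c - d) *\<^sub>h f = c *\<^sub>h f - d *\<^sub>h f"
  by (rule hardy_eqI_cf; simp add: algebra_simps)+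

lemma cinner_hardy_inner: "cinner f g = hardy_inner (fn f) (fn g)"
  by (simp add: cinner_def hardy_inner_def cf_def)

lemma inner_cinner: "inner f g = Re (cinner f g)"
  by (rule inner_hardy_def)

lemma cinner_add_left: "cinner (f + g) h = cinner f h + cinner g h"
  by (rule sums_unique2[OF cinner_sums])
     (use sums_add[OF cinner_sums[of f h] cinner_sums[of g h]] in \<open>simp add: algebra_simps\<close>)

lemma cinner_scaleC_left [simp]: "cinner (c *\<^sub>h f) g = c * cinner f g"
  by (rule sums_unique2[OF cinner_sums])
     (use sums_mult[OF cinner_sums[of f g], of c] in \<open>simp add: algebra_simps\<close>)

lemma cinner_commute: "cinner f g = cnj (cinner g f)"
  by (rule sums_unique2[OF cinner_sums])
     (use sums_cnj[THEN iffD2, OF cinner_sums[of g f]] in \<open>simp add: mult.commute\<close>)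

lemma cinner_add_right: "cinner f (g + h) = cinner f g + cinner f h"
  by (metis cinner_add_left cinner_commute complex_cnj_add)

lemma cinner_scaleC_right [simp]: "cinner f (c *\<^sub>h g) = cnj c * cinner f g"
  by (metis cinner_scaleC_left cinner_commute complex_cnj_mult)

lemma cinner_uminus [simp]: "cinner (- f) g = - cinner f g" "cinner f (- g) = - cinner f g"
  by (simp_all add: hardy_uminus_eq)

lemma cinner_diff_left: "cinner (f - g) h = cinner f h - cinner g h"
  by (metis add_uminus_conv_diff cinner_add_left cinner_uminus(1))

lemma cinner_diff_right: "cinner f (g - h) = cinner f g - cinner f h"
  by (metis add_uminus_conv_diff cinner_add_right cinner_uminus(2))

lemmas cinner_distribs = cinner_add_left cinner_add_right cinner_diff_left cinner_diff_right

lemma cinner_zero [simp]: "cinner 0 f = 0" "cinner f 0 = 0"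
  using cinner_scaleC_left[of 0 0 f] cinner_scaleC_right[of f 0 0] by simp_all

lemma cinner_self: "cinner f f = of_real ((norm f)\<^sup>2)"
proof (rule complex_eqI)
  show "Re (cinner f f) = Re (of_real ((norm f)\<^sup>2))"
    by (simp add: power2_norm_eq_inner inner_cinner)
  show "Im (cinner f f) = Im (of_real ((norm f)\<^sup>2))"
    using cinner_commute[of f f] by (metis Im_complex_of_real Reals_cnj_iff complex_is_Real_iff)
qed

lemma norm_sums: "(\<lambda>n. (cmod (cf f n))\<^sup>2) sums (norm f)\<^sup>2"
  using sums_Re[OF cinner_sums[of f f]] by (simp add: cinner_self complex_mult_cnj cmod_power2)

lemma norm_add_square: "(norm (f + g))\<^sup>2 = (norm f)\<^sup>2 + 2 * Re (cinner f g) + (norm g)\<^sup>2"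
proof -
  have "(norm (f + g))\<^sup>2 = (norm f)\<^sup>2 + 2 * inner f g + (norm g)\<^sup>2"
    by (simp add: power2_norm_eq_inner inner_commute algebra_simps)
  then show ?thesis by (simp add: inner_cinner)
qed

lemma norm_diff_square: "(norm (f - g))\<^sup>2 = (norm f)\<^sup>2 - 2 * Re (cinner f g) + (norm g)\<^sup>2"
  using norm_add_square[of f "- g"] by simp

lemma norm_hardy_norm: "norm f = hardy_norm (fn f)"
  by (simp add: hardy_norm_def norm_eq_sqrt_inner inner_cinner cinner_hardy_inner)

lemma norm_scaleC [simp]: "norm (c *\<^sub>h f) = cmod c * norm f"
proof -
  have "complex_of_real ((norm (c *\<^sub>h f))\<^sup>2) = cinner (c *\<^sub>h f) (c *\<^sub>h f)"
    by (rule cinner_self[symmetric])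
  also have "\<dots> = c * cnj c * cinner f f"
    by simp
  also have "\<dots> = of_real ((cmod c * norm f)\<^sup>2)"
    by (simp only: complex_norm_square[symmetric] cinner_self of_real_mult of_real_power
        power_mult_distrib)
  finally have "complex_of_real ((norm (c *\<^sub>h f))\<^sup>2) = of_real ((cmod c * norm f)\<^sup>2)" .
  then have "(norm (c *\<^sub>h f))\<^sup>2 = (cmod c * norm f)\<^sup>2"
    using of_real_eq_iff by blast
  then show ?thesis
    by (simp add: power2_eq_iff_nonneg)
qed

lemma cinner_cauchy_schwarz: "cmod (cinner f g) \<le> norm f * norm g"
proof -
  \<comment> \<open>Rotating \<open>f\<close> by this phase makes the scalar product real and
    nonnegative, so the real inequality applies; \<open>sgn 0 = 0\<close> covers the degenerate
    case.\<close>
  define c where "c = cnj (sgn (cinner f g))"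
  have "c * cinner f g = of_real (cmod (cinner f g))"
    using complex_norm_square[of "cinner f g"]
    by (cases "cinner f g = 0") (auto simp: c_def sgn_eq field_simps power2_eq_square)
  then have "cmod (cinner f g) = inner (c *\<^sub>h f) g"
    by (simp add: inner_cinner)
  also have "\<dots> \<le> norm (c *\<^sub>h f) * norm g"
    by (rule norm_cauchy_schwarz)
  also have "\<dots> \<le> norm f * norm g"
    by (intro mult_right_mono) (auto simp: c_def norm_sgn)
  finally show ?thesis .
qed

lemma cf_bound: "cmod (cf f n) \<le> norm f"
proof -
  have "(cmod (cf f n))\<^sup>2 = sum (\<lambda>n. (cmod (cf f n))\<^sup>2) {n}"
    by simp
  also have "\<dots> \<le> (norm f)\<^sup>2"
    using sum_le_suminf[of "\<lambda>n. (cmod (cf f n))\<^sup>2" "{n}"] norm_sums[of f]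
    by (auto simp: sums_iff)
  finally show ?thesis
    by (simp add: power2_le_iff_abs_le)
qed

lemma norm_le_of_partial_sums:
  assumes "\<And>N. (\<Sum>n<N. (cmod (a n))\<^sup>2) \<le> C\<^sup>2" "0 \<le> C"
  shows "square_summable a" "norm (of_cf a) \<le> C"
proof -
  show *: "square_summable a"
    unfolding square_summable_def
    by (rule summableI_nonneg_bounded[OF _ assms(1)]) simp
  have "(\<lambda>n. (cmod (a n))\<^sup>2) sums (norm (of_cf a))\<^sup>2"
    using norm_sums[of "of_cf a"] by (simp add: cf_of_cf[OF *])
  then have "(norm (of_cf a))\<^sup>2 \<le> C\<^sup>2"
    unfolding sums_def by (rule LIMSEQ_le_const2) (use assms(1) in blast)
  then show "norm (of_cf a) \<le> C"
    using assms(2) by (rule power2_le_imp_le)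
qed

lemma sum_cf_le: "(\<Sum>n<N. (cmod (cf f n))\<^sup>2) \<le> (norm f)\<^sup>2"
  using norm_sums[of f] sum_le_suminf[of "\<lambda>n. (cmod (cf f n))\<^sup>2" "{..<N}"]
  by (auto simp: sums_iff)

text \<open>The coefficients converge one by one. The Cauchy bound passes to the limit on each
  finite partial sum, and such bounds, uniform in \<open>N\<close>, give both square summability and
  the norm estimate.\<close>

instance hardy :: complete_space
proof
  fix X :: "nat \<Rightarrow> hardy" assume X: "Cauchy X"
  have "Cauchy (\<lambda>k. cf (X k) n)" for n
  proof (rule CauchyI)
    fix e :: real assume "e > 0"
    with X obtain M where M: "\<And>k l. k \<ge> M \<Longrightarrow> l \<ge> M \<Longrightarrow> norm (X k - X l) < e"
      unfolding Cauchy_iff by meson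
    have "cmod (cf (X k) n - cf (X l) n) < e" if "k \<ge> M" "l \<ge> M" for k l
      using cf_bound[of "X k - X l" n] M[OF that] by simp
    then show "\<exists>M. \<forall>k\<ge>M. \<forall>l\<ge>M. cmod (cf (X k) n - cf (X l) n) < e" by blast
  qed
  then have "\<forall>n. \<exists>a. (\<lambda>k. cf (X k) n) \<longlonglongrightarrow> a"
    using Cauchy_convergent convergent_def by blast
  then obtain a where a: "\<And>n. (\<lambda>k. cf (X k) n) \<longlonglongrightarrow> a n" by metis
  have tail: "\<exists>M. \<forall>k\<ge>M. square_summable (\<lambda>n. a n - cf (X k) n) \<and>
      norm (of_cf (\<lambda>n. a n - cf (X k) n)) \<le> e" if "e > 0" for e
  proof -
    from X \<open>e > 0\<close> obtain M where M: "\<And>k l. k \<ge> M \<Longrightarrow> l \<ge> M \<Longrightarrow> norm (X k - X l) < e"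
      unfolding Cauchy_iff by meson
    have *: "(\<Sum>n<N. (cmod (a n - cf (X k) n))\<^sup>2) \<le> e\<^sup>2" if "k \<ge> M" for k N
    proof (rule LIMSEQ_le_const2)
      show "(\<lambda>l. \<Sum>n<N. (cmod (cf (X l) n - cf (X k) n))\<^sup>2)
          \<longlonglongrightarrow> (\<Sum>n<N. (cmod (a n - cf (X k) n))\<^sup>2)"
        by (intro tendsto_intros a)
      have "(\<Sum>n<N. (cmod (cf (X l) n - cf (X k) n))\<^sup>2) \<le> e\<^sup>2" if "l \<ge> M" for l
      proof -
        have "(\<Sum>n<N. (cmod (cf (X l) n - cf (X k) n))\<^sup>2) \<le> (norm (X l - X k))\<^sup>2"
          using sum_cf_le[of "X l - X k" N] by simp
        also have "\<dots> \<le> e\<^sup>2"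
          using M[OF \<open>l \<ge> M\<close> \<open>k \<ge> M\<close>] by (intro power_mono) auto
        finally show ?thesis .
      qed
      then show "\<exists>N'. \<forall>l\<ge>N'. (\<Sum>n<N. (cmod (cf (X l) n - cf (X k) n))\<^sup>2) \<le> e\<^sup>2" by blast
    qed
    show ?thesis
      using norm_le_of_partial_sums[OF *] that by (intro exI[of _ M]) auto
  qed
  from tail[of 1] obtain M where "square_summable (\<lambda>n. a n - cf (X M) n)" by auto
  from square_summable_add[OF this square_summable_cf[of "X M"]]
  have sa: "square_summable a" by simp
  have "X \<longlonglongrightarrow> of_cf a"
  proof (rule LIMSEQ_I)
    fix e :: real assume "e > 0"
    with tail[of "e/2"] obtain M where
      M: "\<And>k. k \<ge> M \<Longrightarrow> square_summable (\<lambda>n. a n - cf (X k) n) \<and>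
        norm (of_cf (\<lambda>n. a n - cf (X k) n)) \<le> e/2" by auto
    have "norm (X k - of_cf a) < e" if "k \<ge> M" for k
    proof -
      have "of_cf (\<lambda>n. a n - cf (X k) n) = of_cf a - X k"
        by (rule hardy_eqI_cf) (use M[OF that] sa in \<open>simp add: cf_of_cf\<close>)
      then show ?thesis
        using M[OF that] \<open>e > 0\<close> by (simp add: norm_minus_commute)
    qed
    then show "\<exists>no. \<forall>n\<ge>no. norm (X n - of_cf a) < e" by blast
  qed
  then show "convergent X" by (auto simp: convergent_def)
qed

section \<open>Orthogonality and spans\<close>

text \<open>The parallelogram law makes a minimising sequence Cauchy, and its limit is compared with
  the translates along \<open>t\<close>.\<close>

lemma closed_subspace_projection:
  fixes S :: "'a::{real_inner, complete_space} set"
  assumes "closed S" "subspace S"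
  shows "\<exists>s\<in>S. \<forall>t\<in>S. inner (x - s) t = 0"
proof -
  define d where "d = infdist x S"
  have S0: "S \<noteq> {}" using subspace_0[OF assms(2)] by blast
  have d0: "d \<ge> 0" by (simp add: d_def infdist_nonneg)
  have d_le: "d \<le> norm (x - s)" if "s \<in> S" for s
    using infdist_le[OF that, of x] by (simp add: d_def dist_norm)
  have "\<exists>s\<in>S. (norm (x - s))\<^sup>2 < d\<^sup>2 + 1 / real (Suc n)" for n
  proof -
    have "d < sqrt (d\<^sup>2 + 1 / real (Suc n))"
      using d0 by (intro real_less_rsqrt) simp
    then obtain s where s: "s \<in> S" "dist x s < sqrt (d\<^sup>2 + 1 / real (Suc n))"
      using cInf_lessD[of "dist x ` S"] S0 by (auto simp: d_def infdist_notempty)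
    then have "(norm (x - s))\<^sup>2 < (sqrt (d\<^sup>2 + 1 / real (Suc n)))\<^sup>2"
      by (intro power_strict_mono) (auto simp: dist_norm)
    also have "\<dots> = d\<^sup>2 + 1 / real (Suc n)"
      by (intro real_sqrt_pow2) (simp add: add_nonneg_nonneg)
    finally show ?thesis using s(1) by blast
  qed
  then obtain s where s: "\<And>n. s n \<in> S" "\<And>n. (norm (x - s n))\<^sup>2 < d\<^sup>2 + 1 / real (Suc n)"
    by metis
  have par: "(norm (s m - s n))\<^sup>2 \<le> 2 / real (Suc m) + 2 / real (Suc n)" for m n
  proof -
    have "(1/2) *\<^sub>R (s m + s n) \<in> S"
      using s(1) assms(2) by (intro subspace_scale subspace_add)
    from d_le[OF this] have "d\<^sup>2 \<le> (norm (x - (1/2) *\<^sub>R (s m + s n)))\<^sup>2"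
      using d0 by (intro power_mono)
    moreover have "(norm (s m - s n))\<^sup>2 = 2 * (norm (x - s m))\<^sup>2 + 2 * (norm (x - s n))\<^sup>2
        - 4 * (norm (x - (1/2) *\<^sub>R (s m + s n)))\<^sup>2"
      unfolding power2_norm_eq_inner by (simp add: inner_commute algebra_simps)
    ultimately show ?thesis
      using s(2)[of m] s(2)[of n] by simp
  qed
  have "Cauchy s"
  proof (rule CauchyI)
    fix e :: real assume "e > 0"
    then obtain N :: nat where N: "4 / e\<^sup>2 < real N"
      using reals_Archimedean2 by blast
    have "norm (s m - s n) < e" if "m \<ge> N" "n \<ge> N" for m n
    proof -
      have *: "2 / real (Suc k) < e\<^sup>2 / 2" if "k \<ge> N" for k
      proof -
        have "4 / e\<^sup>2 < real (Suc k)" using N that by linarith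
        then show ?thesis using \<open>e > 0\<close> by (simp add: field_simps)
      qed
      have "(norm (s m - s n))\<^sup>2 < e\<^sup>2"
        using par[of m n] *[OF that(1)] *[OF that(2)] by linarith
      then show ?thesis using \<open>e > 0\<close> by (simp add: power2_less_imp_less)
    qed
    then show "\<exists>M. \<forall>m\<ge>M. \<forall>n\<ge>M. norm (s m - s n) < e" by blast
  qed
  then obtain l where l: "s \<longlonglongrightarrow> l"
    using Cauchy_convergent convergent_def by blast
  have lS: "l \<in> S"
    using closed_sequentially[OF assms(1)] s(1) l by blast
  have "(\<lambda>n. d\<^sup>2 + 1 / real (Suc n)) \<longlonglongrightarrow> d\<^sup>2 + 0"
    by (intro tendsto_intros LIMSEQ_Suc[OF lim_1_over_n])
  moreover have "(\<lambda>n. (norm (x - s n))\<^sup>2) \<longlonglongrightarrow> (norm (x - l))\<^sup>2"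
    by (intro tendsto_intros l)
  ultimately have ld: "(norm (x - l))\<^sup>2 \<le> d\<^sup>2"
    using s(2) by (intro LIMSEQ_le[of _ "(norm (x - l))\<^sup>2" "\<lambda>n. d\<^sup>2 + 1 / real (Suc n)" "d\<^sup>2"])
      (auto intro: less_imp_le)
  have "inner (x - l) t = 0" if "t \<in> S" for t
  proof (cases "t = 0")
    case False
    \<comment> \<open>The translate of \<open>l\<close> along \<open>t\<close> that is nearest to
      \<open>x\<close>; it is closer than \<open>l\<close> unless the scalar product
      vanishes.\<close>
    define c where "c = inner (x - l) t / (norm t)\<^sup>2"
    have "l + c *\<^sub>R t \<in> S"
      using lS that assms(2) by (intro subspace_scale subspace_add)
    from d_le[OF this] have "d\<^sup>2 \<le> (norm (x - (l + c *\<^sub>R t)))\<^sup>2"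
      using d0 by (intro power_mono)
    also have "\<dots> = (norm (x - l))\<^sup>2 - 2 * c * inner (x - l) t + c\<^sup>2 * (norm t)\<^sup>2"
      unfolding power2_norm_eq_inner
      by (simp add: inner_commute algebra_simps power2_eq_square)
    also have "\<dots> = (norm (x - l))\<^sup>2 - (inner (x - l) t)\<^sup>2 / (norm t)\<^sup>2"
      using False by (simp add: c_def field_simps power2_eq_square)
    finally have "(inner (x - l) t)\<^sup>2 / (norm t)\<^sup>2 \<le> 0"
      using ld by linarith
    then show ?thesis
      using False by (simp add: divide_le_0_iff)
  qed simp
  with lS show ?thesis by blast
qed

definition csubspace :: "hardy set \<Rightarrow> bool" where
  "csubspace K \<longleftrightarrow> 0 \<in> K \<and> (\<forall>f\<in>K. \<forall>g\<in>K. f + g \<in> K) \<and> (\<forall>c. \<forall>f\<in>K. c *\<^sub>h f \<in> K)"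

lemma
  assumes "csubspace K"
  shows csubspace_0: "0 \<in> K"
    and csubspace_add: "f \<in> K \<Longrightarrow> g \<in> K \<Longrightarrow> f + g \<in> K"
    and csubspace_scaleC: "f \<in> K \<Longrightarrow> c *\<^sub>h f \<in> K"
    and csubspace_diff: "f \<in> K \<Longrightarrow> g \<in> K \<Longrightarrow> f - g \<in> K"
    and csubspace_subspace: "subspace K"
  using assms unfolding csubspace_def subspace_def
  by (auto simp: minus_hardy_def scaleR_hardy_def)

lemma csubspace_sum:
  assumes "csubspace K" "\<And>i. i \<in> I \<Longrightarrow> f i \<in> K"
  shows "(\<Sum>i\<in>I. f i) \<in> K"
  using assms(2)
  by (induction I rule: infinite_finite_induct) (auto intro: csubspace_0 csubspace_add assms(1))

definition combos :: "'i set \<Rightarrow> ('i \<Rightarrow> hardy) \<Rightarrow> hardy set" where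
  "combos I v = {(\<Sum>i\<in>J. c i *\<^sub>h v i) | J c. finite J \<and> J \<subseteq> I}"

lemma combosI: "finite J \<Longrightarrow> J \<subseteq> I \<Longrightarrow> (\<Sum>i\<in>J. c i *\<^sub>h v i) \<in> combos I v"
  by (auto simp: combos_def)

lemma combos_base: "i \<in> I \<Longrightarrow> v i \<in> combos I v"
  using combosI[of "{i}" I "\<lambda>_. 1" v] by simp

lemma combos_mono: "I \<subseteq> I' \<Longrightarrow> combos I v \<subseteq> combos I' v"
  unfolding combos_def by blast

lemma csubspace_combos: "csubspace (combos I v)"
  unfolding csubspace_def
proof (intro conjI ballI allI)
  show "0 \<in> combos I v"
    using combosI[of "{}" I "\<lambda>_. 0" v] by simp
next
  fix f g assume "f \<in> combos I v" "g \<in> combos I v"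
  then obtain J c J' c' where
    f: "finite J" "J \<subseteq> I" "f = (\<Sum>i\<in>J. c i *\<^sub>h v i)" and
    g: "finite J'" "J' \<subseteq> I" "g = (\<Sum>i\<in>J'. c' i *\<^sub>h v i)"
    unfolding combos_def by blast
  let ?c = "\<lambda>i. (if i \<in> J then c i else 0) + (if i \<in> J' then c' i else 0)"
  have 1: "f = (\<Sum>i\<in>J \<union> J'. (if i \<in> J then c i else 0) *\<^sub>h v i)"
    unfolding f(3) using f(1) g(1) by (intro sum.mono_neutral_cong_left) auto
  have 2: "g = (\<Sum>i\<in>J \<union> J'. (if i \<in> J' then c' i else 0) *\<^sub>h v i)"
    unfolding g(3) using f(1) g(1) by (intro sum.mono_neutral_cong_left) auto
  have "f + g = (\<Sum>i\<in>J \<union> J'. ?c i *\<^sub>h v i)"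
    unfolding scaleC_distribs sum.distrib using 1 2 by argo
  also have "\<dots> \<in> combos I v"
    using f g by (intro combosI) auto
  finally show "f + g \<in> combos I v" .
next
  fix d f assume "f \<in> combos I v"
  then obtain J c where f: "finite J" "J \<subseteq> I" "f = (\<Sum>i\<in>J. c i *\<^sub>h v i)"
    unfolding combos_def by blast
  have "d *\<^sub>h f = (\<Sum>i\<in>J. (d * c i) *\<^sub>h v i)"
    unfolding f(3) by (rule hardy_eqI_cf) (simp add: sum_distrib_left mult.assoc)
  also have "\<dots> \<in> combos I v"
    using f by (intro combosI) auto
  finally show "d *\<^sub>h f \<in> combos I v" .
qed

lemma combos_subset: "csubspace K \<Longrightarrow> (\<And>i. i \<in> I \<Longrightarrow> v i \<in> K) \<Longrightarrow> combos I v \<subseteq> K"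
  unfolding combos_def by (auto intro!: csubspace_sum csubspace_scaleC)

lemma bounded_linear_scaleC: "bounded_linear (\<lambda>f. c *\<^sub>h f)"
proof (rule bounded_linear_intro)
  show "c *\<^sub>h (f + g) = c *\<^sub>h f + c *\<^sub>h g" for f g
    by (rule scaleC_distribs)
  show "c *\<^sub>h (r *\<^sub>R f) = r *\<^sub>R (c *\<^sub>h f)" for r f
    by (rule hardy_eqI_cf) simp
  show "norm (c *\<^sub>h f) \<le> norm f * cmod c" for f
    by simp
qed

lemma bounded_linear_cinner_left: "bounded_linear (\<lambda>f. cinner f g)"
proof (rule bounded_linear_intro)
  show "cinner (f + f') g = cinner f g + cinner f' g" for f f'
    by (rule cinner_distribs)
  show "cinner (r *\<^sub>R f) g = r *\<^sub>R cinner f g" for r f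
    by (simp add: scaleR_hardy_def scaleR_conv_of_real)
  show "norm (cinner f g) \<le> norm f * norm g" for f
    by (rule cinner_cauchy_schwarz)
qed

lemmas tendsto_cinner_left = bounded_linear.tendsto[OF bounded_linear_cinner_left]

lemma csubspace_closure:
  assumes "csubspace K"
  shows "csubspace (closure K)"
  unfolding csubspace_def
proof (intro conjI ballI allI)
  show "0 \<in> closure K"
    using csubspace_0[OF assms] closure_subset by blast
next
  fix f g assume "f \<in> closure K" "g \<in> closure K"
  then obtain X Y where X: "\<And>n. X n \<in> K" "X \<longlonglongrightarrow> f" and Y: "\<And>n. Y n \<in> K" "Y \<longlonglongrightarrow> g"
    unfolding closure_sequential by blast
  then show "f + g \<in> closure K"
    unfolding closure_sequential using csubspace_add[OF assms]
    by (intro exI[of _ "\<lambda>n. X n + Y n"]) (auto intro: tendsto_add)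
next
  fix c f assume "f \<in> closure K"
  then obtain X where X: "\<And>n. X n \<in> K" "X \<longlonglongrightarrow> f"
    unfolding closure_sequential by blast
  have "(\<lambda>n. c *\<^sub>h X n) \<longlonglongrightarrow> c *\<^sub>h f"
    using X(2) by (rule bounded_linear.tendsto[OF bounded_linear_scaleC])
  then show "c *\<^sub>h f \<in> closure K"
    unfolding closure_sequential using X(1) csubspace_scaleC[OF assms]
    by (intro exI[of _ "\<lambda>n. c *\<^sub>h X n"]) auto
qed

lemma csubspace_projection:
  assumes "closed S" "csubspace S"
  shows "\<exists>s\<in>S. \<forall>t\<in>S. cinner (x - s) t = 0"
proof -
  obtain s where s: "s \<in> S" "\<And>t. t \<in> S \<Longrightarrow> inner (x - s) t = 0"
    using closed_subspace_projection[OF assms(1) csubspace_subspace[OF assms(2)]] by blast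
  have "cinner (x - s) t = 0" if "t \<in> S" for t
  proof -
    \<comment> \<open>Testing against \<open>\<i> *\<^sub>h t\<close> yields the imaginary part,
      because \<open>cinner\<close> is conjugate linear in the second argument.\<close>
    have "Re (cinner (x - s) t) = 0" "Re (cinner (x - s) (\<i> *\<^sub>h t)) = 0"
      using s(2)[of t] s(2)[of "\<i> *\<^sub>h t"] that csubspace_scaleC[OF assms(2)]
      by (auto simp: inner_cinner)
    then show ?thesis by (simp add: complex_eq_iff)
  qed
  with s(1) show ?thesis by blast
qed

text \<open>The residual of the projection onto the closed span is orthogonal to the family, hence
  0. For a family of kernels the last assumption says that their points form a uniqueness
  set.\<close>

lemma closure_combos_eq:
  assumes "closed K" "csubspace K" "\<And>i. i \<in> I \<Longrightarrow> v i \<in> K"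
    and "\<And>u. u \<in> K \<Longrightarrow> (\<And>i. i \<in> I \<Longrightarrow> cinner u (v i) = 0) \<Longrightarrow> u = 0"
  shows "closure (combos I v) = K"
proof
  show sub: "closure (combos I v) \<subseteq> K"
    using assms by (intro closure_minimal combos_subset) auto
  show "K \<subseteq> closure (combos I v)"
  proof
    fix x assume x: "x \<in> K"
    obtain s where s: "s \<in> closure (combos I v)"
      "\<And>t. t \<in> closure (combos I v) \<Longrightarrow> cinner (x - s) t = 0"
      using csubspace_projection[OF closed_closure csubspace_closure[OF csubspace_combos]] by blast
    have "x - s = 0"
    proof (rule assms(4))
      show "x - s \<in> K"
        using x s(1) sub by (intro csubspace_diff assms(2)) auto
      show "cinner (x - s) (v i) = 0" if "i \<in> I" for i
        using s(2) combos_base[OF that] closure_subset by blast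
    qed
    with s(1) show "x \<in> closure (combos I v)" by simp
  qed
qed

lemma closed_orthogonal: "closed {f. cinner f g = 0}"
  by (intro closed_Collect_eq continuous_intros
      linear_continuous_on[OF bounded_linear_cinner_left])

lemma closed_lin_span_eq:
  "closed_lin_span I (\<lambda>i. fn (v i)) = fn ` closure (combos I v)"
proof -
  have nrm: "hardy_norm (\<lambda>z. fn F z - (\<Sum>i\<in>J. c i * fn (v i) z)) = norm (F - (\<Sum>i\<in>J. c i *\<^sub>h v i))"
    for F J c
    unfolding norm_hardy_norm by (rule arg_cong[of _ _ hardy_norm]) auto
  have mem: "fn F \<in> closed_lin_span I (\<lambda>i. fn (v i)) \<longleftrightarrow> F \<in> closure (combos I v)" for F
  proof -
    have "(\<exists>y\<in>combos I v. dist y F < e) \<longleftrightarrow>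
        (\<exists>J c. finite J \<and> J \<subseteq> I \<and> norm (F - (\<Sum>i\<in>J. c i *\<^sub>h v i)) < e)" for e
      unfolding combos_def dist_norm norm_minus_commute[of _ F] by blast
    then show ?thesis
      using fn[of F] by (simp only: closed_lin_span_def closure_approachable mem_Collect_eq nrm simp_thms)
  qed
  show ?thesis
  proof (rule set_eqI)
    fix f
    show "f \<in> closed_lin_span I (\<lambda>i. fn (v i)) \<longleftrightarrow> f \<in> fn ` closure (combos I v)"
    proof (cases "f \<in> hardy_space")
      case True
      then obtain F where "f = fn F" using Hardy_inverse by metis
      then show ?thesis by (simp add: mem inj_image_mem_iff inj_def fn_inject)
    next
      case False
      then have "f \<noteq> fn F" for F using fn[of F] by auto
      then show ?thesis using False by (auto simp: closed_lin_span_def)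
    qed
  qed
qed

section \<open>The Szego kernel\<close>

definition szego :: "complex \<Rightarrow> hardy" where
  "szego w = of_cf (\<lambda>n. cnj w ^ n)"

lemma cf_szego: "w \<in> unit_disc \<Longrightarrow> cf (szego w) n = cnj w ^ n"
  unfolding szego_def by (intro cf_of_cf square_summable_geometric) simp

lemma fn_szego:
  assumes "w \<in> unit_disc" "z \<in> unit_disc"
  shows "fn (szego w) z = 1 / (1 - cnj w * z)"
  unfolding szego_def
proof (rule fn_of_cf_sums)
  have "cmod (cnj w * z) < 1"
    using assms by (simp add: norm_mult) (metis mult_strict_mono' norm_ge_zero mult_1)
  from geometric_sums[OF this] show "(\<lambda>n. cnj w ^ n * z ^ n) sums (1 / (1 - cnj w * z))"
    by (simp add: power_mult_distrib)
qed (use assms in \<open>auto intro: square_summable_geometric\<close>)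

lemma cinner_szego:
  assumes "w \<in> unit_disc"
  shows "cinner f (szego w) = fn f w"
  by (rule sums_unique2[OF cinner_sums]) (use cf_sums[OF assms, of f] in \<open>simp add: cf_szego[OF assms]\<close>)

lemma norm_szego:
  assumes "w \<in> unit_disc"
  shows "(norm (szego w))\<^sup>2 = 1 / (1 - (cmod w)\<^sup>2)"
proof -
  have "complex_of_real ((norm (szego w))\<^sup>2) = fn (szego w) w"
    using cinner_szego[OF assms, of "szego w"] cinner_self by metis
  also have "\<dots> = of_real (1 / (1 - (cmod w)\<^sup>2))"
    using fn_szego[OF assms assms] complex_norm_square[of w] by (simp add: mult.commute)
  finally show ?thesis
    using of_real_eq_iff by blast
qed

lemma fn_bound:
  assumes "z \<in> unit_disc"
  shows "(cmod (fn f z))\<^sup>2 \<le> (norm f)\<^sup>2 / (1 - (cmod z)\<^sup>2)"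
proof -
  have "cmod (fn f z) \<le> norm f * norm (szego z)"
    using cinner_cauchy_schwarz[of f "szego z"] unfolding cinner_szego[OF assms] .
  then have "(cmod (fn f z))\<^sup>2 \<le> (norm f * norm (szego z))\<^sup>2"
    by (intro power_mono) auto
  then show ?thesis
    by (simp add: power_mult_distrib norm_szego[OF assms])
qed

lemma bounded_linear_fn: "bounded_linear (\<lambda>f. fn f z)"
proof (cases "z \<in> unit_disc")
  case True
  show ?thesis
    using bounded_linear_cinner_left[of "szego z", unfolded cinner_szego[OF True]] .
next
  case False
  then show ?thesis
    unfolding fn_outside[OF False] by simp
qed

lemmas tendsto_fn = bounded_linear.tendsto[OF bounded_linear_fn]

lemma closure_combos_szego: "closure (combos unit_disc szego) = UNIV"
proof (rule closure_combos_eq)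
  fix u assume "\<And>z. z \<in> unit_disc \<Longrightarrow> cinner u (szego z) = 0"
  then show "u = 0"
    using cinner_szego by (intro hardy_eqI) (metis fn_simps(1))
qed (auto simp: csubspace_def)

text \<open>\<open>h\<close> is approximated from the total family with an error uniform in
  \<open>n\<close>, thanks to the bound on \<open>X\<close>. Applied to the Szego kernels, it turns
  bounded pointwise convergence into weak convergence.\<close>

lemma tendsto_cinner_of_total:
  assumes bounded: "\<And>n. norm (X n) \<le> C" and total: "closure (combos I v) = UNIV"
    and lim: "\<And>i. i \<in> I \<Longrightarrow> (\<lambda>n. cinner (v i) (X n)) \<longlonglongrightarrow> cinner (v i) x"
  shows "(\<lambda>n. cinner h (X n)) \<longlonglongrightarrow> cinner h x"
proof -
  let ?S = "{h. (\<lambda>n. cinner h (X n)) \<longlonglongrightarrow> cinner h x}"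
  have combos: "combos I v \<subseteq> ?S"
    by (rule combos_subset)
       (auto simp: csubspace_def cinner_distribs lim intro!: tendsto_intros)
  have C: "C \<ge> 0" using bounded[of 0] norm_ge_zero order_trans by blast
  show ?thesis
  proof (rule LIMSEQ_I)
    fix e :: real assume e: "e > 0"
    define B where "B = C + norm x + 1"
    have B: "B > 0" using C by (simp add: B_def add_nonneg_pos)
    have "h \<in> closure (combos I v)" using total by simp
    then obtain g where g: "g \<in> combos I v" "dist g h < e / (2 * B)"
      unfolding closure_approachable using e B by (meson divide_pos_pos mult_pos_pos zero_less_numeral)
    with combos have "(\<lambda>n. cinner g (X n)) \<longlonglongrightarrow> cinner g x" by auto
    from LIMSEQ_D[OF this, of "e/2"] e obtain N where
      N: "\<And>n. n \<ge> N \<Longrightarrow> cmod (cinner g (X n) - cinner g x) < e / 2" by auto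
    have "cmod (cinner h (X n) - cinner h x) < e" if "n \<ge> N" for n
    proof -
      have "cinner h (X n) - cinner h x
          = (cinner g (X n) - cinner g x) + cinner (h - g) (X n - x)"
        by (simp add: cinner_distribs)
      then have "cmod (cinner h (X n) - cinner h x)
          \<le> cmod (cinner g (X n) - cinner g x) + cmod (cinner (h - g) (X n - x))"
        by (metis norm_triangle_ineq)
      moreover have "cmod (cinner (h - g) (X n - x)) \<le> e / (2 * B) * B"
      proof (rule order_trans[OF cinner_cauchy_schwarz], rule mult_mono)
        show "norm (h - g) \<le> e / (2 * B)"
          using g(2) by (simp add: dist_norm norm_minus_commute)
        show "norm (X n - x) \<le> B"
          using norm_triangle_ineq4[of "X n" x] bounded[of n] by (simp add: B_def)
      qed (use e B in auto)
      ultimately show ?thesis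
        using N[OF that] B by simp
    qed
    then show "\<exists>no. \<forall>n\<ge>no. cmod (cinner h (X n) - cinner h x) < e" by blast
  qed
qed

section \<open>Means over circles\<close>

definition circle_mean :: "(complex \<Rightarrow> complex) \<Rightarrow> real \<Rightarrow> real" where
  "circle_mean f r = integral {0..2*pi} (\<lambda>t. (cmod (f (of_real r * cis t)))\<^sup>2) / (2 * pi)"

lemma circle_in_disc: "0 \<le> r \<Longrightarrow> r < 1 \<Longrightarrow> of_real r * cis t \<in> unit_disc"
  by (simp add: norm_mult)

lemma continuous_on_circle:
  assumes "f holomorphic_on unit_disc" "0 \<le> r" "r < 1"
  shows "continuous_on A (\<lambda>t. f (of_real r * cis t))"
proof (rule continuous_on_compose2[OF holomorphic_on_imp_continuous_on[OF assms(1)]])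
  show "continuous_on A (\<lambda>t. of_real r * cis t)"
    by (intro continuous_intros)
qed (use circle_in_disc[OF assms(2,3)] in auto)

lemma has_integral_cis:
  fixes k :: int
  shows "((\<lambda>t. cis (of_int k * t)) has_integral (if k = 0 then 2 * pi else 0)) {0..2*pi}"
proof (cases "k = 0")
  case True
  have "((\<lambda>t. 1::complex) has_integral (2 * pi - 0) *\<^sub>R 1) {0..2*pi}"
    using has_integral_const_real[of "1::complex" 0 "2*pi"] by simp
  with True show ?thesis by (simp add: scaleR_conv_of_real)
next
  case False
  define F where "F z = exp (\<i> * of_int k * z) / (\<i> * of_int k)" for z :: complex
  have "(F has_field_derivative exp (\<i> * of_int k * z)) (at z)" for z
    unfolding F_def using False by (auto intro!: derivative_eq_intros)
  then have "((\<lambda>t. F (of_real t)) has_vector_derivative cis (of_int k * t)) (at t within S)" for t S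
    using has_vector_derivative_real_field[of F _ t S] by (simp add: cis_conv_exp mult.assoc)
  then have "((\<lambda>t. cis (of_int k * t)) has_integral (F (of_real (2*pi)) - F (of_real 0))) {0..2*pi}"
    by (intro fundamental_theorem_of_calculus) auto
  moreover have "F (of_real (2*pi)) = F (of_real 0)"
  proof -
    have "exp (\<i> * of_int k * of_real (2*pi)) = cis (2 * pi * of_int k)"
      by (simp add: cis_conv_exp mult_ac)
    also have "\<dots> = 1"
      using cis_multiple_2pi[of "of_int k"] by simp
    finally show ?thesis by (simp add: F_def)
  qed
  ultimately show ?thesis using False by simp
qed

text \<open>Parseval on the circle of radius \<open>r\<close>: Taylor polynomials converge uniformly
  there, and the integral of their squared modulus keeps only the diagonal terms.\<close>

lemma circle_mean_sums:
  assumes f: "f holomorphic_on unit_disc" and r: "0 \<le> r" "r < 1"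
  shows "(\<lambda>n. (cmod (taylor_coeff f n))\<^sup>2 * r ^ (2 * n)) sums circle_mean f r"
proof -
  define a where "a = taylor_coeff f"
  define P where "P N t = (\<Sum>n<N. a n * (of_real r * cis t) ^ n)" for N t
  define g where "g t = f (of_real r * cis t)" for t
  \<comment> \<open>A radius strictly beyond \<open>r\<close> gives absolute convergence at
    \<open>r\<close>, as the M-test requires.\<close>
  obtain s where s: "r < s" "s < 1" using dense[OF r(2)] by blast
  have "summable (\<lambda>n. a n * of_real s ^ n)"
    using taylor_coeff_sums[OF f, of "of_real s"] s r by (simp add: a_def sums_iff)
  from powser_insidea[OF this, of "of_real r"]
  have M: "summable (\<lambda>n. cmod (a n) * r ^ n)"
    using s r by (simp add: norm_mult norm_power)
  have lim: "uniform_limit {0..2*pi} P g sequentially"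
  proof -
    have "uniform_limit {0..2*pi} P (\<lambda>t. \<Sum>n. a n * (of_real r * cis t) ^ n) sequentially"
      unfolding P_def
      by (rule Weierstrass_m_test[OF _ M]) (use r in \<open>simp add: norm_mult norm_power\<close>)
    moreover have "(\<Sum>n. a n * (of_real r * cis t) ^ n) = g t" for t
      using taylor_coeff_sums[OF f circle_in_disc[OF r, of t]] by (simp add: a_def g_def sums_iff)
    ultimately show ?thesis by simp
  qed
  have cont: "continuous_on {0..2*pi} g"
    unfolding g_def by (rule continuous_on_circle[OF f r])
  have bdd: "bounded (g ` {0..2*pi})"
    by (intro compact_imp_bounded compact_continuous_image cont) simp
  have "bounded ((\<lambda>t. cnj (g t)) ` {0..2*pi})"
    by (intro compact_imp_bounded compact_continuous_image continuous_intros cont) simp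
  then have "uniform_limit {0..2*pi} (\<lambda>N t. P N t * cnj (P N t)) (\<lambda>t. g t * cnj (g t)) sequentially"
    by (intro uniform_lim_mult lim bdd uniform_limit_intros)
  moreover have "continuous_on {0..2*pi} (\<lambda>t. P N t * cnj (P N t))" for N
    unfolding P_def by (intro continuous_intros)
  ultimately obtain I J where IJ:
    "\<And>N. ((\<lambda>t. P N t * cnj (P N t)) has_integral I N) {0..2*pi}"
    "((\<lambda>t. g t * cnj (g t)) has_integral J) {0..2*pi}" "I \<longlonglongrightarrow> J"
    by (rule uniform_limit_integral) auto
  have I: "I N = of_real (2 * pi * (\<Sum>n<N. (cmod (a n))\<^sup>2 * r ^ (2 * n)))" for N
  proof -
    have e: "P N t * cnj (P N t) = (\<Sum>n<N. \<Sum>m<N. a n * cnj (a m) * of_real (r ^ (n + m)) *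
        cis (of_int (int n - int m) * t))" for t
    proof -
      have "cis t ^ n * cnj (cis t ^ m) = cis (of_int (int n - int m) * t)" for n m
        by (simp add: Complex.DeMoivre cis_cnj cis_mult algebra_simps)
      then show ?thesis
        unfolding P_def cnj_sum sum_product
        by (intro sum.cong refl) (simp add: power_mult_distrib power_add mult_ac)
    qed
    have "((\<lambda>t. P N t * cnj (P N t)) has_integral
        (\<Sum>n<N. \<Sum>m<N. a n * cnj (a m) * of_real (r ^ (n + m)) *
           (if int n - int m = 0 then 2 * pi else 0))) {0..2*pi}"
      unfolding e by (intro has_integral_sum has_integral_mult_right has_integral_cis) auto
    with IJ(1)[of N] have "I N = (\<Sum>n<N. \<Sum>m<N. a n * cnj (a m) * of_real (r ^ (n + m)) *
           (if int n - int m = 0 then 2 * pi else 0))"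
      by (rule has_integral_unique)
    also have "\<dots> = (\<Sum>n<N. a n * cnj (a n) * of_real (r ^ (n + n)) * (2 * pi))"
      by (intro sum.cong refl) (simp add: if_distrib cong: if_cong)
    also have "\<dots> = of_real (2 * pi * (\<Sum>n<N. (cmod (a n))\<^sup>2 * r ^ (2 * n)))"
      unfolding complex_norm_square[symmetric] of_real_mult of_real_sum sum_distrib_left mult_2
      by (intro sum.cong refl) (simp add: mult_ac)
    finally show ?thesis .
  qed
  have "(\<lambda>N. Re (I N) / (2 * pi)) \<longlonglongrightarrow> Re J / (2 * pi)"
    by (intro tendsto_intros IJ(3)) simp
  then have "(\<lambda>n. (cmod (a n))\<^sup>2 * r ^ (2 * n)) sums (Re J / (2 * pi))"
    by (simp add: I sums_def)
  moreover have "Re J / (2 * pi) = circle_mean f r"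
  proof -
    have "((\<lambda>t. (cmod (g t))\<^sup>2) has_integral Re J) {0..2*pi}"
      using has_integral_Re[OF IJ(2)] by (simp add: complex_mult_cnj cmod_power2)
    then show ?thesis
      by (simp add: circle_mean_def g_def integral_unique)
  qed
  ultimately show ?thesis by (simp add: a_def)
qed

lemma circle_mean_mono:
  assumes "f holomorphic_on unit_disc" "g holomorphic_on unit_disc" "0 \<le> r" "r < 1" "C \<ge> 0"
    and "\<And>z. cmod z = r \<Longrightarrow> cmod (f z) \<le> C * cmod (g z)"
  shows "circle_mean f r \<le> C\<^sup>2 * circle_mean g r"
proof -
  have "integral {0..2*pi} (\<lambda>t. (cmod (f (of_real r * cis t)))\<^sup>2)
      \<le> integral {0..2*pi} (\<lambda>t. C\<^sup>2 * (cmod (g (of_real r * cis t)))\<^sup>2)"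
  proof (rule integral_le)
    show "(cmod (f (of_real r * cis t)))\<^sup>2 \<le> C\<^sup>2 * (cmod (g (of_real r * cis t)))\<^sup>2" for t
      using assms(6)[of "of_real r * cis t"] assms(3)
      by (simp add: norm_mult power_mult_distrib[symmetric] power_mono)
  qed (intro integrable_continuous_real continuous_intros continuous_on_circle assms)+
  then show ?thesis
    by (simp add: circle_mean_def divide_right_mono)
qed

lemma circle_mean_le_norm:
  assumes "0 \<le> r" "r < 1"
  shows "circle_mean (fn f) r \<le> (norm f)\<^sup>2"
proof (rule sums_le[OF _ circle_mean_sums[OF fn_holomorphic assms] norm_sums])
  fix n
  have "r ^ (2 * n) \<le> 1" using assms by (intro power_le_one) auto
  then show "(cmod (taylor_coeff (fn f) n))\<^sup>2 * r ^ (2 * n) \<le> (cmod (cf f n))\<^sup>2"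
    by (simp add: cf_def mult_left_le)
qed

definition to_hardy :: "(complex \<Rightarrow> complex) \<Rightarrow> hardy" where
  "to_hardy f = of_cf (taylor_coeff f)"

lemma fn_to_hardy:
  assumes "f holomorphic_on unit_disc" "square_summable (taylor_coeff f)" "z \<in> unit_disc"
  shows "fn (to_hardy f) z = f z"
  unfolding to_hardy_def by (rule fn_of_cf_sums[OF assms(2,3) taylor_coeff_sums[OF assms(1,3)]])

text \<open>Each partial sum is continuous up to \<open>r = 1\<close>, so radii near 1 decide. A
  bound for radii above \<open>\<rho>\<close> is what is available for a quotient by
  \<open>z - \<mu>\<close>, whose means are controlled on circles away from
  \<open>\<mu>\<close>.\<close>

lemma partial_sums_le:
  assumes f: "f holomorphic_on unit_disc" and "\<rho> < 1"
    and C: "\<And>r. \<rho> \<le> r \<Longrightarrow> 0 \<le> r \<Longrightarrow> r < 1 \<Longrightarrow> circle_mean f r \<le> C\<^sup>2"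
  shows "(\<Sum>n<N. (cmod (taylor_coeff f n))\<^sup>2) \<le> C\<^sup>2"
proof -
  let ?S = "\<lambda>r::real. (\<Sum>n<N. (cmod (taylor_coeff f n))\<^sup>2 * r ^ (2 * n))"
  have "(?S \<longlongrightarrow> ?S 1) (at_left 1)"
    by (intro tendsto_intros)
  moreover have "\<forall>\<^sub>F r in at_left 1. ?S r \<le> C\<^sup>2"
  proof -
    have "\<forall>\<^sub>F r in at_left (1::real). max \<rho> 0 < r \<and> r < 1"
      using eventually_at_left_real[of "max \<rho> 0" 1] assms(2) by (auto elim: eventually_mono)
    then show ?thesis
    proof (rule eventually_mono)
      fix r :: real assume r: "max \<rho> 0 < r \<and> r < 1"
      then have s: "(\<lambda>n. (cmod (taylor_coeff f n))\<^sup>2 * r ^ (2 * n)) sums circle_mean f r"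
        by (intro circle_mean_sums f) auto
      have "?S r \<le> circle_mean f r"
        using sum_le_suminf[of "\<lambda>n. (cmod (taylor_coeff f n))\<^sup>2 * r ^ (2 * n)" "{..<N}"] s r
        by (auto simp: sums_iff)
      also have "\<dots> \<le> C\<^sup>2" using C[of r] r by auto
      finally show "?S r \<le> C\<^sup>2" .
    qed
  qed
  ultimately have "?S 1 \<le> C\<^sup>2"
    by (rule tendsto_upperbound) simp
  then show ?thesis by simp
qed

lemma
  assumes "f holomorphic_on unit_disc" "\<rho> < 1" "C \<ge> 0"
    and "\<And>r. \<rho> \<le> r \<Longrightarrow> 0 \<le> r \<Longrightarrow> r < 1 \<Longrightarrow> circle_mean f r \<le> C\<^sup>2"
  shows square_summable_of_means: "square_summable (taylor_coeff f)"
    and norm_to_hardy_le: "norm (to_hardy f) \<le> C"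
  unfolding to_hardy_def
  using norm_le_of_partial_sums[OF partial_sums_le[OF assms(1,2,4)] assms(3)] by blast+

text \<open>By \<open>fn_bound\<close> the functions are uniformly bounded on each circle, so
  dominated convergence carries the bound on the means over to \<open>f\<close>. This replaces the
  extraction of weakly convergent subsequences.\<close>

lemma hardy_exists_of_bounded_limit:
  assumes f: "f holomorphic_on unit_disc" and C: "\<And>n. norm (F n) \<le> C"
    and lim: "\<And>z. z \<in> unit_disc \<Longrightarrow> (\<lambda>n. fn (F n) z) \<longlonglongrightarrow> f z"
  shows "\<exists>G. norm G \<le> C \<and> (\<forall>z\<in>unit_disc. fn G z = f z)"
proof -
  have C0: "C \<ge> 0" using C[of 0] norm_ge_zero order_trans by blast
  have "circle_mean f r \<le> C\<^sup>2" if r: "0 \<le> r" "r < 1" for r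
  proof -
    have "(\<lambda>n. integral {0..2*pi} (\<lambda>t. (cmod (fn (F n) (of_real r * cis t)))\<^sup>2))
        \<longlonglongrightarrow> integral {0..2*pi} (\<lambda>t. (cmod (f (of_real r * cis t)))\<^sup>2)"
    proof (rule dominated_convergence(2))
      show "(\<lambda>t. (cmod (fn (F n) (of_real r * cis t)))\<^sup>2) integrable_on {0..2*pi}" for n
        by (intro integrable_continuous_real continuous_intros continuous_on_circle fn_holomorphic r)
      show "(\<lambda>t. C\<^sup>2 / (1 - r\<^sup>2)) integrable_on {0..2*pi}"
        by (intro integrable_continuous_real continuous_intros)
      show "norm ((cmod (fn (F n) (of_real r * cis t)))\<^sup>2) \<le> C\<^sup>2 / (1 - r\<^sup>2)" for n t
      proof -
        have "(cmod (fn (F n) (of_real r * cis t)))\<^sup>2 \<le> (norm (F n))\<^sup>2 / (1 - r\<^sup>2)"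
          using fn_bound[OF circle_in_disc[OF r], of "F n" t] r by (simp add: norm_mult)
        also have "\<dots> \<le> C\<^sup>2 / (1 - r\<^sup>2)"
          using r C[of n] by (intro divide_right_mono power_mono) (auto simp: abs_square_le_1)
        finally show ?thesis by simp
      qed
      show "(\<lambda>n. (cmod (fn (F n) (of_real r * cis t)))\<^sup>2)
          \<longlonglongrightarrow> (cmod (f (of_real r * cis t)))\<^sup>2" for t
        by (intro tendsto_intros lim circle_in_disc r)
    qed
    then have "(\<lambda>n. circle_mean (fn (F n)) r) \<longlonglongrightarrow> circle_mean f r"
      unfolding circle_mean_def by (intro tendsto_intros) auto
    moreover have "circle_mean (fn (F n)) r \<le> C\<^sup>2" for n
      using circle_mean_le_norm[OF r, of "F n"] power_mono[OF C[of n], of 2] by simp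
    ultimately show ?thesis
      by (intro LIMSEQ_le_const2) auto
  qed
  note * = square_summable_of_means[OF f zero_less_one C0 this]
    norm_to_hardy_le[OF f zero_less_one C0 this]
  show ?thesis
    using * fn_to_hardy[OF f] by (intro exI[of _ "to_hardy f"]) blast
qed

section \<open>Multipliers\<close>

definition mult :: "(complex \<Rightarrow> complex) \<Rightarrow> hardy \<Rightarrow> hardy" where
  "mult F g = to_hardy (\<lambda>z. F z * fn g z)"

lemma
  assumes F: "F holomorphic_on unit_disc" and M: "\<And>z. z \<in> unit_disc \<Longrightarrow> cmod (F z) \<le> M"
  shows fn_mult: "fn (mult F g) z = F z * fn g z"
    and norm_mult_le: "norm (mult F g) \<le> M * norm g"
proof -
  let ?f = "\<lambda>z. F z * fn g z"
  have M0: "M \<ge> 0" by (rule order_trans[OF norm_ge_zero[of "F 0"] M]) simp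
  have hol: "?f holomorphic_on unit_disc"
    by (intro holomorphic_intros F fn_holomorphic)
  have "circle_mean ?f r \<le> (M * norm g)\<^sup>2" if r: "0 \<le> r" "r < 1" for r
  proof -
    have "circle_mean ?f r \<le> M\<^sup>2 * circle_mean (fn g) r"
      using r M by (intro circle_mean_mono hol fn_holomorphic M0)
        (auto simp: norm_mult intro!: mult_right_mono)
    also have "\<dots> \<le> (M * norm g)\<^sup>2"
      unfolding power_mult_distrib by (intro mult_left_mono circle_mean_le_norm r) auto
    finally show ?thesis .
  qed
  note * = square_summable_of_means[OF hol zero_less_one _ this]
    norm_to_hardy_le[OF hol zero_less_one _ this]
  show "norm (mult F g) \<le> M * norm g"
    unfolding mult_def using * M0 by simp
  show "fn (mult F g) z = F z * fn g z"
  proof (cases "z \<in> unit_disc")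
    case True
    then show ?thesis
      unfolding mult_def using * M0 fn_to_hardy[OF hol] by simp
  qed (simp add: fn_outside)
qed

text \<open>The defect \<open>(norm x)\<^sup>2 - (norm (T x))\<^sup>2\<close> is nonnegative and
  vanishes at \<open>e\<close>, so its first-order variation at \<open>e\<close> in every direction
  \<open>c *\<^sub>h f\<close> is 0.\<close>

lemma cinner_contraction_eq:
  assumes T: "bounded_linear T" "\<And>c f. T (c *\<^sub>h f) = c *\<^sub>h T f" "\<And>f. norm (T f) \<le> norm f"
    and e: "norm (T e) = norm e"
  shows "cinner (T e) (T f) = cinner e f"
proof -
  define d where "d = cinner (T e) (T f) - cinner e f"
  have "2 * Re (cnj c * d) \<le> (cmod c)\<^sup>2 * ((norm f)\<^sup>2 - (norm (T f))\<^sup>2)" for c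
  proof -
    have "(norm (T (e + c *\<^sub>h f)))\<^sup>2 \<le> (norm (e + c *\<^sub>h f))\<^sup>2"
      by (intro power_mono T(3)) auto
    then show ?thesis
      unfolding linear_add[OF bounded_linear.linear[OF T(1)]] T(2) norm_add_square
      by (simp add: e d_def power_mult_distrib algebra_simps)
  qed
  from this[of "of_real s * d" for s :: real]
  have *: "2 * s * (cmod d)\<^sup>2 \<le> s\<^sup>2 * ((cmod d)\<^sup>2 * ((norm f)\<^sup>2 - (norm (T f))\<^sup>2))" for s :: real
    by (simp add: norm_mult power_mult_distrib mult.assoc complex_norm_square[symmetric]
        mult.commute[of "cnj d" d] flip: of_real_power)
  define B where "B = (cmod d)\<^sup>2 * ((norm f)\<^sup>2 - (norm (T f))\<^sup>2)"
  have B0: "B \<ge> 0"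
    unfolding B_def using T(3)[of f] by (intro mult_nonneg_nonneg) (auto intro: power_mono)
  have "(cmod d)\<^sup>2 \<le> 0"
  proof (rule ccontr)
    assume "\<not> (cmod d)\<^sup>2 \<le> 0"
    then have d: "(cmod d)\<^sup>2 > 0" by simp
    \<comment> \<open>Small enough for the quadratic term \<open>s\<^sup>2 B\<close> to be dominated
      by the linear term \<open>2 s (cmod d)\<^sup>2\<close>; the \<open>+ 1\<close> allows
      \<open>B = 0\<close>.\<close>
    define s where "s = (cmod d)\<^sup>2 / (B + 1)"
    have s: "s > 0" using d B0 by (simp add: s_def)
    have "s * (2 * (cmod d)\<^sup>2) \<le> s * (s * B)"
      using *[of s] by (simp add: B_def power2_eq_square mult_ac)
    then have "2 * (cmod d)\<^sup>2 \<le> s * B" using s by simp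
    also have "\<dots> \<le> (cmod d)\<^sup>2"
      using d B0 by (simp add: s_def field_simps)
    finally show False using d by simp
  qed
  then show ?thesis by (simp add: d_def)
qed

definition monom_h :: "nat \<Rightarrow> hardy" where
  "monom_h n = of_cf (\<lambda>k. if k = n then 1 else 0)"

lemma cf_monom_h [simp]: "cf (monom_h n) k = (if k = n then 1 else 0)"
  unfolding monom_h_def
proof (rule cf_of_cf)
  have "summable (\<lambda>k. (cmod (if k = n then 1 else 0))\<^sup>2)"
    by (rule summable_finite[of "{n}"]) auto
  then show "square_summable (\<lambda>k. if k = n then 1 else 0)"
    by (simp add: square_summable_def)
qed

lemma fn_monom_h: "z \<in> unit_disc \<Longrightarrow> fn (monom_h n) z = z ^ n"
proof (rule sums_unique2[OF cf_sums])
  have "(\<lambda>k. cf (monom_h n) k * z ^ k) = (\<lambda>k. if k = n then z ^ k else 0)"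
    by auto
  then show "(\<lambda>k. cf (monom_h n) k * z ^ k) sums z ^ n"
    using sums_single[of n "\<lambda>k. z ^ k"] by simp
qed

lemma cinner_monom_h: "cinner f (monom_h n) = cf f n"
proof (rule sums_unique2[OF cinner_sums])
  have "(\<lambda>k. cf f k * cnj (cf (monom_h n) k)) = (\<lambda>k. if k = n then cf f k else 0)"
    by auto
  then show "(\<lambda>k. cf f k * cnj (cf (monom_h n) k)) sums cf f n"
    using sums_single[of n "cf f"] by simp
qed

lemma norm_monom_h [simp]: "norm (monom_h n) = 1"
  using cinner_self[of "monom_h n"] unfolding cinner_monom_h
  by (simp add: abs_square_eq_1 flip: of_real_power)

lemma closure_combos_monom: "closure (combos UNIV monom_h) = UNIV"
  by (rule closure_combos_eq) (auto simp: csubspace_def cinner_monom_h intro!: hardy_eqI_cf)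

lemma closure_combos_zero:
  fixes L :: "hardy \<Rightarrow> complex"
  assumes L: "bounded_linear L" "\<And>c f. L (c *\<^sub>h f) = c * L f"
    and "\<And>i. i \<in> I \<Longrightarrow> L (v i) = 0" "u \<in> closure (combos I v)"
  shows "L u = 0"
proof -
  have "closed {f. L f = 0}"
    by (intro closed_Collect_eq continuous_intros linear_continuous_on[OF L(1)])
  moreover have "combos I v \<subseteq> {f. L f = 0}"
    by (rule combos_subset)
       (auto simp: csubspace_def assms(3) L(2) bounded_linear.linear[OF L(1), THEN linear_0]
         bounded_linear.linear[OF L(1), THEN linear_add])
  ultimately show ?thesis
    using closure_minimal assms(4) by blast
qed

lemma
  assumes F: "F holomorphic_on unit_disc" and M: "\<And>z. z \<in> unit_disc \<Longrightarrow> cmod (F z) \<le> M"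
  shows bounded_linear_mult: "bounded_linear (mult F)"
    and mult_scaleC: "mult F (c *\<^sub>h f) = c *\<^sub>h mult F f"
proof -
  have [simp]: "fn (mult F g) z = F z * fn g z" for g z
    by (rule fn_mult[OF F M])
  show "bounded_linear (mult F)"
  proof (rule bounded_linear_intro)
    show "mult F (f + g) = mult F f + mult F g" for f g
      by (rule hardy_eqI) (simp add: algebra_simps)
    show "mult F (r *\<^sub>R f) = r *\<^sub>R mult F f" for r f
      by (rule hardy_eqI) simp
    show "norm (mult F f) \<le> norm f * M" for f
      using norm_mult_le[OF F M, of f] by (simp add: mult.commute)
  qed
  show "mult F (c *\<^sub>h f) = c *\<^sub>h mult F f"
    by (rule hardy_eqI) simp
qed

definition shift :: "hardy \<Rightarrow> hardy" where
  "shift = mult (\<lambda>z. z)"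

lemma fn_shift [simp]: "fn (shift f) z = z * fn f z"
  unfolding shift_def by (rule fn_mult[of _ 1]) (auto intro: holomorphic_intros)

lemma cf_shift: "cf (shift f) n = (case n of 0 \<Rightarrow> 0 | Suc m \<Rightarrow> cf f m)"
  unfolding cf_def
proof (rule taylor_coeff_unique)
  fix z :: complex assume z: "z \<in> unit_disc"
  have "(\<lambda>m. (case Suc m of 0 \<Rightarrow> 0 | Suc m \<Rightarrow> taylor_coeff (fn f) m) * z ^ Suc m)
      sums (z * fn f z)"
    using sums_mult[OF cf_sums[OF z, of f], of z] by (simp add: cf_def mult_ac)
  from sums_Suc[OF this] show "(\<lambda>m. (case m of 0 \<Rightarrow> 0 | Suc m \<Rightarrow> taylor_coeff (fn f) m) * z ^ m)
      sums fn (shift f) z"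
    by simp
qed

lemma norm_shift [simp]: "norm (shift f) = norm f"
proof -
  have "(\<lambda>n. (cmod (cf (shift f) (Suc n)))\<^sup>2) sums (norm f)\<^sup>2"
    using norm_sums[of f] by (simp add: cf_shift)
  from sums_Suc[OF this] have "(\<lambda>n. (cmod (cf (shift f) n))\<^sup>2) sums (norm f)\<^sup>2"
    by (simp add: cf_shift)
  with norm_sums have "(norm (shift f))\<^sup>2 = (norm f)\<^sup>2"
    by (rule sums_unique2)
  then show ?thesis by simp
qed

lemma shift_linear:
  "bounded_linear shift" "shift (c *\<^sub>h f) = c *\<^sub>h shift f"
  unfolding shift_def
  by (rule bounded_linear_mult[of _ 1] mult_scaleC[of _ 1]; auto intro: holomorphic_intros)+

lemma cinner_shift [simp]: "cinner (shift f) (shift g) = cinner f g"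
  by (rule cinner_contraction_eq) (auto simp: shift_linear)

section \<open>Division by linear factors\<close>

lemma quotient_exists:
  assumes "\<mu> \<in> unit_disc" "fn u \<mu> = 0"
  shows "\<exists>q. \<forall>z\<in>unit_disc. fn u z = (z - \<mu>) * fn q z"
proof -
  define h where "h z = (if z = \<mu> then deriv (fn u) \<mu> else (fn u z - fn u \<mu>) / (z - \<mu>))" for z
  have hol: "h holomorphic_on unit_disc"
    unfolding h_def using assms(1) by (intro pole_lemma fn_holomorphic) (simp add: interior_open)
  have h: "fn u z = (z - \<mu>) * h z" for z
    using assms(2) by (simp add: h_def)
  \<comment> \<open>Half the distance from \<open>\<mu>\<close> to the circle, so that circles of
    radius at least \<open>1 - \<delta>\<close> stay at distance at least \<open>\<delta>\<close>
    from \<open>\<mu>\<close>.\<close>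
  define \<delta> where "\<delta> = (1 - cmod \<mu>) / 2"
  have \<delta>: "\<delta> > 0" using assms(1) by (simp add: \<delta>_def)
  have "circle_mean h r \<le> (norm u / \<delta>)\<^sup>2" if r: "1 - \<delta> \<le> r" "0 \<le> r" "r < 1" for r
  proof -
    have "circle_mean h r \<le> (1 / \<delta>)\<^sup>2 * circle_mean (fn u) r"
    proof (rule circle_mean_mono[OF hol fn_holomorphic r(2,3)])
      fix z assume z: "cmod z = r"
      have "\<delta> \<le> cmod (z - \<mu>)"
        using norm_triangle_ineq2[of z \<mu>] z r(1) by (simp add: \<delta>_def field_simps)
      then have "\<delta> * cmod (h z) \<le> cmod (z - \<mu>) * cmod (h z)"
        by (intro mult_right_mono) auto
      also have "\<dots> = cmod (fn u z)"
        by (simp only: h[of z] norm_mult)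
      finally show "cmod (h z) \<le> 1 / \<delta> * cmod (fn u z)"
        using \<delta> by (simp add: field_simps)
    qed (use \<delta> in simp)
    also have "\<dots> \<le> (1 / \<delta>)\<^sup>2 * (norm u)\<^sup>2"
      by (intro mult_left_mono circle_mean_le_norm r) auto
    finally show ?thesis by (simp add: power_divide)
  qed
  from square_summable_of_means[OF hol, of "1 - \<delta>" "norm u / \<delta>", OF _ _ this] have "square_summable (taylor_coeff h)"
    using \<delta> by simp
  from fn_to_hardy[OF hol this] show ?thesis
    using h by (intro exI[of _ "to_hardy h"]) auto
qed

text \<open>\<open>\<mu>\<close> is arbitrary: if it lies in the disc, continuity recovers the value
  there. Points on the circle and beyond occur later, such as \<open>\<zeta>\<close> and
  \<open>\<zeta> + 1 / c\<close>.\<close>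

lemma quotient_unique:
  assumes "\<And>z. z \<in> unit_disc \<Longrightarrow> (z - \<mu>) * fn p z = (z - \<mu>) * fn q z"
  shows "p = q"
proof -
  have eq: "fn p z = fn q z" if "z \<in> unit_disc" "z \<noteq> \<mu>" for z
    using assms[OF that(1)] that(2) by simp
  have "fn p z = fn q z" if z: "z \<in> unit_disc" for z
  proof (rule LIM_unique)
    have c: "isCont (fn f) z" for f
      using fn_holomorphic[of f] z
      by (meson continuous_on_eq_continuous_at holomorphic_on_imp_continuous_on open_ball)
    show "fn p \<midarrow>z\<rightarrow> fn p z" using c by (simp add: isCont_def)
    have "\<forall>\<^sub>F x in at z. fn q x = fn p x"
    proof (rule eventually_at_topological[THEN iffD2])
      show "\<exists>S. open S \<and> z \<in> S \<and> (\<forall>x\<in>S. x \<noteq> z \<longrightarrow> x \<in> UNIV \<longrightarrow> fn q x = fn p x)"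
        using eq z
        by (intro exI[of _ "if z = \<mu> then unit_disc else unit_disc - {\<mu>}"]) (auto simp: open_delete)
    qed
    then show "fn p \<midarrow>z\<rightarrow> fn q z" using c[of q] by (auto simp: isCont_def elim: Lim_transform_eventually)
  qed
  then show ?thesis by (rule hardy_eqI)
qed

section \<open>Inner multipliers and the model space\<close>

lemma radial_tendsto: "(\<lambda>n. 1 - 1 / (real n + 2)) \<longlonglongrightarrow> 1"
  by real_asymp

text \<open>Dominated convergence with the bound 1. The almost everywhere radial limits of an inner
  function are used only here.\<close>

lemma circle_mean_inner_function:
  assumes "inner_function F"
  shows "(\<lambda>n. circle_mean F (1 - 1 / (real n + 2))) \<longlonglongrightarrow> 1"
proof -
  have F: "F holomorphic_on unit_disc" "\<And>z. z \<in> unit_disc \<Longrightarrow> cmod (F z) \<le> 1"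
    and ae: "AE t in lebesgue_on {0..2 * pi}.
        \<exists>w. cmod w = 1 \<and> ((\<lambda>r. F (of_real r * cis t)) \<longlongrightarrow> w) (at_left (1::real))"
    using assms by (auto simp: inner_function_def)
  define r where "r n = 1 - 1 / (real n + 2)" for n
  have r: "0 \<le> r n" "r n < 1" for n by (auto simp: r_def field_simps)
  have r1: "filterlim r (at_left 1) sequentially"
    unfolding filterlim_at using r radial_tendsto by (auto simp: r_def[abs_def] less_imp_neq)
  let ?G = "\<lambda>n t. (cmod (F (of_real (r n) * cis t)))\<^sup>2"
  have cont: "continuous_on {0..2*pi} (?G n)" for n
    by (intro continuous_intros continuous_on_circle F r)
  have meas: "?G n \<in> borel_measurable (lebesgue_on {0..2*pi})" for n
    by (intro continuous_imp_measurable_on_sets_lebesgue cont) auto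
  have le1: "norm (?G n t) \<le> 1" for n t
    using F(2)[OF circle_in_disc[OF r, of n t]] by (simp add: power_le_one)
  have fin: "integrable (lebesgue_on {0..2*pi}) (\<lambda>t. 1::real)"
    by (rule finite_measure.integrable_const) (simp add: finite_measure_lebesgue_on lmeasurable_cbox flip: box_real)
  have "(\<lambda>n. integral\<^sup>L (lebesgue_on {0..2*pi}) (?G n)) \<longlonglongrightarrow>
      integral\<^sup>L (lebesgue_on {0..2*pi}) (\<lambda>t. 1)"
  proof (rule integral_dominated_convergence[OF _ meas fin])
    show "AE t in lebesgue_on {0..2*pi}. (\<lambda>n. ?G n t) \<longlonglongrightarrow> 1"
      using ae
    proof (rule AE_mp, intro AE_I2 impI)
      fix t assume "\<exists>w. cmod w = 1 \<and> ((\<lambda>r. F (of_real r * cis t)) \<longlongrightarrow> w) (at_left (1::real))"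
      then obtain w where w: "cmod w = 1" "((\<lambda>r. F (of_real r * cis t)) \<longlongrightarrow> w) (at_left (1::real))"
        by blast
      have "(\<lambda>n. ?G n t) \<longlonglongrightarrow> (cmod w)\<^sup>2"
        by (intro tendsto_intros filterlim_compose[OF w(2) r1])
      then show "(\<lambda>n. ?G n t) \<longlonglongrightarrow> 1" using w(1) by simp
    qed
  qed (use le1 in auto)
  moreover have "integral\<^sup>L (lebesgue_on {0..2*pi}) (?G n) = 2 * pi * circle_mean F (r n)" for n
  proof -
    have "integrable (lebesgue_on {0..2*pi}) (?G n)"
      by (rule Bochner_Integration.integrable_bound[OF fin meas]) (use le1 in auto)
    from lebesgue_integral_eq_integral[OF this] show ?thesis
      by (simp add: circle_mean_def)
  qed
  moreover have "integral\<^sup>L (lebesgue_on {0..2*pi}) (\<lambda>t. 1) = (2 * pi :: real)"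
    using lebesgue_integral_eq_integral[OF fin] by simp
  ultimately have "(\<lambda>n. 2 * pi * circle_mean F (r n)) \<longlonglongrightarrow> 2 * pi" by simp
  from tendsto_divide[OF this tendsto_const, of "2*pi"]
  show ?thesis by (simp add: r_def)
qed

lemma norm_inner_function:
  assumes "inner_function F"
  shows "norm (mult F (monom_h 0)) = 1"
proof (rule antisym)
  have F: "F holomorphic_on unit_disc" "\<And>z. z \<in> unit_disc \<Longrightarrow> cmod (F z) \<le> 1"
    using assms by (auto simp: inner_function_def)
  show "norm (mult F (monom_h 0)) \<le> 1"
    using norm_mult_le[OF F, of "monom_h 0"] by simp
  define r where "r n = 1 - 1 / (real n + 2)" for n
  have r: "0 \<le> r n" "r n < 1" for n by (auto simp: r_def field_simps)
  have lim: "(\<lambda>n. circle_mean F (r n)) \<longlonglongrightarrow> 1"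
    unfolding r_def by (rule circle_mean_inner_function[OF assms])
  have "circle_mean F (r n) \<le> (norm (mult F (monom_h 0)))\<^sup>2" for n
  proof -
    have "circle_mean F (r n) = circle_mean (fn (mult F (monom_h 0))) (r n)"
    proof -
      have "fn (mult F (monom_h 0)) (of_real (r n) * cis t) = F (of_real (r n) * cis t)" for t
        by (rule trans[OF fn_mult[OF F]]) (simp_all add: fn_monom_h[OF circle_in_disc[OF r]])
      then show ?thesis by (simp add: circle_mean_def)
    qed
    then show ?thesis using circle_mean_le_norm[OF r] by metis
  qed
  then have "1 \<le> (norm (mult F (monom_h 0)))\<^sup>2"
    by (intro LIMSEQ_le_const2[OF lim]) auto
  then show "1 \<le> norm (mult F (monom_h 0))"
    by (intro power2_le_imp_le[of 1]) auto
qed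

locale model =
  fixes \<Theta> :: "complex \<Rightarrow> complex"
  assumes inner: "inner_function \<Theta>"
begin

lemma holomorphic: "\<Theta> holomorphic_on unit_disc"
  and bound: "z \<in> unit_disc \<Longrightarrow> cmod (\<Theta> z) \<le> 1"
  using inner by (auto simp: inner_function_def)

definition T :: "hardy \<Rightarrow> hardy" where
  "T = mult \<Theta>"

lemma fn_T [simp]: "fn (T f) z = \<Theta> z * fn f z"
  unfolding T_def by (rule fn_mult[OF holomorphic bound])

lemma T_linear: "bounded_linear T" "T (c *\<^sub>h f) = c *\<^sub>h T f"
  unfolding T_def using bounded_linear_mult mult_scaleC holomorphic bound by blast+

lemma norm_T_monom: "norm (T (monom_h n)) = 1"
proof (induction n)
  case 0
  show ?case unfolding T_def by (rule norm_inner_function[OF inner])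
next
  case (Suc n)
  have "T (monom_h (Suc n)) = shift (T (monom_h n))"
    by (rule hardy_eqI) (simp add: fn_monom_h del: mem_ball mem_ball_0)
  with Suc show ?case by simp
qed

text \<open>\<open>T\<close> is a contraction that preserves the norms of monomials. By
  \<open>cinner_contraction_eq\<close> it preserves scalar products with monomials, and their
  density does the rest.\<close>

lemma cinner_T [simp]: "cinner (T f) (T g) = cinner f g"
proof -
  have "cinner (T f) (T g) - cinner f g = 0"
  proof (rule closure_combos_zero[where L = "\<lambda>f. cinner (T f) (T g) - cinner f g"])
    show "bounded_linear (\<lambda>f. cinner (T f) (T g) - cinner f g)"
      by (intro bounded_linear_sub bounded_linear_cinner_left
          bounded_linear_compose[OF bounded_linear_cinner_left T_linear(1)])
    show "f \<in> closure (combos UNIV monom_h)" by (simp add: closure_combos_monom)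
    show "cinner (T (monom_h n)) (T g) - cinner (monom_h n) g = 0" for n
    proof -
      have "norm (T f) \<le> norm f" for f
        unfolding T_def using norm_mult_le[OF holomorphic bound, of f] by simp
      then show ?thesis
        using cinner_contraction_eq[OF T_linear, of "monom_h n" g] by (simp add: norm_T_monom)
    qed
  qed (simp add: T_linear algebra_simps)
  then show ?thesis by simp
qed

definition K :: "hardy set" where
  "K = {f. \<forall>g. cinner f (T g) = 0}"

lemma model_space_eq: "model_space \<Theta> = fn ` K"
proof -
  have *: "(\<lambda>z. \<Theta> z * fn g z) = fn (T g)" for g by auto
  have "fn f \<in> model_space \<Theta> \<longleftrightarrow> f \<in> K" for f
  proof -
    have "(\<forall>g\<in>hardy_space. hardy_inner (fn f) (\<lambda>z. \<Theta> z * g z) = 0) \<longleftrightarrow>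
        (\<forall>g. hardy_inner (fn f) (\<lambda>z. \<Theta> z * fn g z) = 0)"
      using fn Hardy_inverse by metis
    then show ?thesis
      using fn[of f] by (simp add: model_space_def K_def * cinner_hardy_inner)
  qed
  moreover have "\<exists>F. f = fn F" if "f \<in> model_space \<Theta>" for f
    using that Hardy_inverse[of f] by (auto simp: model_space_def) metis
  ultimately show ?thesis by blast
qed

lemma closed_K: "closed K"
proof -
  have "K = (\<Inter>g. {f. cinner f (T g) = 0})" by (auto simp: K_def)
  then show ?thesis by (simp add: closed_INT closed_orthogonal)
qed

lemma csubspace_K: "csubspace K"
  by (auto simp: csubspace_def K_def cinner_distribs)

lemma T_shift: "T (shift p) = shift (T p)"
  by (rule hardy_eqI) simp

text \<open>Division by \<open>z - \<mu>\<close> is adjoint to multiplication by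
  \<open>1 - cnj \<mu> * z\<close>: since \<open>T\<close> commutes with the isometry
  \<open>shift\<close>, \<open>cinner q (T (v p)) = cinner f (T (shift p))\<close>. It remains to
  see that the \<open>v p\<close> are total. Orthogonality to \<open>z \<Theta>\<close> H^2 is
  assumed instead of \<open>f \<in> K\<close> so as to cover
  \<open>f = \<Theta> - c\<close>.\<close>

lemma quotient_in_K':
  assumes f: "\<And>p. cinner f (T (shift p)) = 0" and q: "\<And>z. z \<in> unit_disc \<Longrightarrow> fn f z = (z - \<mu>) * fn q z" and \<mu>: "cmod \<mu> \<le> 1"
  shows "q \<in> K"
proof -
  define v where "v p = p - cnj \<mu> *\<^sub>h shift p" for p
  have f_eq: "f = shift q - \<mu> *\<^sub>h q"
    by (rule hardy_eqI) (simp add: q algebra_simps del: mem_ball mem_ball_0)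
  have T_lin: "T (g - h) = T g - T h" for g h
    using T_linear(1) bounded_linear.linear linear_diff by blast
  have "cinner (T (v p)) q = 0" for p
  proof -
    have "cinner q (T (v p)) = cinner f (shift (T p))"
      unfolding f_eq v_def T_lin T_linear T_shift by (simp add: cinner_distribs)
    also have "\<dots> = 0"
      using f unfolding T_shift[symmetric] .
    finally show ?thesis by (metis cinner_commute complex_cnj_zero)
  qed
  moreover have "closure (combos UNIV v) = UNIV"
  proof (rule closure_combos_eq)
    fix u assume u: "\<And>p. p \<in> UNIV \<Longrightarrow> cinner u (v p) = 0"
    \<comment> \<open>Orthogonality to \<open>v p\<close> is the recursion
      \<open>cf u n = \<mu> * cf u (Suc n)\<close>. With \<open>cmod \<mu> \<le> 1\<close> the
      coefficients do not decrease in modulus, so square summability makes them vanish. Points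
      \<open>\<mu>\<close> on the circle are thus covered.\<close>
    have "cmod (cf u n) \<le> cmod (cf u (Suc n))" for n
    proof -
      have "shift (monom_h n) = monom_h (Suc n)"
        by (rule hardy_eqI_cf) (simp add: cf_shift split: nat.split)
      with u[of "monom_h n"] have "cf u n = \<mu> * cf u (Suc n)"
        by (simp add: v_def cinner_distribs cinner_monom_h)
      then have "cmod (cf u n) = cmod \<mu> * cmod (cf u (Suc n))" by (simp add: norm_mult)
      also have "\<dots> \<le> 1 * cmod (cf u (Suc n))" by (intro mult_right_mono \<mu>) auto
      finally show ?thesis by simp
    qed
    then have inc: "incseq (\<lambda>n. cmod (cf u n))" by (rule incseq_SucI)
    have "(\<lambda>n. (cmod (cf u n))\<^sup>2) \<longlonglongrightarrow> 0"
      using norm_sums[of u] by (intro summable_LIMSEQ_zero) (auto simp: sums_iff)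
    then have "(\<lambda>n. sqrt ((cmod (cf u n))\<^sup>2)) \<longlonglongrightarrow> sqrt 0" by (rule tendsto_real_sqrt)
    then have "(\<lambda>n. cmod (cf u n)) \<longlonglongrightarrow> 0" by simp
    from incseq_le[OF inc this] show "u = 0"
      by (intro hardy_eqI_cf) simp
  qed (auto simp: csubspace_def)
  ultimately have "cinner (T g) q = 0" for g
    using closure_combos_zero[of "\<lambda>g. cinner (T g) q" UNIV v g]
    by (simp add: T_linear bounded_linear_compose[OF bounded_linear_cinner_left T_linear(1)])
  then have "cinner q (T g) = 0" for g by (metis cinner_commute complex_cnj_zero)
  then show ?thesis by (simp add: K_def)
qed

lemma quotient_in_K:
  assumes "f \<in> K" "\<And>z. z \<in> unit_disc \<Longrightarrow> fn f z = (z - \<mu>) * fn q z" "cmod \<mu> \<le> 1"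
  shows "q \<in> K"
  using assms(1) by (intro quotient_in_K'[OF _ assms(2,3)]) (simp_all add: K_def)

text \<open>\<open>cnj (\<Theta> w) *\<^sub>h T (szego w)\<close> is the projection of the Szego
  kernel onto \<open>\<Theta>\<close> H^2.\<close>

definition ker :: "complex \<Rightarrow> hardy" where
  "ker w = szego w - cnj (\<Theta> w) *\<^sub>h T (szego w)"

lemma fn_ker:
  "w \<in> unit_disc \<Longrightarrow> z \<in> unit_disc \<Longrightarrow> fn (ker w) z = (1 - cnj (\<Theta> w) * \<Theta> z) / (1 - cnj w * z)"
  by (simp add: ker_def fn_szego diff_divide_distrib del: mem_ball mem_ball_0)

lemma ker_in_K:
  assumes "w \<in> unit_disc"
  shows "ker w \<in> K"
proof -
  have "cinner (szego w) h = cnj (fn h w)" for h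
    using cinner_szego[OF assms] cinner_commute by metis
  then show ?thesis
    by (simp add: K_def ker_def cinner_distribs)
qed

lemma cinner_ker:
  assumes "w \<in> unit_disc" "f \<in> K"
  shows "cinner f (ker w) = fn f w"
  using assms(2) by (simp add: ker_def cinner_distribs cinner_szego[OF assms(1)] K_def)

lemma is_reproducing_kernel_ker:
  assumes "w \<in> unit_disc"
  shows "is_reproducing_kernel \<Theta> w (fn (ker w))"
  using assms ker_in_K[OF assms] cinner_ker[OF assms]
  by (auto simp: is_reproducing_kernel_def model_space_eq cinner_hardy_inner[symmetric])

lemma norm_ker:
  assumes "w \<in> unit_disc"
  shows "(norm (ker w))\<^sup>2 = (1 - (cmod (\<Theta> w))\<^sup>2) / (1 - (cmod w)\<^sup>2)"
proof -
  have "complex_of_real ((norm (ker w))\<^sup>2) = fn (ker w) w"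
    using cinner_ker[OF assms ker_in_K[OF assms]] cinner_self by metis
  also have "\<dots> = of_real ((1 - (cmod (\<Theta> w))\<^sup>2) / (1 - (cmod w)\<^sup>2))"
    using fn_ker[OF assms assms] complex_norm_square[of w] complex_norm_square[of "\<Theta> w"]
    by (simp add: mult.commute)
  finally show ?thesis using of_real_eq_iff by blast
qed

end

section \<open>Blaschke factors\<close>

text \<open>Without the usual unimodular normalisation, as only finite products are formed.\<close>

definition blaschke :: "complex \<Rightarrow> complex \<Rightarrow> complex" where
  "blaschke \<mu> z = (z - \<mu>) / (1 - cnj \<mu> * z)"

lemma blaschke_denom:
  assumes "cmod \<mu> < 1" "cmod z \<le> 1"
  shows "1 - cnj \<mu> * z \<noteq> 0"
proof -
  have "cmod (cnj \<mu> * z) < 1"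
    using assms by (simp add: norm_mult) (metis le_less_trans mult_left_le norm_ge_zero)
  then show ?thesis by auto
qed

lemma one_minus_blaschke:
  assumes "cmod \<mu> < 1" "cmod z \<le> 1"
  shows "1 - (cmod (blaschke \<mu> z))\<^sup>2 = (1 - (cmod \<mu>)\<^sup>2) * (1 - (cmod z)\<^sup>2) / (cmod (1 - cnj \<mu> * z))\<^sup>2"
proof -
  have "(cmod (1 - cnj \<mu> * z))\<^sup>2 - (cmod (z - \<mu>))\<^sup>2 = (1 - (cmod \<mu>)\<^sup>2) * (1 - (cmod z)\<^sup>2)"
    unfolding cmod_power2 by (simp add: power2_eq_square algebra_simps)
  then show ?thesis
    using blaschke_denom[OF assms] by (simp add: blaschke_def norm_divide power_divide field_simps)
qed

lemma cmod_blaschke_le: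
  assumes "cmod \<mu> < 1" "cmod z \<le> 1"
  shows "cmod (blaschke \<mu> z) \<le> 1"
proof -
  have "0 \<le> 1 - (cmod (blaschke \<mu> z))\<^sup>2"
    unfolding one_minus_blaschke[OF assms] using assms
    by (intro divide_nonneg_nonneg mult_nonneg_nonneg) (auto simp: abs_square_le_1)
  then show ?thesis by (simp add: abs_square_le_1)
qed

lemma blaschke_eq_0_iff: "cmod \<mu> < 1 \<Longrightarrow> cmod z \<le> 1 \<Longrightarrow> blaschke \<mu> z = 0 \<longleftrightarrow> z = \<mu>"
  using blaschke_denom by (auto simp: blaschke_def)

lemma holomorphic_blaschke:
  assumes "cmod \<mu> < 1" "F holomorphic_on S" "\<And>z. z \<in> S \<Longrightarrow> cmod (F z) \<le> 1"
  shows "(\<lambda>z. blaschke \<mu> (F z)) holomorphic_on S"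
  unfolding blaschke_def
  using blaschke_denom[OF assms(1) assms(3)] by (intro holomorphic_intros assms(2)) auto

text \<open>\<open>z - \<mu>\<close> and \<open>1 - cnj \<mu> * z\<close> have equal modulus on the
  circle. In place of boundary values, the norms of \<open>shift q - \<mu> *\<^sub>h q\<close> and
  \<open>q - cnj \<mu> *\<^sub>h shift q\<close> are expanded; they agree since \<open>shift\<close>
  is isometric.\<close>

lemma blaschke_division1:
  assumes \<mu>: "\<mu> \<in> unit_disc" "fn u \<mu> = 0"
  shows "\<exists>v. norm v = norm u \<and> (\<forall>z\<in>unit_disc. fn u z = blaschke \<mu> z * fn v z)"
proof -
  obtain q where q: "\<And>z. z \<in> unit_disc \<Longrightarrow> fn u z = (z - \<mu>) * fn q z"
    using quotient_exists[OF assms] by blast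
  define v where "v = q - cnj \<mu> *\<^sub>h shift q"
  have u: "u = shift q - \<mu> *\<^sub>h q"
    by (rule hardy_eqI) (simp add: q algebra_simps del: mem_ball mem_ball_0)
  have "Re (cinner (shift q) (\<mu> *\<^sub>h q)) = Re (cinner q (cnj \<mu> *\<^sub>h shift q))"
  proof -
    have e: "cinner (shift q) (\<mu> *\<^sub>h q) = cnj (cinner q (cnj \<mu> *\<^sub>h shift q))"
      using cinner_commute[of "shift q" q] by simp
    show ?thesis unfolding e by (rule cnj.sel)
  qed
  then have "(norm v)\<^sup>2 = (norm u)\<^sup>2"
    unfolding v_def u norm_diff_square by simp
  moreover have "fn u z = blaschke \<mu> z * fn v z" if z: "z \<in> unit_disc" for z
  proof -
    have "fn v z = (1 - cnj \<mu> * z) * fn q z"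
      by (simp add: v_def algebra_simps)
    then show ?thesis
      using blaschke_denom[of \<mu> z] z \<mu> by (simp add: blaschke_def q[OF z])
  qed
  ultimately show ?thesis by (intro exI[of _ v]) simp
qed

lemma blaschke_division:
  assumes "finite J" "J \<subseteq> unit_disc" "\<And>\<mu>. \<mu> \<in> J \<Longrightarrow> fn u \<mu> = 0"
  shows "\<exists>v. norm v = norm u \<and> (\<forall>z\<in>unit_disc. fn u z = (\<Prod>\<mu>\<in>J. blaschke \<mu> z) * fn v z)"
  using assms
proof (induction J)
  case empty
  then show ?case by auto
next
  case (insert \<mu> J)
  then obtain v where v: "norm v = norm u"
    "\<And>z. z \<in> unit_disc \<Longrightarrow> fn u z = (\<Prod>\<mu>\<in>J. blaschke \<mu> z) * fn v z" by auto
  have \<mu>: "\<mu> \<in> unit_disc" using insert by auto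
  have "blaschke \<nu> \<mu> \<noteq> 0" if "\<nu> \<in> J" for \<nu>
    using that insert \<mu> by (subst blaschke_eq_0_iff) auto
  then have "(\<Prod>\<nu>\<in>J. blaschke \<nu> \<mu>) \<noteq> 0"
    using insert.hyps(1) by simp
  then have "fn v \<mu> = 0"
    using v(2)[OF \<mu>] insert.prems(2)[of \<mu>] by simp
  from blaschke_division1[OF \<mu> this] obtain v' where v': "norm v' = norm v"
    "\<And>z. z \<in> unit_disc \<Longrightarrow> fn v z = blaschke \<mu> z * fn v' z" by blast
  then show ?case
    using v insert.hyps by (intro exI[of _ v']) (auto simp: mult_ac)
qed

section \<open>Frostman's theorem\<close>

text \<open>The mean value property from Parseval: \<open>4 Re h\<close> is the difference of the
  squared moduli of \<open>1 + h\<close> and \<open>1 - h\<close>, and in the difference of their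
  means all but the constant coefficients cancel.\<close>

lemma mean_Re:
  assumes h: "h holomorphic_on unit_disc" and r: "0 \<le> r" "r < 1"
  shows "((\<lambda>t. Re (h (of_real r * cis t))) has_integral 2 * pi * Re (h 0)) {0..2*pi}"
proof -
  let ?p = "\<lambda>z. 1 + h z" and ?m = "\<lambda>z. 1 + (-1) * h z"
  have hol: "?p holomorphic_on unit_disc" "?m holomorphic_on unit_disc"
    by (intro holomorphic_intros h)+
  let ?d = "\<lambda>n. (cmod (taylor_coeff ?p n))\<^sup>2 * r ^ (2 * n) - (cmod (taylor_coeff ?m n))\<^sup>2 * r ^ (2 * n)"
  have "?d sums (circle_mean ?p r - circle_mean ?m r)"
    by (intro sums_diff circle_mean_sums hol r)
  moreover have "?d = (\<lambda>n. if n = 0 then 4 * Re (h 0) else 0)"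
  proof
    fix n
    have c: "taylor_coeff (\<lambda>z. 1 :: complex) n = (if n = 0 then 1 else 0)"
      by (rule taylor_coeff_unique) (use sums_single[of 0 "\<lambda>_. 1 :: complex"] in \<open>simp add: if_distrib if_distribR cong: if_cong\<close>)
    have p: "taylor_coeff ?p n = (if n = 0 then 1 else 0) + taylor_coeff h n"
      unfolding c[symmetric] by (intro taylor_coeff_add h holomorphic_intros)
    have "taylor_coeff ?m n = taylor_coeff (\<lambda>z. 1) n + taylor_coeff (\<lambda>z. (-1) * h z) n"
      by (intro taylor_coeff_add h holomorphic_intros)
    also have "\<dots> = (if n = 0 then 1 else 0) + (-1) * taylor_coeff h n"
      unfolding c taylor_coeff_cmult[OF h] ..
    finally have m: "taylor_coeff ?m n = (if n = 0 then 1 else 0) + (-1) * taylor_coeff h n" .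
    show "?d n = (if n = 0 then 4 * Re (h 0) else 0)"
      unfolding p m by (cases "n = 0") (simp_all add: cmod_power2, simp add: power2_eq_square algebra_simps)
  qed
  ultimately have diff: "circle_mean ?p r - circle_mean ?m r = 4 * Re (h 0)"
    using sums_single[of 0 "\<lambda>_. 4 * Re (h 0)"] sums_unique2 by fastforce
  have int: "(\<lambda>t. (cmod (f (of_real r * cis t)))\<^sup>2) integrable_on {0..2*pi}"
    if "f holomorphic_on unit_disc" for f
    by (intro integrable_continuous_real continuous_intros continuous_on_circle that r)
  have "((\<lambda>t. ((cmod (?p (of_real r * cis t)))\<^sup>2 - (cmod (?m (of_real r * cis t)))\<^sup>2) / 4)
      has_integral (2 * pi * circle_mean ?p r - 2 * pi * circle_mean ?m r) / 4) {0..2*pi}"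
    unfolding circle_mean_def
    using int[OF hol(1)] int[OF hol(2)]
    by (intro has_integral_divide has_integral_diff) (simp_all add: has_integral_integral)
  moreover have "(2 * pi * circle_mean ?p r - 2 * pi * circle_mean ?m r) / 4 = 2 * pi * Re (h 0)"
    using diff by (simp flip: right_diff_distrib)
  moreover have "((cmod (?p z))\<^sup>2 - (cmod (?m z))\<^sup>2) / 4 = Re (h z)" for z
    unfolding cmod_power2 by (simp add: power2_eq_square algebra_simps)
  ultimately show ?thesis by (simp only:)
qed

text \<open>Jensen's formula without zeros: after rescaling by \<open>s'\<close>, \<open>v\<close>
  has a holomorphic logarithm on the whole disc, and \<open>mean_Re\<close> applies to it.\<close>

lemma mean_log_nonzero:
  assumes v: "v holomorphic_on unit_disc" and s: "0 \<le> s" "s < s'" "s' < 1"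
    and nz: "\<And>z. cmod z \<le> s' \<Longrightarrow> v z \<noteq> 0"
  shows "((\<lambda>t. ln (cmod (v (of_real s * cis t)))) has_integral 2 * pi * ln (cmod (v 0))) {0..2*pi}"
proof -
  define g where "g z = v (of_real s' * z)" for z
  have in_disc: "of_real s' * z \<in> unit_disc" if "z \<in> unit_disc" for z
    using that s by (simp add: norm_mult) (metis abs_of_pos le_less_trans less_trans mult_less_cancel_left_pos mult.right_neutral norm_ge_zero order_le_less_trans)
  have g: "g holomorphic_on unit_disc"
    unfolding g_def
    by (rule holomorphic_on_compose_gen[OF _ v, unfolded o_def])
       (use in_disc in \<open>auto intro!: holomorphic_intros\<close>)
  have "g z \<noteq> 0" if "z \<in> unit_disc" for z
    unfolding g_def using that s by (intro nz) (auto simp: norm_mult mult_left_le)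
  then obtain h where h: "h holomorphic_on unit_disc" "\<And>z. z \<in> unit_disc \<Longrightarrow> exp (h z) = g z"
    using holomorphic_logarithm_exists[of unit_disc g 0] g by (metis centre_in_ball convex_ball open_ball zero_less_one)
  have Re_h: "Re (h z) = ln (cmod (g z))" if "z \<in> unit_disc" for z
    using h(2)[OF that] by (metis ln_exp norm_exp_eq_Re)
  define r where "r = s / s'"
  have r: "0 \<le> r" "r < 1" using s by (auto simp: r_def)
  have "Re (h (of_real r * cis t)) = ln (cmod (v (of_real s * cis t)))" for t
    using Re_h[OF circle_in_disc[OF r, of t]] s by (simp add: g_def r_def)
  moreover have "Re (h 0) = ln (cmod (v 0))"
    using Re_h[of 0] by (simp add: g_def)
  ultimately show ?thesis
    using mean_Re[OF h(1) r] by simp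
qed

text \<open>The value at \<open>w = a\<close> must be infinite, whereas \<open>ln 0 = 0\<close> in HOL.\<close>

definition log_kernel :: "real \<Rightarrow> complex \<Rightarrow> ennreal" where
  "log_kernel a w =
     (if w = of_real a then top else ennreal (- ln (cmod (blaschke (of_real a) w))))"

lemma nn_integral_inverse_sqrt:
  fixes x :: real
  assumes "\<bar>x\<bar> \<le> 1"
  shows "(\<integral>\<^sup>+ a. ennreal (indicator {-1/2..1/2} a * (1 / 2 + 2 / sqrt \<bar>a - x\<bar>)) \<partial>lborel) \<le> 17"
proof -
  \<comment> \<open>An antiderivative on either side of \<open>x\<close>, continuous across the
    singularity.\<close>
  define G where "G a = a / 2 + 4 * sgn (a - x) * sqrt \<bar>a - x\<bar>" for a
  have "((\<lambda>a. 1 / 2 + 2 / sqrt \<bar>a - x\<bar>) has_integral G (1/2) - G (-1/2)) {-1/2..1/2}"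
  proof (rule fundamental_theorem_of_calculus_interior_strong[of "{x}"])
    fix a assume "a \<in> {-1/2<..<1/2} - {x}"
    then have "a \<noteq> x" by blast
    then consider "a > x" | "a < x" by (rule linorder_neqE)
    then show "(G has_vector_derivative 1 / 2 + 2 / sqrt \<bar>a - x\<bar>) (at a)"
    proof cases
      case 1
      have "((\<lambda>a. sqrt (a - x)) has_real_derivative inverse (sqrt (a - x)) / 2 * (1 - 0)) (at a)"
        by (rule DERIV_chain2[OF DERIV_real_sqrt DERIV_diff[OF DERIV_ident DERIV_const]]) (use 1 in simp)
      then have "((\<lambda>a. a / 2 + 4 * sqrt (a - x)) has_real_derivative 1 / 2 + 4 * (inverse (sqrt (a - x)) / 2 * (1 - 0))) (at a)"
        by (intro DERIV_add DERIV_diff DERIV_cmult DERIV_cdivide DERIV_ident)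
      moreover have "1 / 2 + 4 * (inverse (sqrt (a - x)) / 2 * (1 - 0)) = 1 / 2 + 2 / sqrt \<bar>a - x\<bar>"
        using 1 by (simp add: inverse_eq_divide)
      ultimately have "((\<lambda>a. a / 2 + 4 * sqrt (a - x)) has_real_derivative 1 / 2 + 2 / sqrt \<bar>a - x\<bar>) (at a)"
        by (simp only:)
      then show ?thesis
        unfolding has_real_derivative_iff_has_vector_derivative
        by (rule has_vector_derivative_transform_within_open[of _ _ _ "{x<..}"])
           (use 1 in \<open>auto simp: G_def\<close>)
    next
      case 2
      have "((\<lambda>a. sqrt (x - a)) has_real_derivative inverse (sqrt (x - a)) / 2 * (0 - 1)) (at a)"
        by (rule DERIV_chain2[OF DERIV_real_sqrt DERIV_diff[OF DERIV_const DERIV_ident]]) (use 2 in simp)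
      then have "((\<lambda>a. a / 2 - 4 * sqrt (x - a)) has_real_derivative 1 / 2 - 4 * (inverse (sqrt (x - a)) / 2 * (0 - 1))) (at a)"
        by (intro DERIV_add DERIV_diff DERIV_cmult DERIV_cdivide DERIV_ident)
      moreover have "1 / 2 - 4 * (inverse (sqrt (x - a)) / 2 * (0 - 1)) = 1 / 2 + 2 / sqrt \<bar>a - x\<bar>"
        using 2 by (simp add: inverse_eq_divide)
      ultimately have "((\<lambda>a. a / 2 - 4 * sqrt (x - a)) has_real_derivative 1 / 2 + 2 / sqrt \<bar>a - x\<bar>) (at a)"
        by (simp only:)
      then show ?thesis
        unfolding has_real_derivative_iff_has_vector_derivative
        by (rule has_vector_derivative_transform_within_open[of _ _ _ "{..<x}"])
           (use 2 in \<open>auto simp: G_def\<close>)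
    qed
  next
    have "continuous_on UNIV (\<lambda>y::real. sgn y * sqrt \<bar>y\<bar>)"
    proof -
      have eq: "(\<lambda>y::real. sgn y * sqrt \<bar>y\<bar>) = (\<lambda>y. max 0 (sqrt y) - max 0 (sqrt (- y)))"
        by (auto simp: sgn_if fun_eq_iff max_def real_sqrt_minus)
      show ?thesis unfolding eq by (intro continuous_intros)
    qed
    then have "continuous_on {-1/2..1/2} (\<lambda>a. sgn (a - x) * sqrt \<bar>a - x\<bar>)"
      by (rule continuous_on_compose2) (auto intro!: continuous_intros)
    then show "continuous_on {-1/2..1/2} G"
      unfolding G_def mult.assoc by (auto intro!: continuous_intros)
  qed auto
  then have "(\<integral>\<^sup>+ a. ennreal (indicator {-1/2..1/2} a * (1 / 2 + 2 / sqrt \<bar>a - x\<bar>)) \<partial>lborel)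
      = ennreal (G (1/2) - G (-1/2))"
    by (intro nn_integral_has_integral_lebesgue) auto
  \<comment> \<open>The linear part gives \<open>1/2\<close>, and each endpoint contributes at most
    \<open>4 * 2\<close> through the root.\<close>
  also have "G (1/2) - G (-1/2) \<le> 17"
  proof -
    have 1: "sqrt \<bar>y\<bar> \<le> 2" if "\<bar>y\<bar> \<le> 4" for y :: real
      using that by (intro real_le_lsqrt) auto
    have 2: "\<bar>sgn y * sqrt \<bar>y\<bar>\<bar> \<le> 2" if "\<bar>y\<bar> \<le> 4" for y :: real
      using 1[OF that] by (cases y "0 :: real" rule: linorder_cases) auto
    from 2[of "1/2 - x"] 2[of "-1/2 - x"] assms show ?thesis
      by (simp add: G_def abs_le_iff)
  qed
  finally show ?thesis by (simp add: ennreal_leI)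
qed

text \<open>The logarithm vanishes to first order at the circle, since
  \<open>1 - (cmod ?b)\<^sup>2\<close> contains the factor \<open>1 - (cmod w)\<^sup>2\<close>. The
  constant is \<open>1 / (2 (1/4)\<^sup>2)\<close>, where \<open>1/4\<close> bounds the distance
  from \<open>w\<close> to \<open>a\<close>.\<close>

lemma log_kernel_near_circle:
  assumes "\<bar>a\<bar> \<le> 1/2" "3/4 \<le> cmod w" "cmod w \<le> 1"
  shows "log_kernel a w \<le> ennreal (8 * (1 - (cmod w)\<^sup>2))"
proof -
  let ?b = "blaschke (of_real a) w"
  have wa: "1/4 \<le> cmod (w - of_real a)"
    using norm_triangle_ineq2[of w "of_real a"] assms by simp
  then have ne: "w \<noteq> of_real a" by auto
  have denom: "1 - of_real a * w \<noteq> 0"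
    using blaschke_denom[of "of_real a" w] assms by simp
  have b0: "?b \<noteq> 0" using blaschke_eq_0_iff[of "of_real a" w] ne assms by auto
  have x: "(cmod ?b)\<^sup>2 > 0" using b0 by simp
  have "- ln (cmod ?b) = ln (1 / (cmod ?b)\<^sup>2) / 2"
    using b0 by (simp add: ln_div ln_realpow)
  also have "\<dots> \<le> (1 / (cmod ?b)\<^sup>2 - 1) / 2"
    using x by (intro divide_right_mono ln_le_minus_one) auto
  also have "\<dots> = (1 - (cmod ?b)\<^sup>2) / (cmod ?b)\<^sup>2 / 2"
    using x by (simp add: field_simps)
  also have "\<dots> = (1 - a\<^sup>2) * (1 - (cmod w)\<^sup>2) / (cmod (w - of_real a))\<^sup>2 / 2"
    using denom assms by (subst one_minus_blaschke) (auto simp: blaschke_def norm_divide power_divide)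
  also have "\<dots> \<le> 1 * (1 - (cmod w)\<^sup>2) / (1/4)\<^sup>2 / 2"
    using assms wa by (intro divide_right_mono frac_le mult_right_mono power_mono)
      (auto simp: abs_square_le_1)
  finally show ?thesis
    using ne by (simp add: log_kernel_def ennreal_leI power2_eq_square)
qed

text \<open>The logarithmic singularity is dominated by an integrable power of
  \<open>\<bar>a - Re w\<bar>\<close>, so that \<open>nn_integral_inverse_sqrt\<close> bounds the
  average over \<open>a\<close> uniformly in \<open>w\<close>.\<close>

lemma log_kernel_interior:
  assumes "\<bar>a\<bar> \<le> 1/2" "cmod w \<le> 1" "a \<noteq> Re w"
  shows "log_kernel a w \<le> ennreal (1 / 2 + 2 / sqrt \<bar>a - Re w\<bar>)"
proof -
  have ne: "w \<noteq> of_real a" using assms(3) by auto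
  have denom: "1 - of_real a * w \<noteq> 0"
    using blaschke_denom[of "of_real a" w] assms by simp
  have y: "\<bar>a - Re w\<bar> > 0" using assms by simp
  have "cmod (of_real a * w) \<le> 1/2 * 1"
    unfolding norm_mult using assms by (intro mult_mono) auto
  then have d: "cmod (1 - of_real a * w) \<le> 3/2"
    using norm_triangle_ineq4[of 1 "of_real a * w"] by simp
  have n: "\<bar>a - Re w\<bar> \<le> cmod (w - of_real a)"
    using abs_Re_le_cmod[of "w - of_real a"] by (simp add: abs_minus_commute)
  have "- ln (cmod (blaschke (of_real a) w)) = ln (cmod (1 - of_real a * w)) - ln (cmod (w - of_real a))"
    using ne denom by (simp add: blaschke_def norm_divide ln_div)
  moreover have "ln (cmod (1 - of_real a * w)) \<le> ln (3/2)"
    using d denom by simp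
  moreover have "ln \<bar>a - Re w\<bar> \<le> ln (cmod (w - of_real a))"
    by (subst ln_le_cancel_iff) (use n y in linarith)+
  moreover have "ln (3/2 :: real) \<le> 1/2"
    using ln_le_minus_one[of "3/2"] by simp
  moreover have "- ln \<bar>a - Re w\<bar> \<le> 2 / sqrt \<bar>a - Re w\<bar>"
  proof -
    have "- ln \<bar>a - Re w\<bar> = 2 * ln (1 / sqrt \<bar>a - Re w\<bar>)"
      using y by (simp add: ln_div ln_sqrt)
    also have "\<dots> \<le> 2 * (1 / sqrt \<bar>a - Re w\<bar>)"
      using y ln_le_minus_one[of "1 / sqrt \<bar>a - Re w\<bar>"] by simp
    finally show ?thesis by simp
  qed
  ultimately have "- ln (cmod (blaschke (of_real a) w)) \<le> 1 / 2 + 2 / sqrt \<bar>a - Re w\<bar>"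
    by linarith
  from ennreal_leI[OF this] show ?thesis
    using ne unfolding log_kernel_def by (simp only: if_False)
qed

text \<open>Averaging over \<open>a\<close> removes the singularity and keeps the first-order decay
  at the circle. The bound is a multiple of \<open>1 - (cmod w)\<^sup>2\<close>, whose mean for
  \<open>w = \<Theta> z\<close> tends to 0.\<close>

lemma nn_integral_log_kernel:
  assumes w: "cmod w \<le> 1"
  shows "(\<integral>\<^sup>+ a. indicator {-1/2..1/2} a * log_kernel a w \<partial>lborel) \<le> ennreal (40 * (1 - (cmod w)\<^sup>2))"
proof (cases "3/4 \<le> cmod w")
  case True
  have "(\<integral>\<^sup>+ a. indicator {-1/2..1/2} a * log_kernel a w \<partial>lborel)
      \<le> (\<integral>\<^sup>+ a. ennreal (8 * (1 - (cmod w)\<^sup>2)) * indicator {-1/2..1/2::real} a \<partial>lborel)"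
    using log_kernel_near_circle[OF _ True w]
    by (intro nn_integral_mono) (auto simp: indicator_def)
  also have "\<dots> = ennreal (8 * (1 - (cmod w)\<^sup>2))"
    by (subst nn_integral_cmult_indicator) auto
  also have "\<dots> \<le> ennreal (40 * (1 - (cmod w)\<^sup>2))"
    using w by (intro ennreal_leI mult_right_mono) (auto simp: abs_square_le_1)
  finally show ?thesis .
next
  case False
  have "AE a in lborel. a \<noteq> Re w"
    using AE_lborel_inner_neq[of "1::real" "Re w"] by simp
  then have "(\<integral>\<^sup>+ a. indicator {-1/2..1/2} a * log_kernel a w \<partial>lborel)
      \<le> (\<integral>\<^sup>+ a. ennreal (indicator {-1/2..1/2} a * (1 / 2 + 2 / sqrt \<bar>a - Re w\<bar>)) \<partial>lborel)"
    using log_kernel_interior[OF _ w]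
    by (intro nn_integral_mono_AE) (auto elim!: eventually_mono simp: indicator_def)
  also have "\<dots> \<le> 17"
    using abs_Re_le_cmod[of w] w by (intro nn_integral_inverse_sqrt) simp
  also have "\<dots> = ennreal 17" by simp
  \<comment> \<open>Below radius \<open>3/4\<close> the factor \<open>1 - (cmod w)\<^sup>2\<close>
    is at least \<open>7/16\<close>, so 40 absorbs 17.\<close>
  also have "\<dots> \<le> ennreal (40 * (1 - (cmod w)\<^sup>2))"
  proof (rule ennreal_leI)
    have "(cmod w)\<^sup>2 \<le> (3/4)\<^sup>2" using False by (intro power_mono) auto
    then show "17 \<le> 40 * (1 - (cmod w)\<^sup>2)" by (simp add: power2_eq_square)
  qed
  finally show ?thesis .
qed

lemma borel_measurable_log_kernel:
  "(\<lambda>x. log_kernel (fst x) (snd x)) \<in> borel_measurable (borel \<Otimes>\<^sub>M borel)"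
proof -
  have [measurable]: "(\<lambda>x::real \<times> complex. complex_of_real (fst x)) \<in> borel_measurable (borel \<Otimes>\<^sub>M borel)"
    by (rule measurable_compose[OF measurable_fst borel_measurable_continuous_onI])
       (intro continuous_intros)
  show ?thesis
    unfolding log_kernel_def blaschke_def complex_cnj_complex_of_real by measurable
qed

section \<open>Almost every value is a Frostman value\<close>

context model
begin

lemma double_zero_deriv:
  assumes hol: "p holomorphic_on unit_disc" "q holomorphic_on unit_disc" and x: "x \<in> unit_disc"
    and e: "\<And>z. z \<in> unit_disc \<Longrightarrow> \<Theta> z - c = p z * q z" and zero: "p x = 0" "q x = 0"
  shows "deriv \<Theta> x = 0"
proof -
  have "((\<lambda>z. p z * q z) has_field_derivative deriv p x * q x + deriv q x * p x) (at x)"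
    using hol x by (intro DERIV_mult holomorphic_derivI[of _ unit_disc]) auto
  then have "((\<lambda>z. p z * q z + c) has_field_derivative 0) (at x)"
    by (simp add: zero DERIV_cong[OF DERIV_add[OF _ DERIV_const]])
  then have "(\<Theta> has_field_derivative 0) (at x)"
    by (rule has_field_derivative_transform_within_open[where S = unit_disc])
       (use x e in \<open>auto simp: algebra_simps simp flip: e\<close>)
  then show ?thesis by (rule DERIV_imp_deriv)
qed

text \<open>\<open>J\<close> is a set, so each zero is divided out once. This is enough, because a
  further zero of \<open>v\<close> at \<open>z0\<close> would be a double zero of
  \<open>\<Theta> - c\<close>.\<close>

lemma blaschke_factor_nonzero:
  assumes simple: "\<And>z. z \<in> unit_disc \<Longrightarrow> \<Theta> z = c \<Longrightarrow> deriv \<Theta> z \<noteq> 0" and c: "cmod c < 1"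
    and J: "finite J" "J \<subseteq> unit_disc" "z0 \<in> J"
    and v: "\<And>z. z \<in> unit_disc \<Longrightarrow> blaschke c (\<Theta> z) = (\<Prod>\<mu>\<in>J. blaschke \<mu> z) * fn v z"
  shows "fn v z0 \<noteq> 0"
proof
  assume v0: "fn v z0 = 0"
  have z0: "z0 \<in> unit_disc" using J by blast
  define q where "q z = (\<Prod>\<mu>\<in>J - {z0}. blaschke \<mu> z) * fn v z * (1 - cnj c * \<Theta> z)" for z
  have bl: "(\<lambda>z. blaschke \<mu> z) holomorphic_on unit_disc" if "\<mu> \<in> J" for \<mu>
    using that J by (intro holomorphic_blaschke holomorphic_on_ident) auto
  have q: "q holomorphic_on unit_disc"
    unfolding q_def by (intro holomorphic_intros bl fn_holomorphic holomorphic) auto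
  have fac: "\<Theta> z - c = blaschke z0 z * q z" if z: "z \<in> unit_disc" for z
  proof -
    have "\<Theta> z - c = blaschke c (\<Theta> z) * (1 - cnj c * \<Theta> z)"
      using blaschke_denom[OF c bound[OF z]] by (simp add: blaschke_def)
    also have "\<dots> = blaschke z0 z * q z"
      using J by (simp add: v[OF z] q_def prod.remove[of J z0] mult_ac)
    finally show ?thesis .
  qed
  have b0: "blaschke z0 z0 = 0" by (simp add: blaschke_def)
  have q0: "q z0 = 0" by (simp add: q_def v0)
  from double_zero_deriv[OF bl[OF J(3)] q z0 fac b0 q0] have "deriv \<Theta> z0 = 0" .
  moreover have "\<Theta> z0 = c" using fac[OF z0] b0 by simp
  ultimately show False using simple z0 by blast
qed

text \<open>The zeros of \<open>\<Theta> - a\<close> in a disc of radius slightly above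
  \<open>s\<close> are divided out. What is left has no zero there, so
  \<open>ln (cmod (fn v 0))\<close> is a mean over the circle of radius \<open>s\<close>; on it
  \<open>cmod (fn v z)\<close> is at least the modulus of \<open>blaschke a (\<Theta> z)\<close>,
  since Blaschke factors are at most 1.\<close>

lemma blaschke_approximation:
  assumes nonconst: "\<not> \<Theta> constant_on unit_disc"
    and simple: "\<And>z. z \<in> unit_disc \<Longrightarrow> \<Theta> z = of_real a \<Longrightarrow> deriv \<Theta> z \<noteq> 0"
    and a: "\<bar>a\<bar> < 1" and s: "0 \<le> s" "s < 1"
  shows "\<exists>J v. finite J \<and> J \<subseteq> {z\<in>unit_disc. \<Theta> z = of_real a} \<and> norm v \<le> 1 \<and>
    (\<forall>z\<in>unit_disc. blaschke (of_real a) (\<Theta> z) = (\<Prod>\<mu>\<in>J. blaschke \<mu> z) * fn v z) \<and> fn v 0 \<noteq> 0 \<and>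
    ennreal (2 * pi * - ln (cmod (fn v 0))) \<le>
      (\<integral>\<^sup>+ t. indicator {0..2*pi} t * log_kernel a (\<Theta> (of_real s * cis t)) \<partial>lborel)"
proof -
  define c where "c = complex_of_real a"
  have c: "cmod c < 1" using a by (simp add: c_def)
  define s' where "s' = (1 + s) / 2"
  have s': "s < s'" "s' < 1" using s by (auto simp: s'_def)
  define A where "A = mult (\<lambda>z. blaschke c (\<Theta> z)) (monom_h 0)"
  have hol: "(\<lambda>z. blaschke c (\<Theta> z)) holomorphic_on unit_disc"
    by (intro holomorphic_blaschke c holomorphic bound)
  have le1: "cmod (blaschke c (\<Theta> z)) \<le> 1" if "z \<in> unit_disc" for z
    by (intro cmod_blaschke_le c bound that)
  have A: "fn A z = blaschke c (\<Theta> z)" if "z \<in> unit_disc" for z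
    using that unfolding A_def by (subst fn_mult[OF hol le1]) (simp_all add: fn_monom_h)
  have nA: "norm A \<le> 1"
    using norm_mult_le[OF hol le1, of "monom_h 0"] by (simp add: A_def)
  define J where "J = {z \<in> cball 0 s'. \<Theta> z - c = 0}"
  have "\<not> (\<lambda>z. \<Theta> z - c) constant_on unit_disc"
    using nonconst unfolding constant_on_def by (metis diff_add_cancel)
  then have finJ: "finite J"
    unfolding J_def using s' holomorphic
    by (intro holomorphic_compact_finite_zeros[of _ unit_disc] holomorphic_intros) auto
  have J: "J \<subseteq> unit_disc" using s' by (auto simp: J_def)
  have "fn A \<mu> = 0" if "\<mu> \<in> J" for \<mu>
    using that J A[of \<mu>] by (auto simp: J_def blaschke_def)
  from blaschke_division[OF finJ J this] obtain v where v: "norm v = norm A"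
    "\<And>z. z \<in> unit_disc \<Longrightarrow> fn A z = (\<Prod>\<mu>\<in>J. blaschke \<mu> z) * fn v z" by blast
  have fac: "blaschke c (\<Theta> z) = (\<Prod>\<mu>\<in>J. blaschke \<mu> z) * fn v z" if "z \<in> unit_disc" for z
    using v(2)[OF that] A[OF that] by simp
  have nz: "fn v z \<noteq> 0" if z: "cmod z \<le> s'" for z
  proof
    assume v0: "fn v z = 0"
    have zD: "z \<in> unit_disc" using z s' by simp
    have "blaschke c (\<Theta> z) = 0" using fac[OF zD] v0 by simp
    then have "\<Theta> z = c" using blaschke_eq_0_iff[OF c bound[OF zD]] by simp
    then have "z \<in> J" using z by (simp add: J_def)
    from blaschke_factor_nonzero[OF _ c finJ J this fac] simple v0 show False
      by (auto simp: c_def)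
  qed
  define f where "f t = - ln (cmod (fn v (of_real s * cis t)))" for t
  have f: "(f has_integral 2 * pi * - ln (cmod (fn v 0))) {0..2*pi}"
    using has_integral_neg[OF mean_log_nonzero[OF fn_holomorphic s(1) s' nz]] by (simp add: f_def[abs_def])
  have nzs: "fn v (of_real s * cis t) \<noteq> 0" for t
    using s s' by (intro nz) (simp add: norm_mult)
  \<comment> \<open>The positive part dominates \<open>f\<close> and can be read as a nonnegative
    integral.\<close>
  have "continuous_on {0..2*pi} (\<lambda>t. max 0 (f t))"
    unfolding f_def using nzs
    by (intro continuous_intros continuous_on_circle fn_holomorphic s) auto
  then obtain I where I: "((\<lambda>t. max 0 (f t)) has_integral I) {0..2*pi}"
    using integrable_continuous_real integrable_on_def by blast
  have "2 * pi * - ln (cmod (fn v 0)) \<le> I"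
    by (rule has_integral_le[OF f I]) simp
  then have "ennreal (2 * pi * - ln (cmod (fn v 0))) \<le> ennreal I"
    by (rule ennreal_leI)
  also have "ennreal I = (\<integral>\<^sup>+ t. ennreal (indicator {0..2*pi} t * max 0 (f t)) \<partial>lborel)"
    by (rule nn_integral_has_integral_lebesgue[symmetric, OF _ I]) simp
  also have "\<dots> \<le> (\<integral>\<^sup>+ t. indicator {0..2*pi} t * log_kernel a (\<Theta> (of_real s * cis t)) \<partial>lborel)"
  proof (rule nn_integral_mono)
    fix t :: real
    let ?z = "of_real s * cis t"
    have zD: "?z \<in> unit_disc" by (rule circle_in_disc[OF s])
    have "ennreal (max 0 (f t)) \<le> log_kernel a (\<Theta> ?z)"
    proof (cases "\<Theta> ?z = of_real a")
      case True
      then show ?thesis by (simp add: log_kernel_def)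
    next
      case False
      then have b0: "blaschke c (\<Theta> ?z) \<noteq> 0"
        using blaschke_eq_0_iff[OF c bound[OF zD]] by (simp add: c_def)
      have "cmod (\<Prod>\<mu>\<in>J. blaschke \<mu> ?z) \<le> 1"
        unfolding prod_norm[symmetric] using J zD
        by (intro prod_le_1) (auto intro!: cmod_blaschke_le)
      then have "cmod (blaschke c (\<Theta> ?z)) \<le> 1 * cmod (fn v ?z)"
        unfolding fac[OF zD] norm_mult by (intro mult_right_mono) auto
      then have "f t \<le> - ln (cmod (blaschke c (\<Theta> ?z)))"
        using b0 nzs[of t] by (simp add: f_def)
      moreover have "0 \<le> - ln (cmod (blaschke c (\<Theta> ?z)))"
        using le1[OF zD] b0 by simp
      ultimately show ?thesis
        using False by (auto simp: log_kernel_def c_def intro!: ennreal_leI)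
    qed
    then show "ennreal (indicator {0..2*pi} t * max 0 (f t))
        \<le> indicator {0..2*pi} t * log_kernel a (\<Theta> ?z)"
      by (simp add: indicator_def)
  qed
  finally have "ennreal (2 * pi * - ln (cmod (fn v 0))) \<le>
      (\<integral>\<^sup>+ t. indicator {0..2*pi} t * log_kernel a (\<Theta> (of_real s * cis t)) \<partial>lborel)" .
  moreover have "J \<subseteq> {z\<in>unit_disc. \<Theta> z = of_real a}"
    using J by (auto simp: J_def c_def)
  ultimately show ?thesis
    using finJ v(1) nA fac nz[of 0] s s' unfolding c_def
    by (intro exI[of _ J] exI[of _ v]) auto
qed

definition log_mean :: "nat \<Rightarrow> real \<Rightarrow> ennreal" where
  "log_mean n a = (\<integral>\<^sup>+ t. indicator {0..2*pi} t *
     log_kernel a (\<Theta> (of_real (1 - 1 / (real n + 2)) * cis t)) \<partial>lborel)"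

text \<open>By Tonelli the average over \<open>a\<close> goes inside, where
  \<open>nn_integral_log_kernel\<close> leaves
  \<open>40 * (1 - (cmod (\<Theta> z))\<^sup>2)\<close>; integration over the circle gives
  \<open>40 * 2 * pi\<close> times one minus the mean.\<close>

lemma
  shows borel_measurable_log_mean: "log_mean n \<in> borel_measurable lborel"
    and nn_integral_log_mean: "(\<integral>\<^sup>+ a. indicator {-1/2..1/2} a * log_mean n a \<partial>lborel)
      \<le> ennreal (80 * pi * (1 - circle_mean \<Theta> (1 - 1 / (real n + 2))))"
proof -
  define r where "r = 1 - 1 / (real n + 2)"
  have r: "0 \<le> r" "r < 1" by (auto simp: r_def field_simps)
  define F where "F t = \<Theta> (of_real r * cis t)" for t
  have F_le: "cmod (F t) \<le> 1" for t
    unfolding F_def by (intro bound circle_in_disc r)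
  have F_cont: "continuous_on A F" for A
    unfolding F_def by (rule continuous_on_circle[OF holomorphic r])
  have F_meas: "F \<in> borel_measurable borel"
    by (rule borel_measurable_continuous_onI[OF F_cont])
  have G: "(\<lambda>x. log_kernel (fst x) (F (snd x))) \<in> borel_measurable (lborel \<Otimes>\<^sub>M lborel)"
  proof -
    have "(\<lambda>x. (fst x, F (snd x))) \<in> lborel \<Otimes>\<^sub>M lborel \<rightarrow>\<^sub>M borel \<Otimes>\<^sub>M borel"
      using F_meas by measurable
    from measurable_compose[OF this borel_measurable_log_kernel] show ?thesis by simp
  qed
  have G1: "(\<lambda>a. log_kernel a (F t)) \<in> borel_measurable lborel" for t
    using measurable_compose[OF measurable_Pair2' G, of t] by simp
  have G2: "(\<lambda>t. log_kernel a (F t)) \<in> borel_measurable lborel" for a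
    using measurable_compose[OF measurable_Pair1' G, of a] by simp
  have [measurable]: "(\<lambda>t. log_kernel a (F t)) \<in> borel_measurable borel"
    "(\<lambda>a. log_kernel a (F t)) \<in> borel_measurable borel" for a t
    using G1 G2 by simp_all
  show meas: "log_mean n \<in> borel_measurable lborel"
  proof -
    have "(\<lambda>x. indicator {0..2*pi} (snd x) * log_kernel (fst x) (F (snd x)))
        \<in> borel_measurable (lborel \<Otimes>\<^sub>M lborel)"
      using G by measurable
    then have "(\<lambda>a. \<integral>\<^sup>+ t. indicator {0..2*pi} t * log_kernel a (F t) \<partial>lborel) \<in> borel_measurable lborel"
      using lborel.borel_measurable_nn_integral_fst by fastforce
    then show ?thesis by (simp add: log_mean_def[abs_def] F_def r_def)
  qed
  have m: "(\<lambda>(a, t). indicator {-1/2..1/2} a * (indicator {0..2*pi} t * log_kernel a (F t)))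
      \<in> borel_measurable (lborel \<Otimes>\<^sub>M lborel)"
    unfolding case_prod_beta using G by measurable
  have "(\<integral>\<^sup>+ a. indicator {-1/2..1/2} a * log_mean n a \<partial>lborel)
      = (\<integral>\<^sup>+ a. (\<integral>\<^sup>+ t. indicator {-1/2..1/2} a * (indicator {0..2*pi} t * log_kernel a (F t)) \<partial>lborel) \<partial>lborel)"
    unfolding log_mean_def r_def[symmetric] F_def[symmetric]
    by (intro nn_integral_cong nn_integral_cmult[symmetric]) measurable
  also have "\<dots> = (\<integral>\<^sup>+ t. (\<integral>\<^sup>+ a. indicator {-1/2..1/2} a * (indicator {0..2*pi} t * log_kernel a (F t)) \<partial>lborel) \<partial>lborel)"
    by (rule lborel_pair.Fubini'[OF m, symmetric])
  also have "\<dots> = (\<integral>\<^sup>+ t. indicator {0..2*pi} t * (\<integral>\<^sup>+ a. indicator {-1/2..1/2} a * log_kernel a (F t) \<partial>lborel) \<partial>lborel)"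
  proof (rule nn_integral_cong)
    fix t
    have "(\<integral>\<^sup>+ a. indicator {0..2*pi} t * (indicator {-1/2..1/2} a * log_kernel a (F t)) \<partial>lborel)
      = indicator {0..2*pi} t * (\<integral>\<^sup>+ a. indicator {-1/2..1/2} a * log_kernel a (F t) \<partial>lborel)"
      by (intro nn_integral_cmult) measurable
    then show "(\<integral>\<^sup>+ a. indicator {-1/2..1/2} a * (indicator {0..2*pi} t * log_kernel a (F t)) \<partial>lborel)
      = indicator {0..2*pi} t * (\<integral>\<^sup>+ a. indicator {-1/2..1/2} a * log_kernel a (F t) \<partial>lborel)"
      by (simp add: mult.left_commute)
  qed
  also have "\<dots> \<le> (\<integral>\<^sup>+ t. ennreal (indicator {0..2*pi} t * (40 * (1 - (cmod (F t))\<^sup>2))) \<partial>lborel)"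
    using nn_integral_log_kernel[OF F_le]
    by (intro nn_integral_mono) (auto simp: indicator_def)
  also have "\<dots> = ennreal (40 * (2 * pi - 2 * pi * circle_mean \<Theta> r))"
  proof (rule nn_integral_has_integral_lebesgue)
    show "0 \<le> 40 * (1 - (cmod (F t))\<^sup>2)" for t
      using F_le[of t] by (simp add: abs_square_le_1)
    have "((\<lambda>t. (cmod (F t))\<^sup>2) has_integral integral {0..2*pi} (\<lambda>t. (cmod (F t))\<^sup>2)) {0..2*pi}"
      by (intro integrable_integral integrable_continuous_real continuous_intros F_cont)
    moreover have "((\<lambda>t. 1::real) has_integral 2 * pi) {0..2*pi}"
      using has_integral_const_real[of "1::real" 0 "2*pi"] by simp
    ultimately show "((\<lambda>t. 40 * (1 - (cmod (F t))\<^sup>2)) has_integral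
        40 * (2 * pi - 2 * pi * circle_mean \<Theta> r)) {0..2*pi}"
      unfolding circle_mean_def F_def[symmetric]
      by (intro has_integral_mult_right has_integral_diff) auto
  qed
  also have "40 * (2 * pi - 2 * pi * circle_mean \<Theta> r) = 80 * pi * (1 - circle_mean \<Theta> r)"
    by (simp add: algebra_simps)
  finally show "(\<integral>\<^sup>+ a. indicator {-1/2..1/2} a * log_mean n a \<partial>lborel)
      \<le> ennreal (80 * pi * (1 - circle_mean \<Theta> (1 - 1 / (real n + 2))))"
    unfolding r_def .
qed

text \<open>Fatou's lemma: the averages over \<open>a\<close> tend to 0 because the circle means of
  \<open>\<Theta>\<close> tend to 1.\<close>

lemma AE_liminf_log_mean: "AE a in lborel. liminf (\<lambda>n. indicator {-1/2..1/2} a * log_mean n a) = 0"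
proof -
  note [measurable] = borel_measurable_log_mean
  have "(\<integral>\<^sup>+ a. liminf (\<lambda>n. indicator {-1/2..1/2} a * log_mean n a) \<partial>lborel)
      \<le> liminf (\<lambda>n. \<integral>\<^sup>+ a. indicator {-1/2..1/2} a * log_mean n a \<partial>lborel)"
    by (rule nn_integral_liminf) measurable
  also have "\<dots> \<le> liminf (\<lambda>n. ennreal (80 * pi * (1 - circle_mean \<Theta> (1 - 1 / (real n + 2)))))"
    by (intro Liminf_mono always_eventually allI nn_integral_log_mean)
  also have "\<dots> = 0"
  proof (rule lim_imp_Liminf)
    have "(\<lambda>n. 80 * pi * (1 - circle_mean \<Theta> (1 - 1 / (real n + 2)))) \<longlonglongrightarrow> 80 * pi * (1 - 1)"
      by (intro tendsto_intros circle_mean_inner_function[OF inner])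
    then have "(\<lambda>n. ennreal (80 * pi * (1 - circle_mean \<Theta> (1 - 1 / (real n + 2))))) \<longlonglongrightarrow> ennreal (80 * pi * (1 - 1))"
      by (rule tendsto_ennrealI)
    then show "(\<lambda>n. ennreal (80 * pi * (1 - circle_mean \<Theta> (1 - 1 / (real n + 2))))) \<longlonglongrightarrow> 0"
      by simp
  qed simp
  finally have "(\<integral>\<^sup>+ a. liminf (\<lambda>n. indicator {-1/2..1/2} a * log_mean n a) \<partial>lborel) = 0"
    by simp
  then show ?thesis
    by (subst (asm) nn_integral_0_iff_AE) measurable
qed

text \<open>
  The last clause says that \<open>(\<Theta> - c) / (1 - cnj c \<Theta>)\<close> is the Blaschke product of its zeros, up to
  a constant factor: finite subproducts exhaust it because the remaining factor \<open>v\<close>, of norm at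
  most 1, can be made almost unimodular at 0.
\<close>

definition frostman_value :: "complex \<Rightarrow> bool" where
  "frostman_value c \<longleftrightarrow> cmod c \<le> 1/2 \<and> \<Theta> 0 \<noteq> c \<and>
     (\<forall>z\<in>unit_disc. \<Theta> z = c \<longrightarrow> deriv \<Theta> z \<noteq> 0) \<and>
     (\<forall>e>0. \<exists>J v. finite J \<and> J \<subseteq> {z\<in>unit_disc. \<Theta> z = c} \<and> norm v \<le> 1 \<and>
        (\<forall>z\<in>unit_disc. blaschke c (\<Theta> z) = (\<Prod>\<mu>\<in>J. blaschke \<mu> z) * fn v z) \<and>
        cmod (fn v 0) > 1 - e)"

text \<open>Real values in \<open>{-1/2..1/2}\<close> suffice. Besides the null set from Fatou's
  lemma only countably many are excluded: \<open>Re (\<Theta> 0)\<close> and the real parts of the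
  critical values. For the others the logarithmic mean is small at some radius, which makes the
  factor left by the zeros almost unimodular at 0.\<close>

lemma frostman:
  assumes nonconst: "\<not> \<Theta> constant_on unit_disc"
  shows "\<exists>c. frostman_value c"
proof -
  \<comment> \<open>A constant derivative of a nonconstant function has no zero, so in both cases
    the critical points are countable.\<close>
  have "\<not> deriv \<Theta> constant_on unit_disc \<or> (\<forall>z\<in>unit_disc. deriv \<Theta> z \<noteq> 0)"
  proof (rule ccontr)
    assume "\<not> ?thesis"
    then obtain z0 where "deriv \<Theta> constant_on unit_disc" "z0 \<in> unit_disc" "deriv \<Theta> z0 = 0" by blast
    then have "deriv \<Theta> z = 0" if "z \<in> unit_disc" for z
      using that unfolding constant_on_def by metis
    then have "(\<Theta> has_field_derivative 0) (at z)" if "z \<in> unit_disc" for z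
      using holomorphic_derivI[OF holomorphic open_ball that] that by metis
    then have "\<exists>c. \<forall>z\<in>unit_disc. \<Theta> z = c"
      using has_field_derivative_zero_constant[of unit_disc \<Theta>]
      by (metis convex_ball has_field_derivative_at_within)
    then show False using nonconst by (auto simp: constant_on_def)
  qed
  then have "countable {z \<in> unit_disc. deriv \<Theta> z = 0}"
  proof
    assume nc: "\<not> deriv \<Theta> constant_on unit_disc"
    have "finite {z \<in> cball 0 (1 - 1 / (real n + 2)). deriv \<Theta> z = 0}" for n
    proof (rule holomorphic_compact_finite_zeros[of _ unit_disc])
      show "cball 0 (1 - 1 / (real n + 2)) \<subseteq> unit_disc"
        by (simp add: cball_subset_ball_iff)
    qed (use nc in \<open>auto intro: holomorphic_deriv holomorphic\<close>)
    then have "countable (\<Union>n. {z \<in> cball 0 (1 - 1 / (real n + 2)). deriv \<Theta> z = 0})"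
      by (intro countable_UN[OF _ countable_finite]) auto
    moreover have "\<exists>n. cmod z \<le> 1 - 1 / (real n + 2)" if "cmod z < 1" for z
    proof -
      have "\<forall>\<^sub>F n in sequentially. cmod z < 1 - 1 / (real n + 2)"
        using order_tendstoD(1)[OF radial_tendsto that] .
      then show ?thesis
        by (auto simp: eventually_sequentially intro: less_imp_le)
    qed
    ultimately show ?thesis
      by (elim countable_subset[rotated]) auto
  next
    assume "\<forall>z\<in>unit_disc. deriv \<Theta> z \<noteq> 0"
    then have "{z \<in> unit_disc. deriv \<Theta> z = 0} = {}" by blast
    then show ?thesis by (simp only: countable_empty)
  qed
  then have "countable (insert (Re (\<Theta> 0)) ((\<lambda>z. Re (\<Theta> z)) ` {z \<in> unit_disc. deriv \<Theta> z = 0}))"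
    by simp
  from AE_not_in[OF countable_imp_null_set_lborel[OF this]] AE_liminf_log_mean
  have ae: "AE a in lborel. a \<noteq> Re (\<Theta> 0) \<and> (\<forall>z\<in>unit_disc. \<Theta> z = of_real a \<longrightarrow> deriv \<Theta> z \<noteq> 0) \<and>
      liminf (\<lambda>n. indicator {-1/2..1/2} a * log_mean n a) = 0" (is "AE a in _. ?P a")
    by eventually_elim force
  have "\<exists>a\<in>{-1/2..1/2}. ?P a"
  proof (rule ccontr)
    assume n: "\<not> ?thesis"
    from ae have "AE a in lborel. a \<notin> {-1/2..1/2::real}"
      by (rule eventually_mono) (use n in blast)
    then have "{-1/2..1/2::real} \<in> null_sets lborel"
      by (subst (asm) AE_iff_null_sets[symmetric]) auto
    then show False by (simp add: null_sets_def)
  qed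
  then obtain a where a: "a \<in> {-1/2..1/2}" and P: "?P a" by blast
  have lim: "liminf (\<lambda>n. log_mean n a) = 0" using P a by simp
  have "\<exists>J v. finite J \<and> J \<subseteq> {z\<in>unit_disc. \<Theta> z = of_real a} \<and> norm v \<le> 1 \<and>
        (\<forall>z\<in>unit_disc. blaschke (of_real a) (\<Theta> z) = (\<Prod>\<mu>\<in>J. blaschke \<mu> z) * fn v z) \<and>
        cmod (fn v 0) > 1 - e" if e: "e > 0" for e
  proof -
    have "\<exists>n. log_mean n a < ennreal (2 * pi * e)"
    proof (rule ccontr)
      assume "\<not> ?thesis"
      then have "ennreal (2 * pi * e) \<le> liminf (\<lambda>n. log_mean n a)"
        by (intro Liminf_bounded always_eventually) (auto simp: not_less)
      then have "2 * pi * e \<le> 0" using lim by (simp add: ennreal_eq_0_iff)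
      moreover have "2 * pi * e > 0" using e by simp
      ultimately show False by linarith
    qed
    then obtain n where n: "log_mean n a < ennreal (2 * pi * e)" by blast
    define s where "s = 1 - 1 / (real n + 2)"
    have s: "0 \<le> s" "s < 1" by (auto simp: s_def field_simps)
    have "\<bar>a\<bar> < 1" using a by auto
    from blaschke_approximation[OF nonconst _ this s] P obtain J v where
      J: "finite J" "J \<subseteq> {z\<in>unit_disc. \<Theta> z = of_real a}" "norm v \<le> 1"
        "\<And>z. z\<in>unit_disc \<Longrightarrow> blaschke (of_real a) (\<Theta> z) = (\<Prod>\<mu>\<in>J. blaschke \<mu> z) * fn v z"
        "fn v 0 \<noteq> 0" and le: "ennreal (2 * pi * - ln (cmod (fn v 0))) \<le> log_mean n a"
      unfolding log_mean_def s_def by blast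
    have "ennreal (2 * pi * - ln (cmod (fn v 0))) < ennreal (2 * pi * e)"
      using le n by (rule le_less_trans)
    then have "2 * pi * - ln (cmod (fn v 0)) < 2 * pi * e"
      using ennreal_leI leD not_less by blast
    then have "- ln (cmod (fn v 0)) < e"
      by (rule mult_less_cancel_left_pos[THEN iffD1, rotated]) simp
    then have "- e < ln (cmod (fn v 0))" by linarith
    then have "exp (- e) < cmod (fn v 0)"
      using J(5) by (subst (asm) exp_less_cancel_iff[symmetric]) simp
    moreover have "1 - e \<le> exp (- e)" using exp_ge_add_one_self[of "-e"] by simp
    ultimately have "cmod (fn v 0) > 1 - e" by linarith
    with J show ?thesis by blast
  qed
  then have "frostman_value (of_real a)"
    unfolding frostman_value_def using P a by auto
  then show ?thesis by blast
qed

text \<open>The phase \<open>\<alpha> n\<close> makes the value at 0 positive. A vector of norm at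
  most 1 whose value at 0 is close to 1 is close in norm to the constant 1, which gives convergence
  at every point.\<close>

lemma frostman_sequence:
  assumes "frostman_value c"
  obtains J \<alpha> v where "\<forall>n::nat. finite (J n)" "\<forall>n. J n \<subseteq> {z\<in>unit_disc. \<Theta> z = c}"
    "\<forall>n. cmod (\<alpha> n) = 1" "\<forall>n. norm (v n) \<le> 1"
    "\<forall>n. \<forall>z\<in>unit_disc. \<alpha> n * blaschke c (\<Theta> z) = (\<Prod>\<mu>\<in>J n. blaschke \<mu> z) * fn (v n) z"
    "\<forall>z\<in>unit_disc. (\<lambda>n. fn (v n) z) \<longlonglongrightarrow> 1"
proof -
  define P where "P n J v \<longleftrightarrow> finite J \<and> J \<subseteq> {z\<in>unit_disc. \<Theta> z = c} \<and> norm v \<le> 1 \<and>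
        (\<forall>z\<in>unit_disc. blaschke c (\<Theta> z) = (\<Prod>\<mu>\<in>J. blaschke \<mu> z) * fn v z) \<and>
        cmod (fn v 0) > 1 - 1 / real (n + 2)" for n J v
  have "\<exists>J v. P n J v" for n
    using assms unfolding frostman_value_def P_def by simp
  then obtain J v where P: "\<And>n. P n (J n) (v n)" by metis
  have J: "\<And>n. finite (J n)" "\<And>n. J n \<subseteq> {z\<in>unit_disc. \<Theta> z = c}"
    "\<And>n. norm (v n) \<le> 1"
    "\<And>n z. z \<in> unit_disc \<Longrightarrow> blaschke c (\<Theta> z) = (\<Prod>\<mu>\<in>J n. blaschke \<mu> z) * fn (v n) z"
    "\<And>n. cmod (fn (v n) 0) > 1 - 1 / real (n + 2)"
    using P unfolding P_def by blast+
  define \<alpha> where "\<alpha> n = cnj (sgn (fn (v n) 0))" for n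
  have v0: "fn (v n) 0 \<noteq> 0" for n
  proof -
    have "0 \<le> 1 - 1 / real (n + 2)" by simp
    then show ?thesis using J(5)[of n] by (metis leD norm_zero)
  qed
  have \<alpha>: "cmod (\<alpha> n) = 1" for n
    using v0 by (simp add: \<alpha>_def norm_sgn)
  define w where "w n = \<alpha> n *\<^sub>h v n" for n
  have w0: "fn (w n) 0 = of_real (cmod (fn (v n) 0))" for n
    using complex_norm_square[of "fn (v n) 0"] v0[of n]
    by (simp add: w_def \<alpha>_def sgn_eq field_simps power2_eq_square)
  have w1: "norm (w n) \<le> 1" for n
    using J(3)[of n] \<alpha> by (simp add: w_def)
  have "w \<longlonglongrightarrow> monom_h 0"
  proof (rule LIM_zero_cancel, rule tendsto_norm_zero_cancel, rule Lim_null_comparison)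
    show "(\<lambda>n. sqrt (2 / real (n + 2))) \<longlonglongrightarrow> 0" by real_asymp
    show "\<forall>\<^sub>F n in sequentially. norm (norm (w n - monom_h 0)) \<le> sqrt (2 / real (n + 2))"
    proof (intro always_eventually allI)
      fix n
      have "(norm (w n - monom_h 0))\<^sup>2 = (norm (w n))\<^sup>2 - 2 * cmod (fn (v n) 0) + 1"
        by (simp add: norm_diff_square cinner_monom_h cf_0 w0)
      also have "(norm (w n))\<^sup>2 \<le> 1" using w1[of n] by (simp add: power_le_one)
      finally have "(norm (w n - monom_h 0))\<^sup>2 \<le> 2 * (1 - cmod (fn (v n) 0))"
        by simp
      also have "\<dots> \<le> 2 / real (n + 2)" using J(5)[of n] by simp
      finally show "norm (norm (w n - monom_h 0)) \<le> sqrt (2 / real (n + 2))"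
        by (simp add: real_le_rsqrt)
    qed
  qed
  then have "(\<lambda>n. fn (w n) z) \<longlonglongrightarrow> fn (monom_h 0) z" for z
    by (rule tendsto_fn)
  then have "(\<lambda>n. fn (w n) z) \<longlonglongrightarrow> 1" if "z \<in> unit_disc" for z
    using fn_monom_h[OF that, of 0] by (metis power_0)
  moreover have "\<alpha> n * blaschke c (\<Theta> z) = (\<Prod>\<mu>\<in>J n. blaschke \<mu> z) * fn (w n) z"
    if "z \<in> unit_disc" for n z
    using J(4)[OF that, of n] by (simp add: w_def)
  ultimately show ?thesis
    using J(1,2) \<alpha> w1 by (intro that[of J \<alpha> w]) blast+
qed

text \<open>
  With \<open>\<psi> = (\<Theta> - c) / (1 - cnj c \<Theta>)\<close>, a function \<open>u\<close> vanishing on the fibre is the weak limit of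
  functions \<open>X n = (\<Theta> - c) k n\<close>, and \<open>u\<close> being orthogonal to \<open>\<Theta> H\<^sup>2\<close> forces \<open>k n\<close> to tend to 0 weakly.
\<close>

lemma frostman_fibre_unique:
  assumes c: "frostman_value c" and u: "u \<in> K" "\<And>z. z \<in> unit_disc \<Longrightarrow> \<Theta> z = c \<Longrightarrow> fn u z = 0"
  shows "u = 0"
proof -
  obtain J \<alpha> v where J: "\<forall>n::nat. finite (J n)" "\<forall>n. J n \<subseteq> {z\<in>unit_disc. \<Theta> z = c}"
    "\<forall>n. cmod (\<alpha> n) = 1" "\<forall>n. norm (v n) \<le> 1"
    "\<forall>n. \<forall>z\<in>unit_disc. \<alpha> n * blaschke c (\<Theta> z) = (\<Prod>\<mu>\<in>J n. blaschke \<mu> z) * fn (v n) z"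
    "\<forall>z\<in>unit_disc. (\<lambda>n. fn (v n) z) \<longlonglongrightarrow> 1"
    by (rule frostman_sequence[OF c])
  note J = J[rule_format]
  have "\<forall>n. \<exists>q. norm q = norm u \<and> (\<forall>z\<in>unit_disc. fn u z = (\<Prod>\<mu>\<in>J n. blaschke \<mu> z) * fn q z)"
  proof
    fix n
    show "\<exists>q. norm q = norm u \<and> (\<forall>z\<in>unit_disc. fn u z = (\<Prod>\<mu>\<in>J n. blaschke \<mu> z) * fn q z)"
      using J(2)[of n] u(2) by (intro blaschke_division J(1)) auto
  qed
  then obtain q where q: "\<And>n. norm (q n) = norm u"
    "\<And>n z. z \<in> unit_disc \<Longrightarrow> fn u z = (\<Prod>\<mu>\<in>J n. blaschke \<mu> z) * fn (q n) z"
    unfolding choice_iff by blast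
  have c1: "cmod c \<le> 1/2" using c by (simp add: frostman_value_def)
  \<comment> \<open>The denominator of \<open>blaschke c (\<Theta> z)\<close>; it is bounded away
    from 0, so division by it acts on H^2.\<close>
  define D where "D z = 1 - cnj c * \<Theta> z" for z
  have D: "1/2 \<le> cmod (D z)" if "z \<in> unit_disc" for z
  proof -
    have "cmod (cnj c * \<Theta> z) \<le> 1/2 * 1"
      unfolding norm_mult using c1 bound[OF that] by (intro mult_mono) auto
    then show ?thesis
      using norm_triangle_ineq2[of 1 "cnj c * \<Theta> z"] by (simp add: D_def)
  qed
  have D0: "D z \<noteq> 0" if "z \<in> unit_disc" for z using D[OF that] by auto
  define I where "I = mult (\<lambda>z. 1 / D z)"
  have I: "fn (I g) z = 1 / D z * fn g z" and nI: "norm (I g) \<le> 2 * norm g" for g z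
  proof -
    have 1: "(\<lambda>z. 1 / D z) holomorphic_on unit_disc"
      unfolding D_def using D0 by (intro holomorphic_intros holomorphic) (auto simp: D_def)
    have 2: "cmod (1 / D z) \<le> 2" if "z \<in> unit_disc" for z
      using D[OF that] D0[OF that] by (simp add: norm_divide field_simps)
    show "fn (I g) z = 1 / D z * fn g z" "norm (I g) \<le> 2 * norm g"
      unfolding I_def by (rule fn_mult[OF 1 2] norm_mult_le[OF 1 2]; assumption)+
  qed
  define k where "k n = \<alpha> n *\<^sub>h I (q n)" for n
  define X where "X n = T (k n) - c *\<^sub>h k n" for n
  have X: "fn (X n) z = fn u z * fn (v n) z" if z: "z \<in> unit_disc" for n z
  proof -
    have "fn (X n) z = (\<Theta> z - c) * (\<alpha> n * (1 / D z * fn (q n) z))"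
      by (simp only: X_def k_def fn_simps fn_T fn_scaleC I left_diff_distrib)
    also have "\<dots> = (\<alpha> n * blaschke c (\<Theta> z)) * fn (q n) z"
      by (simp add: blaschke_def D_def)
    also have "\<dots> = fn u z * fn (v n) z"
      unfolding J(5)[OF z] q(2)[OF z, of n] by simp
    finally show ?thesis .
  qed
  have nX: "norm (X n) \<le> 3 * norm u" for n
  proof -
    have nk: "norm (k n) \<le> 2 * norm u"
      using nI[of "q n"] by (simp add: k_def J(3) q(1))
    have "norm (T (k n)) \<le> norm (k n)"
      unfolding T_def using norm_mult_le[OF holomorphic bound, of "k n"] by simp
    moreover have "cmod c * norm (k n) \<le> 1/2 * norm (k n)"
      using c1 by (intro mult_right_mono) auto
    ultimately show ?thesis
      using norm_triangle_ineq4[of "T (k n)" "c *\<^sub>h k n"] nk by (simp add: X_def)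
  qed
  have limX: "(\<lambda>n. fn (X n) z) \<longlonglongrightarrow> fn u z" if z: "z \<in> unit_disc" for z
    unfolding X[OF z] using tendsto_mult[OF tendsto_const J(6)[OF z], of "fn u z"] by simp
  have weak: "(\<lambda>n. cinner h (X n)) \<longlonglongrightarrow> cinner h u" for h
  proof (rule tendsto_cinner_of_total[OF nX closure_combos_szego])
    fix z assume z: "z \<in> unit_disc"
    have e: "cinner (szego z) f = cnj (fn f z)" for f
      using cinner_szego[OF z, of f] cinner_commute by metis
    show "(\<lambda>n. cinner (szego z) (X n)) \<longlonglongrightarrow> cinner (szego z) u"
      unfolding e by (intro tendsto_intros limX z)
  qed
  show ?thesis
  proof (rule hardy_eqI)
    fix z assume z: "z \<in> unit_disc"
    define p where "p = I (szego z)"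
    have p: "szego z = p - cnj c *\<^sub>h T p"
    proof (rule hardy_eqI)
      fix x assume x: "x \<in> unit_disc"
      have "fn (p - cnj c *\<^sub>h T p) x = D x * fn p x"
        by (simp add: D_def algebra_simps)
      then show "fn (szego z) x = fn (p - cnj c *\<^sub>h T p) x"
        using D0[OF x] by (simp add: p_def I)
    qed
    \<comment> \<open>As \<open>T\<close> is isometric, \<open>cinner k (p - cnj c *\<^sub>h T p) =
      cinner (T k - c *\<^sub>h k) (T p)\<close>; with \<open>k = k n\<close> the right side tends
      to \<open>cinner u (T p) = 0\<close>.\<close>
    have "cinner (k n) (szego z) = cinner (X n) (T p)" for n
      unfolding p X_def by (simp add: cinner_distribs)
    then have "fn (k n) z = cinner (X n) (T p)" for n
      using cinner_szego[OF z] by metis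
    then have "fn (k n) z = cnj (cinner (T p) (X n))" for n
      using cinner_commute by metis
    moreover have "(\<lambda>n. cnj (cinner (T p) (X n))) \<longlonglongrightarrow> cnj (cinner (T p) u)"
      by (intro tendsto_intros weak)
    moreover have "cinner (T p) u = 0"
      using u(1) cinner_commute[of "T p" u] by (simp add: K_def)
    ultimately have "(\<lambda>n. fn (k n) z) \<longlonglongrightarrow> 0" by simp
    from tendsto_mult[OF tendsto_const this, of "\<Theta> z - c"]
    have "(\<lambda>n. fn (X n) z) \<longlonglongrightarrow> 0"
      by (simp add: X_def algebra_simps)
    from LIMSEQ_unique[OF limX[OF z] this] show "fn u z = fn 0 z"
      by simp
  qed
qed

section \<open>The fibre accumulates at points of the spectrum\<close>

lemma small_near_spectrum:
  assumes "\<zeta> \<in> boundary_spectrum \<Theta>" "e > 0" "\<rho> > 0"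
  shows "\<exists>z\<in>unit_disc. dist z \<zeta> < \<rho> \<and> cmod (\<Theta> z) < e"
proof (rule ccontr)
  assume n: "\<not> ?thesis"
  have "\<forall>\<^sub>F z in at \<zeta> within unit_disc. ereal e \<le> ereal (cmod (\<Theta> z))"
    unfolding eventually_at using n assms(3) by (intro exI[of _ \<rho>]) (auto simp: not_less)
  then have "ereal e \<le> Liminf (at \<zeta> within unit_disc) (\<lambda>z. ereal (cmod (\<Theta> z)))"
    by (rule Liminf_bounded)
  then show False
    using assms by (simp add: boundary_spectrum_def zero_ereal_def)
qed

text \<open>If the fibre kept away from \<open>\<zeta>\<close>, each
  \<open>1 - (cmod (blaschke \<mu> z))\<^sup>2\<close> would near \<open>\<zeta>\<close> be at most
  \<open>(1 - (cmod \<mu>)\<^sup>2) * (1 - (cmod z)\<^sup>2) / \<delta>\<^sup>2\<close>. As the sums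
  of \<open>1 - (cmod \<mu>)\<^sup>2\<close> are bounded, the product has modulus near 1 there,
  whereas \<open>\<Theta>\<close> takes small values near a point of the spectrum.\<close>

lemma frostman_fibre_islimpt:
  assumes c: "frostman_value c" and \<zeta>: "\<zeta> \<in> boundary_spectrum \<Theta>"
  shows "\<zeta> islimpt {z\<in>unit_disc. \<Theta> z = c}"
proof (rule ccontr)
  assume "\<not> ?thesis"
  then obtain \<delta>2 where \<delta>2: "\<delta>2 > 0" "\<And>z. z \<in> unit_disc \<Longrightarrow> \<Theta> z = c \<Longrightarrow> dist z \<zeta> < \<delta>2 \<Longrightarrow> z = \<zeta>"
    unfolding islimpt_approachable by blast
  have \<zeta>1: "cmod \<zeta> = 1" using \<zeta> by (simp add: boundary_spectrum_def)
  define \<delta> where "\<delta> = \<delta>2 / 2"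
  have \<delta>: "\<delta> > 0" using \<delta>2(1) by (simp add: \<delta>_def)
  have far: "\<delta> \<le> cmod (z - \<mu>)" if "\<mu> \<in> unit_disc" "\<Theta> \<mu> = c" "dist z \<zeta> < \<delta>" for \<mu> z
  proof -
    have "\<mu> \<noteq> \<zeta>" using that(1) \<zeta>1 by auto
    then have "\<delta>2 \<le> dist \<mu> \<zeta>" using \<delta>2(2)[OF that(1,2)] by force
    also have "\<dots> \<le> dist \<mu> z + dist z \<zeta>" by (rule dist_triangle)
    finally show ?thesis
      using that(3) by (simp add: \<delta>_def dist_norm norm_minus_commute)
  qed
  have c1: "cmod c \<le> 1/2" "\<Theta> 0 \<noteq> c" using c by (auto simp: frostman_value_def)
  obtain J \<alpha> v where J: "\<forall>n::nat. finite (J n)" "\<forall>n. J n \<subseteq> {z\<in>unit_disc. \<Theta> z = c}"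
    "\<forall>n. cmod (\<alpha> n) = 1" "\<forall>n. norm (v n) \<le> 1"
    "\<forall>n. \<forall>z\<in>unit_disc. \<alpha> n * blaschke c (\<Theta> z) = (\<Prod>\<mu>\<in>J n. blaschke \<mu> z) * fn (v n) z"
    "\<forall>z\<in>unit_disc. (\<lambda>n. fn (v n) z) \<longlonglongrightarrow> 1"
    by (rule frostman_sequence[OF c])
  note J = J[rule_format]
  define \<psi> where "\<psi> z = blaschke c (\<Theta> z)" for z
  have abs: "cmod (\<psi> z) = (\<Prod>\<mu>\<in>J n. cmod (blaschke \<mu> z)) * cmod (fn (v n) z)" if "z \<in> unit_disc" for z n
    using arg_cong[OF J(5)[OF that, of n], of cmod] J(3)[of n]
    by (simp add: \<psi>_def norm_mult prod_norm)
  have \<psi>0: "\<psi> 0 \<noteq> 0"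
    unfolding \<psi>_def using c1 bound[of 0] by (subst blaschke_eq_0_iff) auto
  \<comment> \<open>From \<open>cmod (\<psi> 0) \<le> (\<Prod>\<mu>\<in>J n. cmod \<mu>)\<close> and
    \<open>1 - x \<le> - ln x\<close> this bounds the Blaschke sums for all \<open>n\<close> at
    once.\<close>
  define C where "C = - ln ((cmod (\<psi> 0))\<^sup>2)"
  have sum_le: "(\<Sum>\<mu>\<in>J n. 1 - (cmod \<mu>)\<^sup>2) \<le> C" for n
  proof -
    have v0: "cmod (fn (v n) 0) \<le> 1"
      using cf_bound[of "v n" 0] J(4)[of n] unfolding cf_0 by linarith
    have e: "cmod (\<psi> 0) = (\<Prod>\<mu>\<in>J n. cmod \<mu>) * cmod (fn (v n) 0)"
      using abs[of 0 n] by (simp add: blaschke_def)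
    then have "cmod (\<psi> 0) \<le> (\<Prod>\<mu>\<in>J n. cmod \<mu>)"
      using v0 by (simp add: mult_left_le prod_nonneg)
    then have "(cmod (\<psi> 0))\<^sup>2 \<le> (\<Prod>\<mu>\<in>J n. cmod \<mu>)\<^sup>2" by (intro power_mono) auto
    also have "\<dots> = (\<Prod>\<mu>\<in>J n. (cmod \<mu>)\<^sup>2)" by (simp add: prod_power_distrib)
    finally have le: "(cmod (\<psi> 0))\<^sup>2 \<le> (\<Prod>\<mu>\<in>J n. (cmod \<mu>)\<^sup>2)" .
    have pos: "(cmod (\<psi> 0))\<^sup>2 > 0" using \<psi>0 by simp
    have nz: "\<mu> \<noteq> 0" if "\<mu> \<in> J n" for \<mu>
    proof
      assume "\<mu> = 0"
      then have "(\<Prod>\<mu>\<in>J n. cmod \<mu>) = 0" using that by (intro prod_zero J(1)) auto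
      then show False using e \<psi>0 by simp
    qed
    have "(\<Sum>\<mu>\<in>J n. 1 - (cmod \<mu>)\<^sup>2) \<le> (\<Sum>\<mu>\<in>J n. - ln ((cmod \<mu>)\<^sup>2))"
    proof (rule sum_mono)
      fix \<mu> assume "\<mu> \<in> J n"
      then have "0 < (cmod \<mu>)\<^sup>2" using nz by simp
      from ln_le_minus_one[OF this] show "1 - (cmod \<mu>)\<^sup>2 \<le> - ln ((cmod \<mu>)\<^sup>2)" by linarith
    qed
    also have "\<dots> = - ln (\<Prod>\<mu>\<in>J n. (cmod \<mu>)\<^sup>2)"
      using nz by (subst ln_prod) (auto simp: sum_negf J(1))
    also have "\<dots> \<le> C"
      unfolding C_def using le pos less_le_trans[OF pos le] by (simp only: ln_le_cancel_iff neg_le_iff_le)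
    finally show ?thesis .
  qed
  have lower: "1 - C * (1 - (cmod z)\<^sup>2) / \<delta>\<^sup>2 \<le> (cmod (\<psi> z))\<^sup>2"
    if z: "z \<in> unit_disc" and near: "dist z \<zeta> < \<delta>" for z
  proof -
    have B: "1 - C * (1 - (cmod z)\<^sup>2) / \<delta>\<^sup>2 \<le> (\<Prod>\<mu>\<in>J n. (cmod (blaschke \<mu> z))\<^sup>2)" for n
    proof -
      define f where "f \<mu> = 1 - (cmod (blaschke \<mu> z))\<^sup>2" for \<mu>
      have D: "\<mu> \<in> unit_disc" "\<Theta> \<mu> = c" if "\<mu> \<in> J n" for \<mu> using that J(2)[of n] by auto
      have f01: "f \<mu> \<in> {0..1}" if "\<mu> \<in> J n" for \<mu>
        using cmod_blaschke_le[of \<mu> z] D[OF that] z by (auto simp: f_def abs_square_le_1)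
      have f_le: "f \<mu> \<le> (1 - (cmod \<mu>)\<^sup>2) * ((1 - (cmod z)\<^sup>2) / \<delta>\<^sup>2)" if "\<mu> \<in> J n" for \<mu>
      proof -
        have \<mu>: "cmod \<mu> < 1" "cmod z \<le> 1" using D[OF that] z by auto
        have "cmod (z - \<mu>) \<le> cmod (1 - cnj \<mu> * z)"
          using cmod_blaschke_le[OF \<mu>] blaschke_denom[OF \<mu>]
          by (simp add: blaschke_def norm_divide divide_le_eq)
        then have "\<delta> \<le> cmod (1 - cnj \<mu> * z)"
          using far[OF D[OF that] near] by linarith
        then show ?thesis
          unfolding f_def one_minus_blaschke[OF \<mu>] times_divide_eq_right using \<mu> \<delta>
          by (intro frac_le mult_nonneg_nonneg power_mono) (auto simp: abs_square_le_1)
      qed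
      have "(\<Sum>\<mu>\<in>J n. f \<mu>) \<le> (\<Sum>\<mu>\<in>J n. 1 - (cmod \<mu>)\<^sup>2) * ((1 - (cmod z)\<^sup>2) / \<delta>\<^sup>2)"
        unfolding sum_distrib_right by (intro sum_mono f_le)
      also have "\<dots> \<le> C * ((1 - (cmod z)\<^sup>2) / \<delta>\<^sup>2)"
        using z sum_le[of n] by (intro mult_right_mono) (auto simp: abs_square_le_1)
      finally have "1 - C * (1 - (cmod z)\<^sup>2) / \<delta>\<^sup>2 \<le> 1 - (\<Sum>\<mu>\<in>J n. f \<mu>)" by simp
      also have "\<dots> \<le> (\<Prod>\<mu>\<in>J n. 1 - f \<mu>)" by (rule Weierstrass_prod_ineq[OF f01])
      finally show ?thesis by (simp add: f_def)
    qed
    have "(\<lambda>n. (1 - C * (1 - (cmod z)\<^sup>2) / \<delta>\<^sup>2) * (cmod (fn (v n) z))\<^sup>2)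
        \<longlonglongrightarrow> (1 - C * (1 - (cmod z)\<^sup>2) / \<delta>\<^sup>2) * (cmod 1)\<^sup>2"
      by (intro tendsto_intros J(6) z)
    moreover have "(1 - C * (1 - (cmod z)\<^sup>2) / \<delta>\<^sup>2) * (cmod (fn (v n) z))\<^sup>2 \<le> (cmod (\<psi> z))\<^sup>2" for n
      unfolding abs[OF z, of n] power_mult_distrib prod_power_distrib
      by (intro mult_right_mono B) auto
    ultimately have "(1 - C * (1 - (cmod z)\<^sup>2) / \<delta>\<^sup>2) * (cmod 1)\<^sup>2 \<le> (cmod (\<psi> z))\<^sup>2"
      by (intro LIMSEQ_le_const2) auto
    then show ?thesis by simp
  qed
  have "\<forall>\<^sub>F z in nhds \<zeta>. C * (1 - (cmod z)\<^sup>2) / \<delta>\<^sup>2 < 1/4"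
  proof (rule order_tendstoD(2))
    show "((\<lambda>z. C * (1 - (cmod z)\<^sup>2) / \<delta>\<^sup>2) \<longlongrightarrow> C * (1 - (cmod \<zeta>)\<^sup>2) / \<delta>\<^sup>2) (nhds \<zeta>)"
      using \<delta> by (intro tendsto_intros filterlim_ident) auto
  qed (simp add: \<zeta>1)
  then obtain \<rho> where \<rho>: "\<rho> > 0" "\<And>z. dist z \<zeta> < \<rho> \<Longrightarrow> C * (1 - (cmod z)\<^sup>2) / \<delta>\<^sup>2 < 1/4"
    unfolding eventually_nhds_metric by blast
  obtain z where z: "z \<in> unit_disc" "dist z \<zeta> < min \<rho> \<delta>" "cmod (\<Theta> z) < 1/8"
    using small_near_spectrum[OF \<zeta>, of "1/8" "min \<rho> \<delta>"] \<rho>(1) \<delta> by auto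
  have "3/4 \<le> (cmod (\<psi> z))\<^sup>2"
    using lower[OF z(1)] \<rho>(2)[of z] z(2) by simp
  \<comment> \<open>From \<open>cmod c \<le> 1/2\<close> and \<open>cmod (\<Theta> z) < 1/8\<close>
    comes \<open>(5/8) / (15/16) = 2/3\<close>, whose square \<open>4/9\<close> is below the lower
    bound \<open>3/4\<close>.\<close>
  moreover have "cmod (\<psi> z) \<le> 2/3"
  proof -
    have 1: "cmod (\<Theta> z - c) \<le> 5/8"
      using norm_triangle_ineq4[of "\<Theta> z" c] z(3) c1 by simp
    have "cmod (cnj c * \<Theta> z) \<le> 1/2 * (1/8)"
      unfolding norm_mult using c1 z(3) by (intro mult_mono) auto
    then have 2: "15/16 \<le> cmod (1 - cnj c * \<Theta> z)"
      using norm_triangle_ineq2[of 1 "cnj c * \<Theta> z"] by simp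
    have "cmod (\<psi> z) \<le> (5/8) / (15/16)"
      unfolding \<psi>_def blaschke_def norm_divide using 1 2 by (intro frac_le) auto
    then show ?thesis by simp
  qed
  then have "(cmod (\<psi> z))\<^sup>2 \<le> (2/3)\<^sup>2" by (intro power_mono) auto
  ultimately show False by (simp add: power2_eq_square)
qed

section \<open>The kernel at a Caratheodory point\<close>

definition rad :: "complex \<Rightarrow> nat \<Rightarrow> complex" where
  "rad \<zeta> n = of_real (1 - 1 / (real n + 2)) * \<zeta>"

lemma cmod_rad: "cmod \<zeta> = 1 \<Longrightarrow> cmod (rad \<zeta> n) = 1 - 1 / (real n + 2)"
  unfolding rad_def norm_mult norm_of_real by simp

lemma cmod_rad_diff: "cmod \<zeta> = 1 \<Longrightarrow> cmod (rad \<zeta> n - \<zeta>) = 1 / (real n + 2)"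
proof -
  assume \<zeta>: "cmod \<zeta> = 1"
  have "rad \<zeta> n - \<zeta> = of_real (- (1 / (real n + 2))) * \<zeta>"
    by (simp add: rad_def algebra_simps)
  then show ?thesis
    using \<zeta> by (simp only: norm_mult norm_of_real) simp
qed

lemma rad_in_disc: "cmod \<zeta> = 1 \<Longrightarrow> rad \<zeta> n \<in> unit_disc"
  by (simp add: cmod_rad)

lemma tendsto_rad: "rad \<zeta> \<longlonglongrightarrow> \<zeta>"
proof -
  have "(\<lambda>n. complex_of_real (1 - 1 / (real n + 2)) * \<zeta>) \<longlonglongrightarrow> complex_of_real 1 * \<zeta>"
    by (rule tendsto_mult[OF tendsto_of_real[OF radial_tendsto] tendsto_const])
  then show ?thesis
    by (simp only: rad_def[abs_def] of_real_1 mult_1)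
qed

lemma caratheodory_radial:
  assumes "caratheodory_point \<Theta> \<zeta>"
  shows "\<exists>w d. cmod w = 1 \<and> (\<lambda>n. \<Theta> (rad \<zeta> n)) \<longlonglongrightarrow> w \<and>
    (\<lambda>n. (\<Theta> (rad \<zeta> n) - w) / (rad \<zeta> n - \<zeta>)) \<longlonglongrightarrow> d"
proof -
  obtain w d where \<zeta>: "cmod \<zeta> = 1" and w: "cmod w = 1"
    and lims: "nontangential_limit \<Theta> \<zeta> w" "nontangential_limit (\<lambda>z. (\<Theta> z - w) / (z - \<zeta>)) \<zeta> d"
    using assms by (auto simp: caratheodory_point_def)
  \<comment> \<open>On the radius \<open>cmod (z - \<zeta>) = 1 - cmod z\<close>, so any aperture
    above 1 contains it; 2 is a convenient choice.\<close>
  have in_stolz: "rad \<zeta> n \<in> stolz_region \<zeta> 2" and ne: "rad \<zeta> n \<noteq> \<zeta>" for n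
  proof -
    have "1 / (real n + 2) < 2 / (real n + 2)" by (intro divide_strict_right_mono) auto
    then show "rad \<zeta> n \<in> stolz_region \<zeta> 2"
      using rad_in_disc[OF \<zeta>, of n] by (simp add: stolz_region_def cmod_rad cmod_rad_diff \<zeta>)
    show "rad \<zeta> n \<noteq> \<zeta>"
      using cmod_rad_diff[OF \<zeta>, of n] by auto
  qed
  have "filterlim (rad \<zeta>) (at \<zeta> within stolz_region \<zeta> 2) sequentially"
    unfolding filterlim_at using in_stolz ne tendsto_rad by simp
  note compose = filterlim_compose[OF _ this]
  have "(\<Theta> \<longlongrightarrow> w) (at \<zeta> within stolz_region \<zeta> 2)"
    "((\<lambda>z. (\<Theta> z - w) / (z - \<zeta>)) \<longlongrightarrow> d) (at \<zeta> within stolz_region \<zeta> 2)"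
    using lims by (auto simp: nontangential_limit_def)
  from compose[OF this(1)] compose[OF this(2)] w show ?thesis by blast
qed

text \<open>At the radial points the squared norm of the kernel,
  \<open>(1 - (cmod (\<Theta> z))\<^sup>2) / (1 - (cmod z)\<^sup>2)\<close>, stays bounded because
  the difference quotient of \<open>\<Theta>\<close> does. The kernels converge pointwise to
  \<open>(1 - cnj w * \<Theta> z) / (1 - cnj \<zeta> * z)\<close>, hence weakly, and this limit is
  \<open>k\<close>.\<close>

lemma boundary_kernel:
  assumes "caratheodory_point \<Theta> \<zeta>"
  shows "\<exists>k\<in>K. \<forall>f\<in>K. (\<lambda>n. fn f (rad \<zeta> n)) \<longlonglongrightarrow> cinner f k"
proof -
  obtain w d where w: "cmod w = 1" "(\<lambda>n. \<Theta> (rad \<zeta> n)) \<longlonglongrightarrow> w"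
    and d: "(\<lambda>n. (\<Theta> (rad \<zeta> n) - w) / (rad \<zeta> n - \<zeta>)) \<longlonglongrightarrow> d"
    using caratheodory_radial[OF assms] by blast
  have \<zeta>: "cmod \<zeta> = 1" using assms by (simp add: caratheodory_point_def)
  note D = rad_in_disc[OF \<zeta>]
  obtain B where B: "\<And>n. cmod ((\<Theta> (rad \<zeta> n) - w) / (rad \<zeta> n - \<zeta>)) \<le> B"
    using convergent_imp_Bseq[OF convergentI[OF d]] by (auto simp: Bseq_def)
  have B0: "B \<ge> 0" using B[of 0] norm_ge_zero order_trans by blast
  have norm_le: "norm (ker (rad \<zeta> n)) \<le> sqrt (2 * B)" for n
  proof -
    define r where "r = 1 - 1 / (real n + 2)"
    have r: "0 \<le> r" "r < 1" by (auto simp: r_def field_simps)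
    let ?x = "rad \<zeta> n"
    have 1: "cmod (?x - \<zeta>) = 1 - r" and 2: "cmod ?x = r"
      by (simp_all add: r_def cmod_rad cmod_rad_diff \<zeta>)
    have "cmod (\<Theta> ?x - w) \<le> B * (1 - r)"
      using B[of n] r unfolding norm_divide 1 by (simp add: divide_le_eq)
    moreover have "1 - cmod (\<Theta> ?x) \<le> cmod (\<Theta> ?x - w)"
      using norm_triangle_ineq2[of w "\<Theta> ?x"] w(1) by (simp add: norm_minus_commute)
    ultimately have 3: "1 - cmod (\<Theta> ?x) \<le> B * (1 - r)" by linarith
    have "1 - (cmod (\<Theta> ?x))\<^sup>2 = (1 - cmod (\<Theta> ?x)) * (1 + cmod (\<Theta> ?x))"
      by (simp add: power2_eq_square algebra_simps)
    also have "\<dots> \<le> (B * (1 - r)) * 2"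
      using 3 bound[OF D[of n]] B0 r by (intro mult_mono) auto
    finally have "(norm (ker ?x))\<^sup>2 \<le> (B * (1 - r)) * 2 / (1 - r\<^sup>2)"
      unfolding norm_ker[OF D] 2 using r by (intro divide_right_mono) (auto simp: abs_square_le_1)
    also have "1 - r\<^sup>2 = (1 - r) * (1 + r)" by (simp add: power2_eq_square algebra_simps)
    also have "(B * (1 - r)) * 2 / ((1 - r) * (1 + r)) = 2 * B / (1 + r)"
      using r by simp
    also have "\<dots> \<le> 2 * B / 1" using B0 r by (intro divide_left_mono) auto
    finally show ?thesis by (intro real_le_rsqrt) simp
  qed
  define g where "g z = (1 - cnj w * \<Theta> z) / (1 - cnj \<zeta> * z)" for z
  have nz: "1 - cnj \<zeta> * z \<noteq> 0" if "z \<in> unit_disc" for z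
  proof
    assume "1 - cnj \<zeta> * z = 0"
    then have "cmod (cnj \<zeta> * z) = 1" by simp
    then show False using that \<zeta> by (simp add: norm_mult)
  qed
  have hol: "g holomorphic_on unit_disc"
    unfolding g_def using nz by (intro holomorphic_intros holomorphic) auto
  have pw: "(\<lambda>n. fn (ker (rad \<zeta> n)) z) \<longlonglongrightarrow> g z" if z: "z \<in> unit_disc" for z
    unfolding fn_ker[OF D z] g_def by (intro tendsto_intros w tendsto_rad nz z)
  obtain k where k: "\<And>z. z \<in> unit_disc \<Longrightarrow> fn k z = g z"
    using hardy_exists_of_bounded_limit[of g "\<lambda>n. ker (rad \<zeta> n)", OF hol norm_le pw] by blast
  have weak: "(\<lambda>n. cinner h (ker (rad \<zeta> n))) \<longlonglongrightarrow> cinner h k" for h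
  proof (rule tendsto_cinner_of_total[OF norm_le closure_combos_szego])
    fix z assume z: "z \<in> unit_disc"
    have e: "cinner (szego z) f = cnj (fn f z)" for f
      using cinner_szego[OF z, of f] cinner_commute by metis
    show "(\<lambda>n. cinner (szego z) (ker (rad \<zeta> n))) \<longlonglongrightarrow> cinner (szego z) k"
      unfolding e k[OF z] by (intro tendsto_intros pw z)
  qed
  have "cinner k (T p) = 0" for p
  proof -
    have "cinner (T p) (ker (rad \<zeta> n)) = 0" for n
      using ker_in_K[OF D] cinner_commute[of "T p" "ker (rad \<zeta> n)"] by (simp add: K_def)
    then have "(\<lambda>n. cinner (T p) (ker (rad \<zeta> n))) \<longlonglongrightarrow> 0" by simp
    from LIMSEQ_unique[OF weak this] have "cinner (T p) k = 0" .
    then show ?thesis by (metis cinner_commute complex_cnj_zero)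
  qed
  then have "k \<in> K" by (simp add: K_def)
  moreover have "(\<lambda>n. fn f (rad \<zeta> n)) \<longlonglongrightarrow> cinner f k" if "f \<in> K" for f
    using weak[of f] unfolding cinner_ker[OF D that] .
  ultimately show ?thesis by blast
qed

end

section \<open>Moving zeros\<close>

lemma hardy_eq_0_of_islimpt:
  assumes "S \<subseteq> unit_disc" "\<xi> \<in> unit_disc" "\<xi> islimpt S" "\<And>z. z \<in> S \<Longrightarrow> fn u z = 0"
  shows "u = 0"
proof (rule hardy_eqI)
  fix z :: complex assume z: "z \<in> unit_disc"
  show "fn u z = fn 0 z"
    using analytic_continuation[OF fn_holomorphic open_ball connected_ball assms(1-3) _ z] assms(4)
    by simp
qed

lemma nonzero_point_exists:
  fixes f :: hardy
  assumes "open A" "A \<noteq> {}" "A \<subseteq> unit_disc" "f \<noteq> 0"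
  shows "\<exists>\<xi>\<in>A. fn f \<xi> \<noteq> 0"
proof (rule ccontr)
  assume n: "\<not> ?thesis"
  obtain \<xi> where \<xi>: "\<xi> \<in> A" using assms(2) by blast
  then have "\<xi> islimpt A" using assms(1) by (simp add: interior_limit_point interior_open)
  with n \<xi> assms show False
    using hardy_eq_0_of_islimpt[OF assms(3), of \<xi> f] by blast
qed

locale model_boundary = model +
  fixes \<zeta> h
  assumes spectrum: "\<zeta> \<in> boundary_spectrum \<Theta>"
    and h_K: "h \<in> K"
    and radial: "\<And>f. f \<in> K \<Longrightarrow> (\<lambda>n. fn f (rad \<zeta> n)) \<longlonglongrightarrow> cinner f h"
begin

lemma cmod_\<zeta>: "cmod \<zeta> = 1"
  using spectrum by (simp add: boundary_spectrum_def)

lemma \<zeta>_notin_disc: "\<zeta> \<notin> unit_disc"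
  using cmod_\<zeta> by simp

text \<open>By \<open>fn_bound\<close> functions in H^2 grow at most like
  \<open>1 / sqrt (1 - r)\<close> along the radius, while the factor \<open>z - \<zeta>\<close> has
  modulus \<open>1 - r\<close> there.\<close>

lemma multiple_orthogonal:
  assumes f: "f \<in> K" and g: "\<And>z. z \<in> unit_disc \<Longrightarrow> fn f z = (z - \<zeta>) * fn g z"
  shows "cinner f h = 0"
proof -
  have "(\<lambda>n. fn f (rad \<zeta> n)) \<longlonglongrightarrow> 0"
  proof (rule Lim_null_comparison[OF always_eventually])
    show "\<forall>n. norm (fn f (rad \<zeta> n)) \<le> sqrt ((norm g)\<^sup>2 / (real n + 2))"
    proof
      fix n
      define r where "r = 1 - 1 / (real n + 2)"
      have r: "0 \<le> r" "r < 1" by (auto simp: r_def field_simps)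
      have D: "rad \<zeta> n \<in> unit_disc" by (rule rad_in_disc[OF cmod_\<zeta>])
      have cr: "cmod (rad \<zeta> n) = r" "cmod (rad \<zeta> n - \<zeta>) = 1 - r"
        by (simp_all add: r_def cmod_rad cmod_rad_diff cmod_\<zeta>)
      have "(cmod (fn f (rad \<zeta> n)))\<^sup>2 = (1 - r)\<^sup>2 * (cmod (fn g (rad \<zeta> n)))\<^sup>2"
        by (simp add: g[OF D] norm_mult power_mult_distrib cr)
      also have "\<dots> \<le> (1 - r)\<^sup>2 * ((norm g)\<^sup>2 / (1 - r\<^sup>2))"
        using fn_bound[OF D, of g] by (intro mult_left_mono) (auto simp: cr)
      also have "\<dots> = (1 - r) * (norm g)\<^sup>2 / (1 + r)"
      proof -
        have "1 - r\<^sup>2 = (1 - r) * (1 + r)" by (simp add: power2_eq_square algebra_simps)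
        then show ?thesis using r by (simp add: power2_eq_square)
      qed
      also have "\<dots> \<le> (1 - r) * (norm g)\<^sup>2 / 1"
        using r by (intro divide_left_mono) auto
      also have "\<dots> = (norm g)\<^sup>2 / (real n + 2)" by (simp add: r_def)
      finally show "norm (fn f (rad \<zeta> n)) \<le> sqrt ((norm g)\<^sup>2 / (real n + 2))"
        by (intro real_le_rsqrt) simp
    qed
    have "(\<lambda>n. 1 / (real n + 2)) \<longlonglongrightarrow> 0" by real_asymp
    from tendsto_real_sqrt[OF tendsto_mult[OF tendsto_const this, of "(norm g)\<^sup>2"]]
    show "(\<lambda>n. sqrt ((norm g)\<^sup>2 / (real n + 2))) \<longlonglongrightarrow> 0" by simp
  qed
  from LIMSEQ_unique[OF radial[OF f] this] show ?thesis .
qed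

lemma quotient_orthogonal:
  assumes f: "f \<in> K" "cinner f h = 0" and q: "\<And>z. z \<in> unit_disc \<Longrightarrow> fn f z = (z - \<mu>) * fn q z"
    and \<mu>: "\<mu> \<in> unit_disc"
  shows "q \<in> K" "cinner q h = 0"
proof -
  show qK: "q \<in> K" using \<mu> by (intro quotient_in_K[OF f(1) q]) auto
  have "(\<lambda>n. fn f (rad \<zeta> n)) \<longlonglongrightarrow> (\<zeta> - \<mu>) * cinner q h"
    unfolding q[OF rad_in_disc[OF cmod_\<zeta>]] by (intro tendsto_intros tendsto_rad radial qK)
  from LIMSEQ_unique[OF this radial[OF f(1)]] f(2) \<mu> \<zeta>_notin_disc show "cinner q h = 0"
    by auto
qed

text \<open>\<open>Z\<close> is a selection of zeros of \<open>f\<close>. Read dually,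
  \<open>f\<close> spans what is orthogonal in \<open>K\<close> to \<open>h\<close> and to the
  kernels at \<open>Z\<close>, so that \<open>f\<close> together with these is total in
  \<open>K\<close>.\<close>

definition good :: "hardy \<Rightarrow> hardy \<Rightarrow> complex set \<Rightarrow> bool" where
  "good f g Z \<longleftrightarrow> f \<in> K \<and> cinner f h = 0 \<and> g \<noteq> 0 \<and> (\<forall>z\<in>unit_disc. fn f z = (z - \<zeta>) * fn g z) \<and>
     Z \<subseteq> unit_disc \<and> (\<forall>z\<in>Z. fn f z = 0) \<and> \<zeta> islimpt Z \<and>
     (\<forall>u\<in>K. cinner u h = 0 \<longrightarrow> (\<forall>z\<in>Z. fn u z = 0) \<longrightarrow> (\<exists>c. u = c *\<^sub>h f))"

lemma
  assumes "good f g Z"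
  shows good_K: "f \<in> K" and good_orth: "cinner f h = 0" and good_nonzero: "g \<noteq> 0"
    and good_factor: "z \<in> unit_disc \<Longrightarrow> fn f z = (z - \<zeta>) * fn g z"
    and good_sub: "Z \<subseteq> unit_disc" and good_zero: "z \<in> Z \<Longrightarrow> fn f z = 0" and good_islimpt: "\<zeta> islimpt Z"
    and good_unique: "u \<in> K \<Longrightarrow> cinner u h = 0 \<Longrightarrow> (\<And>z. z \<in> Z \<Longrightarrow> fn u z = 0) \<Longrightarrow> \<exists>c. u = c *\<^sub>h f"
  using assms unfolding good_def by blast+

lemma good_f_nonzero:
  assumes "good f g Z"
  shows "f \<noteq> 0"
proof
  assume "f = 0"
  then have "(z - \<zeta>) * fn g z = (z - \<zeta>) * fn 0 z" if "z \<in> unit_disc" for z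
    using good_factor[OF assms that] by simp
  then have "g = 0" by (rule quotient_unique)
  with good_nonzero[OF assms] show False by blast
qed

lemma limit_quotient:
  assumes bounded: "\<And>n. norm (q n) \<le> C" and lim: "\<And>z. z \<in> unit_disc \<Longrightarrow> (\<lambda>n. fn (q n) z) \<longlonglongrightarrow> fn g z / (z - \<zeta>)"
  shows "\<exists>G. norm G \<le> C \<and> (\<forall>z\<in>unit_disc. fn g z = (z - \<zeta>) * fn G z)"
proof -
  have ne: "z - \<zeta> \<noteq> 0" if "z \<in> unit_disc" for z using that \<zeta>_notin_disc by auto
  have "(\<lambda>z. fn g z / (z - \<zeta>)) holomorphic_on unit_disc"
    using ne by (intro holomorphic_intros fn_holomorphic) auto
  from hardy_exists_of_bounded_limit[of _ q, OF this bounded lim] obtain G where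
    "norm G \<le> C" "\<forall>z\<in>unit_disc. fn G z = fn g z / (z - \<zeta>)" by blast
  with ne show ?thesis by (intro exI[of _ G]) auto
qed

text \<open>If the quotients by \<open>z - \<mu>\<close> stayed bounded along zeros
  \<open>\<mu>\<close> tending to \<open>\<zeta>\<close>, their limit would put
  \<open>g / (z - \<zeta>)\<close> into H^2. Then \<open>g\<close> itself would vanish at
  \<open>\<zeta>\<close> and on \<open>Z\<close>, hence be a multiple of
  \<open>f = (z - \<zeta>) g\<close>, which forces \<open>g = 0\<close>.\<close>

lemma quotients_blow_up:
  assumes good: "good f g Z" and Y: "finite Y" and \<delta>: "\<delta> > 0"
  shows "\<exists>\<mu>\<in>Z - Y. dist \<mu> \<zeta> < \<delta> \<and> (\<exists>q. (\<forall>z\<in>unit_disc. fn g z = (z - \<mu>) * fn q z) \<and> C < norm q)"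
proof (rule ccontr)
  assume n: "\<not> ?thesis"
  have "\<zeta> islimpt Z - Y"
    using good_islimpt[OF good] Y by (metis Un_Diff_cancel2 islimpt_Un_finite sup_commute)
  then have "\<exists>x. (\<forall>n. x n \<in> (Z - Y) - {\<zeta>}) \<and> x \<longlonglongrightarrow> \<zeta>"
    unfolding islimpt_sequential by blast
  then obtain x where x: "\<And>n. x n \<in> Z - Y" "x \<longlonglongrightarrow> \<zeta>" by blast
  from x(2) \<delta> have "\<forall>\<^sub>F n in sequentially. dist (x n) \<zeta> < \<delta>" by (rule tendstoD)
  then obtain N where N: "\<And>n. n \<ge> N \<Longrightarrow> dist (x n) \<zeta> < \<delta>"
    by (auto simp: eventually_sequentially)
  define y where "y n = x (n + N)" for n
  have y: "y n \<in> Z - Y" "dist (y n) \<zeta> < \<delta>" for n using x(1) N by (auto simp: y_def)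
  have ylim: "y \<longlonglongrightarrow> \<zeta>" unfolding y_def using x(2) by (rule LIMSEQ_ignore_initial_segment)
  have yD: "y n \<in> unit_disc" for n using y(1) good_sub[OF good] by blast
  have "fn g (y n) = 0" for n
    using good_factor[OF good yD[of n]] good_zero[OF good, of "y n"] y(1) yD[of n] \<zeta>_notin_disc by auto
  then have "\<forall>n. \<exists>q. \<forall>z\<in>unit_disc. fn g z = (z - y n) * fn q z"
    using quotient_exists[OF yD] by blast
  then obtain q where q: "\<forall>n. \<forall>z\<in>unit_disc. fn g z = (z - y n) * fn (q n) z"
    unfolding choice_iff by blast
  have C: "norm (q n) \<le> C" for n
    using n y[of n] q by (meson not_less)
  have lim: "(\<lambda>n. fn (q n) z) \<longlonglongrightarrow> fn g z / (z - \<zeta>)" if z: "z \<in> unit_disc" for z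
  proof -
    have ne: "z \<noteq> \<zeta>" using z \<zeta>_notin_disc by auto
    have "(\<lambda>n. fn g z / (z - y n)) \<longlonglongrightarrow> fn g z / (z - \<zeta>)"
      using ne by (intro tendsto_intros ylim) auto
    moreover have "\<forall>\<^sub>F n in sequentially. fn g z / (z - y n) = fn (q n) z"
    proof (rule eventually_mono[OF tendsto_imp_eventually_ne[OF ylim ne[symmetric]]])
      fix n assume "y n \<noteq> z"
      moreover have "fn g z = (z - y n) * fn (q n) z" using q z by blast
      ultimately show "fn g z / (z - y n) = fn (q n) z" by simp
    qed
    ultimately show ?thesis by (rule Lim_transform_eventually)
  qed
  obtain G where G: "\<And>z. z \<in> unit_disc \<Longrightarrow> fn g z = (z - \<zeta>) * fn G z"
    using limit_quotient[of q, OF C lim] by blast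
  have gK: "g \<in> K"
    using cmod_\<zeta> by (intro quotient_in_K[OF good_K[OF good] good_factor[OF good]]) auto
  have "fn g z = 0" if "z \<in> Z" for z
    using good_factor[OF good, of z] good_zero[OF good that] good_sub[OF good] that \<zeta>_notin_disc by auto
  from good_unique[OF good gK multiple_orthogonal[OF gK G] this] obtain c where c: "g = c *\<^sub>h f" by blast
  have e: "fn g z = c * ((z - \<zeta>) * fn g z)" if "z \<in> unit_disc" for z
    using arg_cong[OF c, of "\<lambda>f. fn f z"] good_factor[OF good that] by simp
  have "g = 0"
  proof (cases "c = 0")
    case False
    \<comment> \<open>The identity \<open>g = c (z - \<zeta>) g\<close> is rearranged into a linear
      factor times \<open>g\<close> being 0.\<close>
    have "(z - (\<zeta> + 1 / c)) * fn g z = (z - (\<zeta> + 1 / c)) * fn 0 z" if "z \<in> unit_disc" for z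
    proof -
      have "(z - (\<zeta> + 1 / c)) * fn g z = (c * ((z - \<zeta>) * fn g z) - fn g z) / c"
        using False by (simp add: field_simps)
      then show ?thesis using e[OF that] by simp
    qed
    then show ?thesis by (rule quotient_unique)
  qed (simp add: c)
  with good_nonzero[OF good] show False by blast
qed

text \<open>For a competitor \<open>u\<close> the move is undone:
  \<open>u (z - \<mu>) / (z - w)\<close> is again in \<open>K\<close>, vanishes at
  \<open>\<zeta>\<close> and on the old \<open>Z\<close>, hence is a multiple of \<open>f\<close>.
  Since \<open>f\<close> does not vanish at \<open>w\<close>, the new zero lies outside
  \<open>Z\<close>.\<close>

lemma good_move_zero:
  assumes good: "good f g Z" and \<mu>: "\<mu> \<in> Z" and w: "w \<in> unit_disc" "fn f w \<noteq> 0"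
    and p: "\<And>z. z \<in> unit_disc \<Longrightarrow> fn f z = (z - \<mu>) * fn p z"
    and q: "\<And>z. z \<in> unit_disc \<Longrightarrow> fn g z = (z - \<mu>) * fn q z"
    and f': "\<And>z. z \<in> unit_disc \<Longrightarrow> fn f' z = (z - w) * fn p z"
    and g': "\<And>z. z \<in> unit_disc \<Longrightarrow> fn g' z = (z - w) * fn q z" and g'0: "g' \<noteq> 0"
    and f'K: "f' \<in> K"
  shows "good f' g' (insert w (Z - {\<mu>}))"
proof -
  have \<mu>D: "\<mu> \<in> unit_disc" using \<mu> good_sub[OF good] by blast
  have fac: "fn f' z = (z - \<zeta>) * fn g' z" if z: "z \<in> unit_disc" for z
  proof -
    have pe: "p = shift q - \<zeta> *\<^sub>h q"
    proof (rule quotient_unique)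
      show "(z - \<mu>) * fn p z = (z - \<mu>) * fn (shift q - \<zeta> *\<^sub>h q) z" if "z \<in> unit_disc" for z
        using p[OF that] q[OF that] good_factor[OF good that] by (simp add: algebra_simps)
    qed
    have "fn p z = (z - \<zeta>) * fn q z" by (simp add: pe algebra_simps)
    then show ?thesis by (simp add: f'[OF z] g'[OF z])
  qed
  have "\<exists>c. u = c *\<^sub>h f'"
    if u: "u \<in> K" "cinner u h = 0" "\<And>z. z \<in> insert w (Z - {\<mu>}) \<Longrightarrow> fn u z = 0" for u
  proof -
    have "fn u w = 0" using u(3) by blast
    from quotient_exists[OF w(1) this] obtain r where
      r: "\<And>z. z \<in> unit_disc \<Longrightarrow> fn u z = (z - w) * fn r z" by blast
    note rK = quotient_orthogonal[OF u(1,2) r w(1)]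
    \<comment> \<open>This is \<open>u (z - \<mu>) / (z - w)\<close>, written as a sum so that
      membership in \<open>K\<close> is visible.\<close>
    define y where "y = u + (w - \<mu>) *\<^sub>h r"
    have y: "fn y z = (z - \<mu>) * fn r z" if "z \<in> unit_disc" for z
      by (simp add: y_def r[OF that] algebra_simps)
    have "fn y z = 0" if z: "z \<in> Z" for z
    proof (cases "z = \<mu>")
      case False
      have zD: "z \<in> unit_disc" using z good_sub[OF good] by blast
      have "z \<noteq> w" using good_zero[OF good z] w(2) by auto
      then have "fn r z = 0" using u(3)[of z] z False r[OF zD] by simp
      then show ?thesis using y[OF zD] by simp
    qed (simp add: y[OF \<mu>D])
    moreover have "y \<in> K" "cinner y h = 0"
      unfolding y_def using rK u csubspace_add[OF csubspace_K] csubspace_scaleC[OF csubspace_K]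
      by (auto simp: cinner_distribs)
    ultimately obtain c where c: "y = c *\<^sub>h f" using good_unique[OF good] by blast
    have "r = c *\<^sub>h p"
    proof (rule quotient_unique)
      show "(z - \<mu>) * fn r z = (z - \<mu>) * fn (c *\<^sub>h p) z" if "z \<in> unit_disc" for z
        using y[OF that] p[OF that] by (auto simp: c mult_ac)
    qed
    then have "u = c *\<^sub>h f'"
      by (intro hardy_eqI) (simp add: r f' mult_ac del: mem_ball mem_ball_0)
    then show ?thesis by blast
  qed
  moreover have "fn f' z = 0" if "z \<in> insert w (Z - {\<mu>})" for z
  proof (cases "z = w")
    case True
    then show ?thesis using f'[OF w(1)] by simp
  next
    case False
    with that have z: "z \<in> Z" "z \<noteq> \<mu>" by auto
    then have zD: "z \<in> unit_disc" using good_sub[OF good] by blast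
    have "fn p z = 0" using p[OF zD] good_zero[OF good z(1)] z(2) by simp
    then show ?thesis using f'[OF zD] by simp
  qed
  moreover have "\<zeta> islimpt insert w (Z - {\<mu>})"
    using good_islimpt[OF good] by (metis insert_Diff_single islimpt_insert)
  ultimately show ?thesis
    unfolding good_def
    using f'K multiple_orthogonal[OF f'K fac] g'0 fac w(1) good_sub[OF good] by blast
qed

text \<open>A displacement above \<open>\<tau>\<close> makes \<open>g\<close> change much, one below
  \<open>2 * \<tau>\<close> makes \<open>f\<close> change little. The annulus meets the disc in a
  nonempty open set, on which \<open>f\<close> cannot vanish identically.\<close>

lemma exists_near_annulus:
  assumes "f \<noteq> 0" "\<mu> \<in> unit_disc" "1/2 < cmod \<mu>" "0 < \<tau>" "\<tau> \<le> 1/4"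
  shows "\<exists>w\<in>unit_disc. \<tau> < cmod (\<mu> - w) \<and> cmod (\<mu> - w) < 2 * \<tau> \<and> fn f w \<noteq> 0"
proof -
  define A where "A = {w \<in> unit_disc. \<tau> < cmod (\<mu> - w) \<and> cmod (\<mu> - w) < 2 * \<tau>}"
  have "A = unit_disc \<inter> {w. \<tau> < cmod (\<mu> - w)} \<inter> {w. cmod (\<mu> - w) < 2 * \<tau>}"
    by (auto simp: A_def)
  then have "open A"
    by (auto intro!: open_Int open_Collect_less continuous_intros)
  moreover have "A \<noteq> {}"
  proof -
    \<comment> \<open>A radial move inwards by \<open>3 / 2 * \<tau>\<close>, the middle of the
      annulus; \<open>\<tau> \<le> 1/4\<close> and \<open>1/2 < cmod \<mu>\<close> keep
      \<open>s\<close> below 1.\<close>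
    define s where "s = 3 / 2 * \<tau> / cmod \<mu>"
    define w where "w = of_real (1 - s) * \<mu>"
    have m: "0 < cmod \<mu>" using assms(3) by linarith
    then have s: "s * cmod \<mu> = 3 / 2 * \<tau>" "0 < s" "s \<le> 1"
      unfolding s_def using assms by (simp_all add: divide_le_eq_1_pos)
    have "\<mu> - w = of_real s * \<mu>" by (simp add: w_def algebra_simps)
    then have "cmod (\<mu> - w) = 3 / 2 * \<tau>" using s by (simp add: norm_mult)
    moreover have "cmod w < 1"
    proof -
      have "cmod w = (1 - s) * cmod \<mu>" using s unfolding w_def norm_mult norm_of_real by simp
      also have "\<dots> \<le> 1 * cmod \<mu>" using s by (intro mult_right_mono) auto
      finally show ?thesis using assms(2) by simp
    qed
    ultimately have "w \<in> A" using assms(4) by (simp add: A_def)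
    then show ?thesis by blast
  qed
  moreover have "A \<subseteq> unit_disc" by (auto simp: A_def)
  ultimately obtain w where "w \<in> A" "fn f w \<noteq> 0"
    using nonzero_point_exists[of A f] assms(1) by blast
  then show ?thesis unfolding A_def by blast
qed

text \<open>
  Moving the zero \<open>\<mu>\<close> by about \<open>N / norm q\<close> changes \<open>g\<close> by more than \<open>N\<close> in norm, but \<open>f\<close> only by about
  \<open>N * norm p / norm q\<close>, which is small since \<open>p = g + (\<mu> - \<zeta>) q\<close>.
\<close>

lemma good_step:
  assumes good: "good f g Z" and Y: "finite Y" "Y \<subseteq> Z" and e: "e > 0" and M: "M \<ge> 0"
  shows "\<exists>f' g' Z'. good f' g' Z' \<and> Y \<subseteq> Z' \<and> norm (f' - f) < e \<and> M < norm g'"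
proof -
  \<comment> \<open>Room for \<open>norm g' \<ge> N - norm g\<close> to exceed
    \<open>M\<close>.\<close>
  define N where "N = M + norm g + 1"
  have N: "N \<ge> 1" using M by (simp add: N_def)
  \<comment> \<open>The first bound gives \<open>\<tau> \<le> 1/4\<close>; the second, with
    \<open>e / (4 * N)\<close> in \<open>\<delta>\<close>, splits the change of \<open>f\<close>
    into two parts below \<open>e / 2\<close>. The \<open>1/2\<close> in \<open>\<delta>\<close>
    ensures \<open>1/2 < cmod \<mu>\<close>.\<close>
  define C where "C = max (4 * N) (4 * N * norm g / e)"
  define \<delta> where "\<delta> = min (1/2) (e / (4 * N))"
  have \<delta>: "\<delta> > 0" using e N by (simp add: \<delta>_def)
  obtain \<mu> q where \<mu>: "\<mu> \<in> Z - Y" "dist \<mu> \<zeta> < \<delta>"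
    and q: "\<And>z. z \<in> unit_disc \<Longrightarrow> fn g z = (z - \<mu>) * fn q z" and C: "C < norm q"
    using quotients_blow_up[OF good Y(1) \<delta>, of C] by blast
  have \<mu>D: "\<mu> \<in> unit_disc" using \<mu>(1) good_sub[OF good] by blast
  have X: "4 * N < norm q" "4 * N * norm g / e < norm q" using C by (auto simp: C_def)
  have qpos: "norm q > 0" using X(1) N by linarith
  define \<tau> where "\<tau> = N / norm q"
  have \<tau>: "0 < \<tau>" "\<tau> \<le> 1/4" using X(1) N qpos by (auto simp: \<tau>_def field_simps)
  have "1/2 < cmod \<mu>"
    using norm_triangle_ineq2[of \<zeta> \<mu>] \<mu>(2) cmod_\<zeta> by (simp add: \<delta>_def dist_norm norm_minus_commute)
  from exists_near_annulus[OF good_f_nonzero[OF good] \<mu>D this \<tau>] obtain w where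
    w: "w \<in> unit_disc" "\<tau> < cmod (\<mu> - w)" "cmod (\<mu> - w) < 2 * \<tau>" "fn f w \<noteq> 0" by blast
  define p where "p = g + (\<mu> - \<zeta>) *\<^sub>h q"
  have p: "fn f z = (z - \<mu>) * fn p z" if "z \<in> unit_disc" for z
    using good_factor[OF good that] q[OF that] by (simp add: p_def algebra_simps)
  define f' where "f' = f + (\<mu> - w) *\<^sub>h p"
  define g' where "g' = g + (\<mu> - w) *\<^sub>h q"
  have "p \<in> K"
    using \<mu>D by (intro quotient_in_K[OF good_K[OF good] p]) auto
  then have f'K: "f' \<in> K"
    unfolding f'_def using good_K[OF good]
    by (intro csubspace_add[OF csubspace_K] csubspace_scaleC[OF csubspace_K])
  have "norm g' \<ge> cmod (\<mu> - w) * norm q - norm g"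
    using norm_triangle_ineq2[of "(\<mu> - w) *\<^sub>h q" "- g"] by (simp add: g'_def add.commute)
  moreover have "cmod (\<mu> - w) * norm q > \<tau> * norm q"
    using w(2) qpos by (intro mult_strict_right_mono)
  moreover have "\<tau> * norm q = N" using qpos by (simp add: \<tau>_def)
  ultimately have big: "M < norm g'" by (simp add: N_def)
  have small: "norm (f' - f) < e"
  proof -
    have "norm p \<le> norm g + cmod (\<mu> - \<zeta>) * norm q"
      using norm_triangle_ineq[of g "(\<mu> - \<zeta>) *\<^sub>h q"] by (simp add: p_def)
    then have "cmod (\<mu> - w) * norm p \<le> (2 * \<tau>) * (norm g + cmod (\<mu> - \<zeta>) * norm q)"
      using w(3) \<tau>(1) by (intro mult_mono) auto
    also have "\<dots> = 2 * N * norm g / norm q + 2 * N * cmod (\<mu> - \<zeta>)"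
      using qpos by (simp add: \<tau>_def field_simps)
    also have "\<dots> < e / 2 + e / 2"
    proof (rule add_strict_mono)
      show "2 * N * norm g / norm q < e / 2"
        using X(2) qpos e by (simp add: field_simps)
      have "cmod (\<mu> - \<zeta>) < e / (4 * N)" using \<mu>(2) by (simp add: \<delta>_def dist_norm)
      then show "2 * N * cmod (\<mu> - \<zeta>) < e / 2" using N by (simp add: field_simps)
    qed
    finally show ?thesis by (simp add: f'_def)
  qed
  have "g' \<noteq> 0" using big M by auto
  have "good f' g' (insert w (Z - {\<mu>}))"
  proof (rule good_move_zero[OF good _ w(1,4) p q _ _ \<open>g' \<noteq> 0\<close> f'K])
    show "\<mu> \<in> Z" using \<mu>(1) by blast
    show "fn f' z = (z - w) * fn p z" "fn g' z = (z - w) * fn q z" if "z \<in> unit_disc" for z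
      using p[OF that] q[OF that] by (simp_all add: f'_def g'_def algebra_simps)
  qed
  with big small \<mu>(1) Y(2) show ?thesis by blast
qed

text \<open>Here \<open>g = (\<Theta> - c) / ((z - a) (z - b))\<close>. The functions of
  \<open>K\<close> that vanish on the fibre without \<open>a\<close> and \<open>b\<close> are the
  combinations of \<open>g\<close> and \<open>f = (z - \<zeta>) g\<close>. As
  \<open>\<Theta>\<close> has the unimodular limit \<open>w \<noteq> c\<close>, the value of
  \<open>g\<close> at \<open>\<zeta>\<close> is not 0; so the condition at \<open>\<zeta>\<close>
  leaves the multiples of \<open>f\<close>, and \<open>h \<noteq> 0\<close>.\<close>

lemma good_exists:
  assumes c: "frostman_value c" and w: "cmod w = 1" "(\<lambda>n. \<Theta> (rad \<zeta> n)) \<longlonglongrightarrow> w"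
  shows "\<exists>f g Z. good f g Z \<and> h \<noteq> 0"
proof -
  define S where "S = {z\<in>unit_disc. \<Theta> z = c}"
  have lim: "\<zeta> islimpt S"
    unfolding S_def by (rule frostman_fibre_islimpt[OF c spectrum])
  then have inf: "infinite S" using islimpt_finite by blast
  obtain a where a: "a \<in> S" using inf by (metis finite.emptyI all_not_in_conv)
  have "infinite (S - {a})" using inf by simp
  then obtain b where b: "b \<in> S" "b \<noteq> a" by (metis DiffE finite.emptyI all_not_in_conv singletonI)
  have D: "a \<in> unit_disc" "b \<in> unit_disc" and \<Theta>: "\<Theta> a = c" "\<Theta> b = c"
    using a b by (auto simp: S_def)
  define B where "B = T (monom_h 0) - c *\<^sub>h monom_h 0"
  have B: "fn B z = \<Theta> z - c" if "z \<in> unit_disc" for z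
    using fn_monom_h[OF that, of 0] by (simp add: B_def)
  \<comment> \<open>\<open>\<Theta> - c\<close> need not lie in \<open>K\<close>, but it is
    orthogonal to \<open>z \<Theta>\<close> H^2, which puts its quotients into
    \<open>K\<close>.\<close>
  have "cinner B (T (shift p)) = 0" for p
  proof -
    have "cinner (monom_h 0) (shift x) = 0" for x
      using cinner_monom_h[of "shift x" 0] cinner_commute[of "monom_h 0" "shift x"]
      by (simp add: cf_shift)
    then show ?thesis by (simp add: B_def cinner_distribs) (simp add: T_shift)
  qed
  note quotient_B = quotient_in_K'[OF this]
  have "fn B a = 0" using B D \<Theta> by simp
  from quotient_exists[OF D(1) this] obtain b0 where
    b0: "\<And>z. z \<in> unit_disc \<Longrightarrow> fn B z = (z - a) * fn b0 z" by blast
  have b0K: "b0 \<in> K" using D by (intro quotient_B[OF b0]) auto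
  have "fn b0 b = 0" using b0[OF D(2)] B[OF D(2)] \<Theta> b(2) by simp
  from quotient_exists[OF D(2) this] obtain g where
    g: "\<And>z. z \<in> unit_disc \<Longrightarrow> fn b0 z = (z - b) * fn g z" by blast
  have gK: "g \<in> K" using D by (intro quotient_in_K[OF b0K g]) auto
  have fac: "\<Theta> z - c = (z - a) * ((z - b) * fn g z)" if "z \<in> unit_disc" for z
    using b0[OF that] g[OF that] B[OF that] by simp
  define f where "f = b0 + (b - \<zeta>) *\<^sub>h g"
  have f: "fn f z = (z - \<zeta>) * fn g z" if "z \<in> unit_disc" for z
    using g[OF that] by (simp add: f_def algebra_simps)
  have fK: "f \<in> K"
    unfolding f_def using b0K gK
    by (intro csubspace_add[OF csubspace_K] csubspace_scaleC[OF csubspace_K])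
  note f_orth = multiple_orthogonal[OF fK f]
  have simple: "q x \<noteq> 0" if q: "q holomorphic_on unit_disc" and x: "x \<in> unit_disc" "\<Theta> x = c"
    and e: "\<And>z. z \<in> unit_disc \<Longrightarrow> \<Theta> z - c = (z - x) * q z" for q x
  proof
    assume q0: "q x = 0"
    have "deriv \<Theta> x = 0"
      by (rule double_zero_deriv[of "\<lambda>z. z - x" q, OF _ q x(1) e _ q0]) (auto intro!: holomorphic_intros)
    then show False using c x by (auto simp: frostman_value_def)
  qed
  have "(a - b) * fn g a \<noteq> 0"
    by (rule simple[of "\<lambda>z. (z - b) * fn g z"]) (use D \<Theta> fac in \<open>auto intro!: holomorphic_intros fn_holomorphic\<close>)
  then have ga: "fn g a \<noteq> 0" by simp
  have "(b - a) * fn g b \<noteq> 0"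
    by (rule simple[of "\<lambda>z. (z - a) * fn g z"]) (use D \<Theta> fac in \<open>auto intro!: holomorphic_intros fn_holomorphic\<close>)
  then have gb: "fn g b \<noteq> 0" by simp
  have g_h: "cinner g h \<noteq> 0"
  proof -
    have "(\<lambda>n. (rad \<zeta> n - a) * ((rad \<zeta> n - b) * fn g (rad \<zeta> n))) \<longlonglongrightarrow> (\<zeta> - a) * ((\<zeta> - b) * cinner g h)"
      by (intro tendsto_intros tendsto_rad radial gK)
    moreover have "(\<lambda>n. \<Theta> (rad \<zeta> n) - c) \<longlonglongrightarrow> w - c"
      by (intro tendsto_intros w)
    ultimately have "(\<zeta> - a) * ((\<zeta> - b) * cinner g h) = w - c"
      unfolding fac[OF rad_in_disc[OF cmod_\<zeta>]] by (rule LIMSEQ_unique)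
    moreover have "w \<noteq> c" using w(1) c by (auto simp: frostman_value_def)
    ultimately show ?thesis by auto
  qed
  define Z where "Z = S - {a, b}"
  have "\<exists>d. u = d *\<^sub>h f" if u: "u \<in> K" "cinner u h = 0" "\<And>z. z \<in> Z \<Longrightarrow> fn u z = 0" for u
  proof -
    \<comment> \<open>\<open>\<beta> (z - \<zeta>) + \<gamma>\<close> interpolates
      \<open>u / g\<close> at \<open>a\<close> and \<open>b\<close>, so \<open>y\<close> vanishes on
      the whole fibre.\<close>
    define \<beta> where "\<beta> = (fn u a / fn g a - fn u b / fn g b) / (a - b)"
    define \<gamma> where "\<gamma> = fn u a / fn g a - \<beta> * (a - \<zeta>)"
    have "\<beta> * (a - b) = fn u a / fn g a - fn u b / fn g b"
      using b(2) by (simp add: \<beta>_def)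
    then have \<gamma>b: "\<gamma> = fn u b / fn g b - \<beta> * (b - \<zeta>)"
      by (simp add: \<gamma>_def algebra_simps)
    define y where "y = u - (\<beta> *\<^sub>h f + \<gamma> *\<^sub>h g)"
    have "y = 0"
    proof (rule frostman_fibre_unique[OF c])
      show "y \<in> K"
        unfolding y_def using u(1) fK gK
        by (intro csubspace_diff[OF csubspace_K] csubspace_add[OF csubspace_K] csubspace_scaleC[OF csubspace_K])
      fix z assume z: "z \<in> unit_disc" "\<Theta> z = c"
      have yz: "fn y z = fn u z - (\<beta> * (z - \<zeta>) + \<gamma>) * fn g z"
        by (simp add: y_def f[OF z(1)] algebra_simps)
      consider "z = a" | "z = b" | "z \<in> Z" using z by (auto simp: Z_def S_def)
      then show "fn y z = 0"
      proof cases
        case 1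
        then show ?thesis unfolding yz using ga by (simp add: \<gamma>_def)
      next
        case 2
        then show ?thesis unfolding yz using gb by (simp add: \<gamma>b)
      next
        case 3
        then have "z \<noteq> a" "z \<noteq> b" by (auto simp: Z_def)
        then have "fn g z = 0" using fac[OF z(1)] z(2) by simp
        then show ?thesis unfolding yz using u(3)[OF 3] by simp
      qed
    qed
    then have ue: "u = \<beta> *\<^sub>h f + \<gamma> *\<^sub>h g" by (simp add: y_def)
    have "\<gamma> * cinner g h = 0"
      using u(2) f_orth unfolding ue by (simp add: cinner_distribs)
    then have "\<gamma> = 0" using g_h by simp
    then show ?thesis using ue by auto
  qed
  moreover have "fn f z = 0" if "z \<in> Z" for z
  proof -
    have z: "z \<in> unit_disc" "\<Theta> z = c" "z \<noteq> a" "z \<noteq> b" using that by (auto simp: Z_def S_def)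
    then show ?thesis using fac[OF z(1)] f[OF z(1)] by simp
  qed
  moreover have "\<zeta> islimpt Z"
    unfolding Z_def using lim by (metis Un_Diff_cancel2 finite.emptyI finite_insert islimpt_Un_finite sup_commute)
  moreover have "Z \<subseteq> unit_disc" by (auto simp: Z_def S_def)
  ultimately have "good f g Z"
    unfolding good_def using fK f_orth f ga by auto
  then show ?thesis using g_h by auto
qed

section \<open>The limit function\<close>

text \<open>The points accumulate at 0, so no nonzero function vanishes at all of them; the kernels
  there are the test vectors for density in \<open>K\<close>.\<close>

definition target :: "nat \<Rightarrow> complex" where
  "target i = of_real (1 / (real i + 2))"

lemma target_in_disc: "target i \<in> unit_disc"
  unfolding target_def mem_ball_0 norm_of_real by simp

lemma target_unique:
  assumes "\<And>i. fn u (target i) = 0"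
  shows "u = 0"
proof (rule hardy_eq_0_of_islimpt)
  show "range target \<subseteq> unit_disc" using target_in_disc by blast
  show "0 \<in> unit_disc" by simp
  have "(\<lambda>i. 1 / (real i + 2)) \<longlonglongrightarrow> 0" by real_asymp
  then have "(\<lambda>i. complex_of_real (1 / (real i + 2))) \<longlonglongrightarrow> of_real 0"
    by (rule tendsto_of_real)
  then have "target \<longlonglongrightarrow> 0"
    by (simp only: target_def[abs_def] of_real_0)
  moreover have "target i \<noteq> 0" for i
    unfolding target_def of_real_eq_0_iff by simp
  then have "target i \<in> range target - {0}" for i
    by blast
  ultimately show "0 islimpt range target"
    unfolding islimpt_sequential by blast
qed (use assms in auto)

text \<open>
  An open condition on \<open>F\<close>, hence inherited by the limit of the construction. If it holds for all \<open>n\<close>,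
  then the first part makes the span of \<open>h\<close>, \<open>F\<close> and the kernels at the points of all \<open>Y\<close> dense in
  \<open>K\<close>, and the second part says that \<open>F / (z - \<zeta>)\<close> is not in \<open>H\<^sup>2\<close>.
\<close>

definition lock :: "nat \<Rightarrow> complex set \<Rightarrow> hardy \<Rightarrow> bool" where
  "lock n Y F \<longleftrightarrow>
     (\<forall>i\<le>n. \<exists>e\<in>combos Y ker. \<exists>c d. norm (ker (target i) - e - c *\<^sub>h h - d *\<^sub>h F) < 1 / (real n + 1)) \<and>
     \<not> (\<exists>g. norm g \<le> real n \<and> (\<forall>z\<in>unit_disc. fn F z = (z - \<zeta>) * fn g z))"

text \<open>For fixed coefficients the approximation is an open condition on \<open>F\<close>.
  Divisibility with a quotient of norm at most \<open>n\<close> is closed, because bounded quotients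
  have a limit by \<open>limit_quotient\<close>.\<close>

lemma open_lock: "open {F. lock n Y F}"
proof -
  have 1: "open {F. \<exists>e\<in>combos Y ker. \<exists>c d. norm (ker (target i) - e - c *\<^sub>h h - d *\<^sub>h F) < 1 / (real n + 1)}" for i
  proof -
    have "open {F. norm (ker (target i) - e - c *\<^sub>h h - d *\<^sub>h F) < 1 / (real n + 1)}" for e c d
      by (intro open_Collect_less continuous_intros linear_continuous_on[OF bounded_linear_scaleC])
    then have "open (\<Union>e\<in>combos Y ker. \<Union>c. \<Union>d. {F. norm (ker (target i) - e - c *\<^sub>h h - d *\<^sub>h F) < 1 / (real n + 1)})"
      by (intro open_UN ballI)
    moreover have "(\<Union>e\<in>combos Y ker. \<Union>c. \<Union>d. {F. norm (ker (target i) - e - c *\<^sub>h h - d *\<^sub>h F) < 1 / (real n + 1)})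
      = {F. \<exists>e\<in>combos Y ker. \<exists>c d. norm (ker (target i) - e - c *\<^sub>h h - d *\<^sub>h F) < 1 / (real n + 1)}"
      by blast
    ultimately show ?thesis by simp
  qed
  let ?C = "{F. \<exists>g. norm g \<le> real n \<and> (\<forall>z\<in>unit_disc. fn F z = (z - \<zeta>) * fn g z)}"
  have ne: "z - \<zeta> \<noteq> 0" if "z \<in> unit_disc" for z using that \<zeta>_notin_disc by auto
  have 2: "closed ?C"
    unfolding closed_sequential_limits
  proof (intro allI impI, elim conjE)
    fix X F assume X: "\<forall>k. X k \<in> ?C" "X \<longlonglongrightarrow> F"
    then have "\<forall>k. \<exists>g. norm g \<le> real n \<and> (\<forall>z\<in>unit_disc. fn (X k) z = (z - \<zeta>) * fn g z)" by blast
    then obtain g where g: "\<forall>k. norm (g k) \<le> real n \<and> (\<forall>z\<in>unit_disc. fn (X k) z = (z - \<zeta>) * fn (g k) z)"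
      unfolding choice_iff by blast
    have "\<exists>G. norm G \<le> real n \<and> (\<forall>z\<in>unit_disc. fn F z = (z - \<zeta>) * fn G z)"
    proof (rule limit_quotient[of g])
      show "norm (g k) \<le> real n" for k using g by blast
      fix z assume z: "z \<in> unit_disc"
      have "fn (g k) z = fn (X k) z / (z - \<zeta>)" for k
      proof -
        have "fn (X k) z = (z - \<zeta>) * fn (g k) z" using g z by blast
        then show ?thesis using ne[OF z] by simp
      qed
      moreover have "(\<lambda>k. fn (X k) z / (z - \<zeta>)) \<longlonglongrightarrow> fn F z / (z - \<zeta>)"
        by (intro tendsto_divide tendsto_const tendsto_fn[OF X(2)] ne[OF z])
      ultimately show "(\<lambda>k. fn (g k) z) \<longlonglongrightarrow> fn F z / (z - \<zeta>)" by simp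
    qed
    then show "F \<in> ?C" by blast
  qed
  have "{F. lock n Y F} = (\<Inter>i\<in>{..n}. {F. \<exists>e\<in>combos Y ker. \<exists>c d.
      norm (ker (target i) - e - c *\<^sub>h h - d *\<^sub>h F) < 1 / (real n + 1)}) \<inter> - ?C"
    unfolding lock_def by blast
  moreover have "open \<dots>"
    using 1 2 by (intro open_Int open_INT open_Compl) auto
  ultimately show ?thesis by simp
qed

text \<open>By duality, \<open>good_unique\<close> makes the span of \<open>h\<close>,
  \<open>f\<close> and the kernels at \<open>Z\<close> dense in \<open>K\<close>, and finitely many
  zeros suffice for finitely many targets. The second part of \<open>lock\<close> holds since
  \<open>g\<close> is the only quotient and has norm above \<open>n\<close>.\<close>

lemma lock_exists:
  assumes good: "good f g Z" and n: "real n < norm g" and Y: "finite Y" "Y \<subseteq> Z"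
  shows "\<exists>Y'. finite Y' \<and> Y \<subseteq> Y' \<and> Y' \<subseteq> Z \<and> n \<le> card Y' \<and> lock n Y' f"
proof -
  define S where "S = {e + c *\<^sub>h h + d *\<^sub>h f | e c d. e \<in> combos Z ker}"
  have ZD: "Z \<subseteq> unit_disc" by (rule good_sub[OF good])
  have S: "csubspace S"
    unfolding csubspace_def
  proof (intro conjI ballI allI)
    have "0 = 0 + 0 *\<^sub>h h + 0 *\<^sub>h f" by simp
    then show "0 \<in> S" unfolding S_def using csubspace_0[OF csubspace_combos] by blast
  next
    fix x y assume "x \<in> S" "y \<in> S"
    then obtain e c d e' c' d' where *: "x = e + c *\<^sub>h h + d *\<^sub>h f" "y = e' + c' *\<^sub>h h + d' *\<^sub>h f"
      "e \<in> combos Z ker" "e' \<in> combos Z ker" unfolding S_def by blast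
    have "x + y = (e + e') + (c + c') *\<^sub>h h + (d + d') *\<^sub>h f"
      by (simp add: * scaleC_distribs)
    then show "x + y \<in> S" unfolding S_def using csubspace_add[OF csubspace_combos *(3,4)] by blast
  next
    fix a x assume "x \<in> S"
    then obtain e c d where *: "x = e + c *\<^sub>h h + d *\<^sub>h f" "e \<in> combos Z ker" unfolding S_def by blast
    have "a *\<^sub>h x = a *\<^sub>h e + (a * c) *\<^sub>h h + (a * d) *\<^sub>h f"
      by (simp add: * scaleC_distribs)
    then show "a *\<^sub>h x \<in> S" unfolding S_def using csubspace_scaleC[OF csubspace_combos *(2)] by blast
  qed
  have mem: "e + c *\<^sub>h h + d *\<^sub>h f \<in> S" if "e \<in> combos Z ker" for e c d
    using that unfolding S_def by blast
  have hS: "h \<in> S" and fS: "f \<in> S" and kS: "\<And>z. z \<in> Z \<Longrightarrow> ker z \<in> S"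
    using mem[OF csubspace_0[OF csubspace_combos], of 1 0] mem[OF csubspace_0[OF csubspace_combos], of 0 1]
      mem[OF combos_base, of _ 0 0] by simp_all
  have SK: "S \<subseteq> K"
  proof -
    have "combos Z ker \<subseteq> K"
      using ZD ker_in_K by (intro combos_subset csubspace_K) blast
    then show ?thesis
      unfolding S_def using h_K good_K[OF good]
      by (auto intro!: csubspace_add[OF csubspace_K] csubspace_scaleC[OF csubspace_K])
  qed
  have "closure (combos S (\<lambda>x. x)) = K"
  proof (rule closure_combos_eq[OF closed_K csubspace_K])
    fix u assume u: "u \<in> K" "\<And>s. s \<in> S \<Longrightarrow> cinner u s = 0"
    have "fn u z = 0" if "z \<in> Z" for z
    proof -
      have "cinner u (ker z) = 0" using u(2) kS that by blast
      then show ?thesis using cinner_ker[of z u] u(1) that ZD by auto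
    qed
    from good_unique[OF good u(1) u(2)[OF hS] this] obtain c where c: "u = c *\<^sub>h f" by blast
    have "cinner u u = 0" using u(2)[OF fS] c by simp
    then show "u = 0" by (simp add: cinner_self)
  qed (use SK in blast)
  moreover have "combos S (\<lambda>x. x) \<subseteq> S" by (rule combos_subset[OF S])
  ultimately have dense: "K \<subseteq> closure S" using closure_mono by blast
  have "\<exists>J. finite J \<and> J \<subseteq> Z \<and> (\<exists>e\<in>combos J ker. \<exists>c d.
      norm (ker (target i) - e - c *\<^sub>h h - d *\<^sub>h f) < 1 / (real n + 1))" for i
  proof -
    have "ker (target i) \<in> closure S" using ker_in_K[OF target_in_disc] dense by blast
    moreover have "(0::real) < 1 / (real n + 1)" by simp
    ultimately obtain s where s: "s \<in> S" "dist s (ker (target i)) < 1 / (real n + 1)"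
      unfolding closure_approachable by blast
    then obtain e c d where e: "s = e + c *\<^sub>h h + d *\<^sub>h f" "e \<in> combos Z ker" unfolding S_def by blast
    from e(2) obtain J a where J: "finite J" "J \<subseteq> Z" "e = (\<Sum>i\<in>J. a i *\<^sub>h ker i)"
      unfolding combos_def by blast
    have "e \<in> combos J ker" unfolding J(3) by (rule combosI[OF J(1) subset_refl])
    moreover have "norm (ker (target i) - e - c *\<^sub>h h - d *\<^sub>h f) < 1 / (real n + 1)"
      using s(2) by (simp add: e(1) dist_norm norm_minus_commute diff_diff_eq algebra_simps)
    ultimately show ?thesis using J by blast
  qed
  then have "\<forall>i. \<exists>J. finite J \<and> J \<subseteq> Z \<and> (\<exists>e\<in>combos J ker. \<exists>c d.
      norm (ker (target i) - e - c *\<^sub>h h - d *\<^sub>h f) < 1 / (real n + 1))" by blast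
  then obtain J where J: "\<forall>i. finite (J i) \<and> J i \<subseteq> Z \<and> (\<exists>e\<in>combos (J i) ker. \<exists>c d.
      norm (ker (target i) - e - c *\<^sub>h h - d *\<^sub>h f) < 1 / (real n + 1))"
    unfolding choice_iff by blast
  have "infinite Z" using good_islimpt[OF good] islimpt_finite by blast
  then obtain B where B: "finite B" "card B = n" "B \<subseteq> Z" using infinite_arbitrarily_large by blast
  \<comment> \<open>\<open>B\<close> is added for its cardinality, which makes the union of all
    stages infinite.\<close>
  define Y' where "Y' = Y \<union> B \<union> (\<Union>i\<le>n. J i)"
  have fin: "finite Y'" unfolding Y'_def using Y(1) B(1) J by blast
  have "Y' \<subseteq> Z" unfolding Y'_def using Y(2) B(3) J by blast
  moreover have "n \<le> card Y'"
    using card_mono[OF fin, of B] B(2) by (auto simp: Y'_def)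
  moreover have "lock n Y' f"
    unfolding lock_def
  proof (intro conjI allI impI)
    fix i assume "i \<le> n"
    then have "J i \<subseteq> Y'" unfolding Y'_def by blast
    from combos_mono[OF this] J show "\<exists>e\<in>combos Y' ker. \<exists>c d.
        norm (ker (target i) - e - c *\<^sub>h h - d *\<^sub>h f) < 1 / (real n + 1)" by blast
  next
    show "\<not> (\<exists>g. norm g \<le> real n \<and> (\<forall>z\<in>unit_disc. fn f z = (z - \<zeta>) * fn g z))"
    proof
      assume "\<exists>g. norm g \<le> real n \<and> (\<forall>z\<in>unit_disc. fn f z = (z - \<zeta>) * fn g z)"
      then obtain g' where g': "norm g' \<le> real n" "\<And>z. z \<in> unit_disc \<Longrightarrow> fn f z = (z - \<zeta>) * fn g' z"
        by blast
      have "g' = g"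
        by (rule quotient_unique[of \<zeta>]) (simp only: g'(2)[symmetric] good_factor[OF good, symmetric])
      then show False using g'(1) n by simp
    qed
  qed
  moreover have "Y \<subseteq> Y'" by (auto simp: Y'_def)
  ultimately show ?thesis using fin by blast
qed

text \<open>The zeros in \<open>Y\<close> are fixed for good, and all later functions have to stay
  in the ball of radius \<open>e\<close> around \<open>f\<close>, on which \<open>lock n Y\<close>
  is guaranteed.\<close>

definition stage :: "nat \<Rightarrow> hardy \<times> complex set \<times> real \<Rightarrow> bool" where
  "stage n = (\<lambda>(f, Y, e). (\<exists>g Z. good f g Z \<and> Y \<subseteq> Z) \<and> finite Y \<and> n \<le> card Y \<and>
     0 < e \<and> e \<le> 1 / (real n + 1) \<and> (\<forall>F. norm (F - f) \<le> e \<longrightarrow> lock n Y F))"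

lemma stage_exists:
  assumes good: "good f g Z" and Y: "finite Y" "Y \<subseteq> Z" and e: "e > 0"
  shows "\<exists>f' Y' e'. stage n (f', Y', e') \<and> Y \<subseteq> Y' \<and> norm (f' - f) + e' \<le> e"
proof -
  have "e / 2 > 0" using e by simp
  from good_step[OF good Y this, of "real n"] obtain f' g' Z' where
    1: "good f' g' Z'" "Y \<subseteq> Z'" "norm (f' - f) < e / 2" "real n < norm g'" by auto
  from lock_exists[OF 1(1,4) Y(1) 1(2)] obtain Y' where
    2: "finite Y'" "Y \<subseteq> Y'" "Y' \<subseteq> Z'" "n \<le> card Y'" "lock n Y' f'" by blast
  have "f' \<in> {F. lock n Y' F}" using 2(5) by simp
  with open_lock obtain d where d: "d > 0" "cball f' d \<subseteq> {F. lock n Y' F}"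
    by (meson open_contains_cball)
  \<comment> \<open>One half of \<open>e\<close> pays for the move, the other keeps the new ball
    inside the old one; \<open>1 / (real n + 1)\<close> forces the radii to 0.\<close>
  define e' where "e' = min (min (e / 2) d) (1 / (real n + 1))"
  have e': "0 < e'" "e' \<le> e / 2" "e' \<le> d" "e' \<le> 1 / (real n + 1)"
    using e d(1) by (auto simp: e'_def)
  have "lock n Y' F" if "norm (F - f') \<le> e'" for F
  proof -
    have "F \<in> cball f' d" using that e'(3) by (simp add: dist_norm norm_minus_commute)
    then show ?thesis using d(2) by blast
  qed
  then have "stage n (f', Y', e')"
    unfolding stage_def using 1(1) 2 e' by auto
  then show ?thesis using 1(3) 2(2) e'(2) by (intro exI[of _ f'] exI[of _ Y'] exI[of _ e']) auto
qed

lemma limit_function: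
  assumes "\<exists>f g Z. good f g Z"
  shows "\<exists>f \<Lambda>. f \<in> K \<and> cinner f h = 0 \<and> \<Lambda> \<subseteq> unit_disc \<and> countable \<Lambda> \<and> infinite \<Lambda> \<and>
    (\<forall>z\<in>\<Lambda>. fn f z = 0) \<and> (\<forall>n. \<exists>Y\<subseteq>\<Lambda>. lock n Y f)"
proof -
  \<comment> \<open>The closed balls of successive stages are nested, so the limit lies in each of
    them and satisfies every \<open>lock\<close>.\<close>
  let ?Q = "\<lambda>(n::nat) (f, Y, e) (f', Y', e'). Y \<subseteq> Y' \<and> norm (f' - f) + e' \<le> (e::real)"
  have "\<exists>s. \<forall>n. stage n (s n) \<and> ?Q n (s n) (s (Suc n))"
  proof (rule dependent_nat_choice)
    obtain f g Z where "good f g Z" using assms by blast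
    from stage_exists[OF this _ _ zero_less_one, of "{}"] show "\<exists>x. stage 0 x" by blast
  next
    fix x n assume "stage n x"
    then obtain f Y e g Z where x: "x = (f, Y, e)" "good f g Z" "Y \<subseteq> Z" "finite Y" "e > 0"
      by (auto simp: stage_def)
    from stage_exists[OF x(2,4,3,5), of "Suc n"] show "\<exists>y. stage (Suc n) y \<and> ?Q n x y"
      unfolding x(1) by auto
  qed
  then obtain s where s: "\<forall>n. stage n (s n) \<and> ?Q n (s n) (s (Suc n))" by (rule exE)
  define F where "F n = fst (s n)" for n
  define Y where "Y n = fst (snd (s n))" for n
  define e where "e n = snd (snd (s n))" for n
  have s_eq: "s n = (F n, Y n, e n)" for n by (simp add: F_def Y_def e_def)
  have stage: "stage n (F n, Y n, e n)" and next_stage: "?Q n (F n, Y n, e n) (F (Suc n), Y (Suc n), e (Suc n))" for n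
    unfolding s_eq[symmetric] using s by (rule allE, simp only:)+
  have st: "(\<exists>g Z. good (F n) g Z \<and> Y n \<subseteq> Z)" "finite (Y n)" "n \<le> card (Y n)"
    "0 < e n" "e n \<le> 1 / (real n + 1)" "\<And>G. norm (G - F n) \<le> e n \<Longrightarrow> lock n (Y n) G" for n
    using stage[of n] unfolding stage_def prod.case by (elim conjE; blast)+
  have step: "Y n \<subseteq> Y (Suc n)" "norm (F (Suc n) - F n) + e (Suc n) \<le> e n" for n
    using next_stage[of n] unfolding prod.case by (elim conjE; blast)+
  have Ymono: "Y n \<subseteq> Y m" if "n \<le> m" for n m
    using that by (induction m rule: dec_induct) (use step in auto)
  have near: "norm (F m - F n) + e m \<le> e n" if "n \<le> m" for n m
    using that
  proof (induction m rule: dec_induct)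
    case (step m)
    have "norm (F (Suc m) - F n) \<le> norm (F (Suc m) - F m) + norm (F m - F n)"
      using norm_triangle_ineq[of "F (Suc m) - F m" "F m - F n"] by simp
    with \<open>norm (F m - F n) + e m \<le> e n\<close> \<open>\<And>n. norm (F (Suc n) - F n) + e (Suc n) \<le> e n\<close>[of m]
    show ?case by linarith
  qed simp
  have "Cauchy F"
  proof (rule CauchyI)
    fix d :: real assume "d > 0"
    then obtain N where N: "1 / (real N + 1) < d / 2"
      using reals_Archimedean[of "d/2"] by (auto simp: inverse_eq_divide add.commute)
    have "norm (F m - F n) < d" if "m \<ge> N" "n \<ge> N" for m n
    proof -
      have "norm (F k - F N) < d / 2" if "k \<ge> N" for k
        using near[OF that] st(4)[of k] st(5)[of N] N by linarith
      from this[OF that(1)] this[OF that(2)] show ?thesis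
        using norm_triangle_ineq4[of "F m - F N" "F n - F N"] by simp
    qed
    then show "\<exists>M. \<forall>m\<ge>M. \<forall>n\<ge>M. norm (F m - F n) < d" by blast
  qed
  then obtain f where f: "F \<longlonglongrightarrow> f" using Cauchy_convergent convergent_def by blast
  have FK: "F n \<in> K" "cinner (F n) h = 0" for n
    using st(1)[of n] good_K good_orth by blast+
  have fK: "f \<in> K" using closed_sequentially[OF closed_K] FK(1) f by blast
  have "(\<lambda>n. cinner (F n) h) \<longlonglongrightarrow> cinner f h" by (rule tendsto_cinner_left[OF f])
  then have fh: "cinner f h = 0" by (simp add: FK(2) LIMSEQ_const_iff)
  have lock: "lock n (Y n) f" for n
  proof (rule st(6))
    have "(\<lambda>m. norm (F m - F n)) \<longlonglongrightarrow> norm (f - F n)" by (intro tendsto_intros f)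
    moreover have "norm (F m - F n) \<le> e n" if "m \<ge> n" for m
      using near[OF that] st(4)[of m] by linarith
    ultimately show "norm (f - F n) \<le> e n" by (intro LIMSEQ_le_const2) auto
  qed
  have zero: "fn f z = 0" if "z \<in> Y n" for z n
  proof -
    have "fn (F m) z = 0" if "m \<ge> n" for m
      using st(1)[of m] good_zero Ymono[OF that] \<open>z \<in> Y n\<close> by blast
    then have "\<forall>\<^sub>F m in sequentially. fn (F m) z = 0"
      by (auto simp: eventually_sequentially)
    then have "(\<lambda>m. fn (F m) z) \<longlonglongrightarrow> 0" by (rule tendsto_eventually)
    from LIMSEQ_unique[OF tendsto_fn[OF f] this] show ?thesis .
  qed
  define \<Lambda> where "\<Lambda> = (\<Union>n. Y n)"
  have "infinite \<Lambda>"
  proof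
    assume fin: "finite \<Lambda>"
    have "Y (Suc (card \<Lambda>)) \<subseteq> \<Lambda>" by (auto simp: \<Lambda>_def)
    from card_mono[OF fin this] st(3)[of "Suc (card \<Lambda>)"] show False by simp
  qed
  moreover have "countable \<Lambda>"
    unfolding \<Lambda>_def by (intro countable_UN countable_finite[OF st(2)]) auto
  moreover have "\<Lambda> \<subseteq> unit_disc"
    unfolding \<Lambda>_def using st(1) good_sub by blast
  moreover have "\<forall>z\<in>\<Lambda>. fn f z = 0" using zero by (auto simp: \<Lambda>_def)
  moreover have "\<forall>n. \<exists>Y\<subseteq>\<Lambda>. lock n Y f" using lock by (auto simp: \<Lambda>_def)
  ultimately show ?thesis using fK fh by blast
qed

section \<open>Uniqueness for the limit function and the exact system\<close>

lemma lock_nonzero: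
  assumes "\<exists>Y. lock 0 Y f"
  shows "f \<noteq> 0"
proof
  assume "f = 0"
  then have "\<exists>g. norm g \<le> real 0 \<and> (\<forall>z\<in>unit_disc. fn f z = (z - \<zeta>) * fn g z)"
    by (intro exI[of _ 0]) simp
  then show False using assms unfolding lock_def by blast
qed

text \<open>With the component along \<open>f\<close> removed, \<open>y\<close> is orthogonal to
  \<open>h\<close>, to \<open>f\<close> and to the kernels at \<open>\<Lambda>\<close>. By
  \<open>lock n\<close> the kernel at a target of index at most \<open>n\<close> is within
  \<open>1 / (real n + 1)\<close> of their span, which bounds the value of \<open>y\<close> there;
  letting \<open>n\<close> grow shows that it is 0.\<close>

lemma limit_unique:
  assumes f: "f \<in> K" "cinner f h = 0" "\<And>z. z \<in> \<Lambda> \<Longrightarrow> fn f z = 0" and lock: "\<forall>n. \<exists>Y\<subseteq>\<Lambda>. lock n Y f" and \<Lambda>: "\<Lambda> \<subseteq> unit_disc"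
    and u: "u \<in> K" "cinner u h = 0" "\<And>z. z \<in> \<Lambda> \<Longrightarrow> fn u z = 0"
  shows "\<exists>c. u = c *\<^sub>h f"
proof -
  have *: "y = 0" if y: "y \<in> K" "cinner y h = 0" "\<And>z. z \<in> \<Lambda> \<Longrightarrow> fn y z = 0" "cinner y f = 0" for y
  proof (rule target_unique)
    fix i
    have le: "cmod (fn y (target i)) \<le> norm y / (real n + 1)" if n: "i \<le> n" for n
    proof -
      obtain Y where Y: "Y \<subseteq> \<Lambda>" "lock n Y f" using lock by blast
      then obtain e c d where e: "e \<in> combos Y ker"
        and small: "norm (ker (target i) - e - c *\<^sub>h h - d *\<^sub>h f) < 1 / (real n + 1)"
        using n unfolding lock_def by blast
      have "combos Y ker \<subseteq> {e. cinner y e = 0}"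
      proof (rule combos_subset)
        show "csubspace {e. cinner y e = 0}" by (auto simp: csubspace_def cinner_distribs)
        fix z assume "z \<in> Y"
        then have "z \<in> \<Lambda>" "z \<in> unit_disc" using Y(1) \<Lambda> by auto
        then show "ker z \<in> {e. cinner y e = 0}"
          using cinner_ker[OF _ y(1)] y(3) by simp
      qed
      then have "cinner y e = 0" using e by blast
      then have "cinner y (ker (target i) - e - c *\<^sub>h h - d *\<^sub>h f) = fn y (target i)"
        using y by (simp add: cinner_distribs cinner_ker[OF target_in_disc])
      then have "cmod (fn y (target i)) \<le> norm y * norm (ker (target i) - e - c *\<^sub>h h - d *\<^sub>h f)"
        using cinner_cauchy_schwarz by metis
      also have "\<dots> \<le> norm y * (1 / (real n + 1))"
        using small by (intro mult_left_mono) auto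
      finally show ?thesis by simp
    qed
    have "(\<lambda>n. norm y / (real n + 1)) \<longlonglongrightarrow> norm y * 0"
      unfolding divide_inverse by (intro tendsto_intros) real_asymp
    then have "cmod (fn y (target i)) \<le> norm y * 0"
      by (rule LIMSEQ_le_const) (use le in blast)
    then show "fn y (target i) = 0" by simp
  qed
  have f0: "f \<noteq> 0" by (rule lock_nonzero) (use lock in blast)
  define c where "c = cinner u f / cinner f f"
  have "u - c *\<^sub>h f = 0"
  proof (rule *)
    show "u - c *\<^sub>h f \<in> K"
      using u(1) f(1) by (intro csubspace_diff[OF csubspace_K] csubspace_scaleC[OF csubspace_K])
    show "cinner (u - c *\<^sub>h f) f = 0"
      using f0 by (simp add: c_def cinner_distribs cinner_self)
    show "cinner (u - c *\<^sub>h f) h = 0" using u(2) f(2) by (simp add: cinner_distribs)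
    show "fn (u - c *\<^sub>h f) z = 0" if "z \<in> \<Lambda>" for z using u(3) f(3) that by simp
  qed
  then show ?thesis by auto
qed

lemma limit_point_unique:
  assumes f: "f \<in> K" "cinner f h = 0" "\<And>z. z \<in> \<Lambda> \<Longrightarrow> fn f z = 0" and lock: "\<forall>n. \<exists>Y\<subseteq>\<Lambda>. lock n Y f"
    and \<Lambda>: "\<Lambda> \<subseteq> unit_disc" and a: "a \<in> unit_disc" "fn f a \<noteq> 0"
    and u: "u \<in> K" "\<And>z. z \<in> insert a \<Lambda> \<Longrightarrow> fn u z = 0"
  shows "u = 0"
proof (rule ccontr)
  assume u0: "u \<noteq> 0"
  have "fn u a = 0" using u(2) by simp
  from quotient_exists[OF a(1) this] obtain q where
    q: "\<And>z. z \<in> unit_disc \<Longrightarrow> fn u z = (z - a) * fn q z" by blast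
  have qK: "q \<in> K" using a(1) by (intro quotient_in_K[OF u(1) q]) auto
  define y where "y = u + (a - \<zeta>) *\<^sub>h q"
  have y: "fn y z = (z - \<zeta>) * fn q z" if "z \<in> unit_disc" for z
    by (simp add: y_def q[OF that] algebra_simps)
  have yK: "y \<in> K"
    unfolding y_def using u(1) qK by (intro csubspace_add[OF csubspace_K] csubspace_scaleC[OF csubspace_K])
  have "fn y z = 0" if z: "z \<in> \<Lambda>" for z
  proof -
    have zD: "z \<in> unit_disc" using z \<Lambda> by blast
    have "z \<noteq> a" using f(3)[OF z] a(2) by auto
    then have "fn q z = 0" using q[OF zD] u(2)[of z] z by simp
    then show ?thesis using y[OF zD] by simp
  qed
  from limit_unique[OF f lock \<Lambda> yK multiple_orthogonal[OF yK y] this] obtain c where c: "y = c *\<^sub>h f"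
    by blast
  show False
  proof (cases "c = 0")
    case True
    have "q = 0"
      by (rule quotient_unique[of \<zeta>]) (simp only: y[symmetric] c True scaleC_simps fn_simps mult_zero_right)
    then have "u = 0" by (intro hardy_eqI) (simp add: q del: mem_ball mem_ball_0)
    with u0 show False by simp
  next
    case False
    define g where "g = (1 / c) *\<^sub>h q"
    have g: "fn f z = (z - \<zeta>) * fn g z" if "z \<in> unit_disc" for z
      using y[OF that] False by (simp add: c g_def field_simps)
    obtain n where n: "norm g \<le> real n" using real_arch_simple by blast
    obtain Y where "lock n Y f" using lock by blast
    then show False using n g unfolding lock_def by blast
  qed
qed

text \<open>The index 0 belongs to the extra point \<open>a\<close>, and \<open>f\<close> itself
  vanishes at all other points. A zero \<open>e k\<close> of \<open>f\<close> is traded for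
  \<open>a\<close>: \<open>f (z - a) / (z - e k)\<close> vanishes at all points but
  \<open>e k\<close>. All these functions keep the value 0 at \<open>\<zeta>\<close>.\<close>

lemma exact_kernel_system:
  assumes good: "\<exists>f g Z. good f g Z"
  shows "\<exists>p w. (\<forall>n. p n \<in> unit_disc) \<and> (\<forall>u\<in>K. (\<forall>n::nat. fn u (p n) = 0) \<longrightarrow> u = 0) \<and>
    (\<forall>n. w n \<in> K \<and> cinner (w n) h = 0 \<and> (\<forall>m. fn (w n) (p m) = (if m = n then 1 else 0)))"
proof -
  obtain f \<Lambda> where f: "f \<in> K" "cinner f h = 0" "\<And>z. z \<in> \<Lambda> \<Longrightarrow> fn f z = 0"
    and \<Lambda>: "\<Lambda> \<subseteq> unit_disc" "countable \<Lambda>" "infinite \<Lambda>" and lock: "\<forall>n. \<exists>Y\<subseteq>\<Lambda>. lock n Y f"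
    using limit_function[OF good] by blast
  have f0: "f \<noteq> 0" by (rule lock_nonzero) (use lock in blast)
  have "unit_disc \<noteq> {}" by simp
  from nonzero_point_exists[OF open_ball this subset_refl f0] obtain a where
    a: "a \<in> unit_disc" "fn f a \<noteq> 0" by blast
  have unique: "u = 0" if "u \<in> K" "\<And>z. z \<in> insert a \<Lambda> \<Longrightarrow> fn u z = 0" for u
    by (rule limit_point_unique[OF f lock \<Lambda>(1) a that])
  obtain e0 :: "complex \<Rightarrow> nat" where "bij_betw e0 \<Lambda> UNIV"
    by (rule countableE_infinite[OF \<Lambda>(2,3)])
  then obtain e where e: "bij_betw e (UNIV :: nat set) \<Lambda>"
    using bij_betw_inv_into by blast
  have e_mem: "e n \<in> \<Lambda>" for n using e by (auto simp: bij_betw_def)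
  have e_inj: "e m = e n \<longleftrightarrow> m = n" for m n using e by (auto simp: bij_betw_def inj_eq)
  define p where "p n = (case n of 0 \<Rightarrow> a | Suc m \<Rightarrow> e m)" for n
  have p: "p 0 = a" "p (Suc m) = e m" for m by (auto simp: p_def)
  have eD: "e n \<in> unit_disc" for n using e_mem \<Lambda>(1) by blast
  have pD: "p n \<in> unit_disc" for n
    by (cases n) (simp_all only: p a(1) eD)
  have range_p: "insert a \<Lambda> = range p"
  proof -
    have "\<Lambda> = range e" using e by (auto simp: bij_betw_def)
    moreover have "range p = insert (p 0) (range (\<lambda>m. p (Suc m)))"
      by (metis UNIV_nat_eq image_image image_insert)
    ultimately show ?thesis by (simp add: p)
  qed
  have p_unique: "u = 0" if "u \<in> K" "\<And>n. fn u (p n) = 0" for u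
    by (rule unique[OF that(1)]) (use that(2) range_p in auto)
  have "\<exists>v\<in>K. cinner v h = 0 \<and> v \<noteq> 0 \<and> (\<forall>m. m \<noteq> n \<longrightarrow> fn v (p m) = 0)" for n
  proof (cases n)
    case 0
    have "fn f (p m) = 0" if "m \<noteq> 0" for m
      using that f(3)[OF e_mem] by (cases m) (auto simp: p)
    then show ?thesis using f f0 0 by blast
  next
    case (Suc k)
    from quotient_exists[OF eD f(3)[OF e_mem]] obtain q where
      q: "\<And>z. z \<in> unit_disc \<Longrightarrow> fn f z = (z - e k) * fn q z" by blast
    note q_props = quotient_orthogonal[OF f(1,2) q eD]
    define v where "v = f + (e k - a) *\<^sub>h q"
    have v: "fn v z = (z - a) * fn q z" if "z \<in> unit_disc" for z
      by (simp add: v_def q[OF that] algebra_simps)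
    have "v \<in> K"
      unfolding v_def using f(1) q_props(1) by (intro csubspace_add[OF csubspace_K] csubspace_scaleC[OF csubspace_K])
    moreover have "cinner v h = 0"
      using f(2) q_props(2) by (simp add: v_def cinner_distribs)
    moreover have "v \<noteq> 0"
    proof
      assume "v = 0"
      have "q = 0"
        by (rule quotient_unique[of a]) (simp only: v[symmetric] \<open>v = 0\<close> fn_simps mult_zero_right)
      then have "f = 0" by (intro hardy_eqI) (simp add: q del: mem_ball mem_ball_0)
      with f0 show False by simp
    qed
    moreover have "fn v (p m) = 0" if "m \<noteq> n" for m
    proof (cases m)
      case 0
      then show ?thesis using v[OF a(1)] by (simp add: p)
    next
      case (Suc j)
      then have "e j \<noteq> e k" using that \<open>n = Suc k\<close> e_inj by auto
      then have "fn q (e j) = 0" using q[OF eD[of j]] f(3)[OF e_mem[of j]] by simp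
      then show ?thesis using v[OF eD[of j]] Suc by (simp add: p)
    qed
    ultimately show ?thesis by blast
  qed
  then have "\<forall>n. \<exists>v. v \<in> K \<and> cinner v h = 0 \<and> v \<noteq> 0 \<and> (\<forall>m. m \<noteq> n \<longrightarrow> fn v (p m) = 0)" by blast
  then obtain v where v: "\<forall>n. v n \<in> K \<and> cinner (v n) h = 0 \<and> v n \<noteq> 0 \<and> (\<forall>m. m \<noteq> n \<longrightarrow> fn (v n) (p m) = 0)"
    unfolding choice_iff by blast
  \<comment> \<open>A zero at the remaining point as well would contradict uniqueness, so the
    functions can be normalised.\<close>
  have v_nz: "fn (v n) (p n) \<noteq> 0" for n
  proof
    assume n: "fn (v n) (p n) = 0"
    have "v n = 0"
    proof (rule p_unique)
      show "v n \<in> K" using v by blast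
      show "fn (v n) (p m) = 0" for m using v n by (cases "m = n") auto
    qed
    then show False using v by blast
  qed
  define w where "w n = (1 / fn (v n) (p n)) *\<^sub>h v n" for n
  have "w n \<in> K \<and> cinner (w n) h = 0 \<and> (\<forall>m. fn (w n) (p m) = (if m = n then 1 else 0))" for n
    using v v_nz[of n] unfolding w_def by (auto intro: csubspace_scaleC[OF csubspace_K])
  then show ?thesis using pD p_unique by blast
qed

lemma incomplete_biorthogonal_system:
  assumes h0: "h \<noteq> 0" and good: "\<exists>f g Z. good f g Z"
  shows "\<exists>(p :: nat \<Rightarrow> complex) k w.
           (\<forall>n. is_reproducing_kernel \<Theta> (p n) (k n)) \<and>
           exact_system (model_space \<Theta>) UNIV k \<and>
           biorthogonal_system (model_space \<Theta>) UNIV k w \<and>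
           \<not> complete_system (model_space \<Theta>) UNIV w"
proof -
  obtain p :: "nat \<Rightarrow> complex" and w where pD: "\<And>n. p n \<in> unit_disc"
    and unique: "\<And>u. u \<in> K \<Longrightarrow> (\<And>n. fn u (p n) = 0) \<Longrightarrow> u = 0"
    and wK: "\<And>n. w n \<in> K" and wh: "\<And>n. cinner (w n) h = 0"
    and wp: "\<And>n m. fn (w n) (p m) = (if m = n then 1 else 0)"
    using exact_kernel_system[OF good] by metis
  define k where "k n = ker (p n)" for n
  have kK: "k n \<in> K" for n unfolding k_def by (rule ker_in_K[OF pD])
  have ck: "cinner f (k n) = fn f (p n)" if "f \<in> K" for f n
    unfolding k_def by (rule cinner_ker[OF pD that])
  have kw: "cinner (k i) (w j) = (if i = j then 1 else 0)" for i j
    using cinner_commute[of "k i" "w j"] by (simp add: ck[OF wK] wp)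
  have image_eq: "closed_lin_span I (\<lambda>i. fn (v i)) = model_space \<Theta> \<longleftrightarrow> closure (combos I v) = K"
    for I :: "nat set" and v
    unfolding closed_lin_span_eq model_space_eq
    by (rule inj_image_eq_iff) (simp add: inj_def fn_inject)
  \<comment> \<open>A nonzero member of \<open>K\<close> orthogonal to a family bars its
    completeness. Applied to \<open>w i\<close> this shows that no kernel can be omitted, applied to
    \<open>h\<close> that the biorthogonal system is incomplete.\<close>
  have not_closure: "closure (combos I v) \<noteq> K"
    if "x \<in> K" "x \<noteq> 0" "\<And>i. i \<in> I \<Longrightarrow> cinner (v i) x = 0" for I :: "nat set" and v x
  proof
    assume "closure (combos I v) = K"
    then have "x \<in> closure (combos I v)" using that(1) by simp
    then have "cinner x x = 0"
      by (rule closure_combos_zero[where L = "\<lambda>f. cinner f x", rotated 3])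
         (use that(3) in \<open>auto intro: bounded_linear_cinner_left\<close>)
    then show False using that(2) by (simp add: cinner_self)
  qed
  have w0: "w i \<noteq> 0" for i using wp[of i i] by auto
  have "exact_system (model_space \<Theta>) UNIV (\<lambda>n. fn (k n))"
    unfolding exact_system_def complete_system_def image_eq
  proof (intro conjI ballI)
    show "closure (combos UNIV k) = K"
    proof (rule closure_combos_eq[OF closed_K csubspace_K kK])
      fix u assume u: "u \<in> K" "\<And>i. i \<in> UNIV \<Longrightarrow> cinner u (k i) = 0"
      show "u = 0" by (rule unique[OF u(1)]) (use u(2) ck[OF u(1)] in simp)
    qed
    show "closure (combos (UNIV - {i}) k) \<noteq> K" for i
      by (rule not_closure[OF wK[of i] w0]) (simp add: kw)
  qed
  moreover have "biorthogonal_system (model_space \<Theta>) UNIV (\<lambda>n. fn (k n)) (\<lambda>n. fn (w n))"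
    unfolding biorthogonal_system_def cinner_hardy_inner[symmetric] model_space_eq
    using wK kw by simp
  moreover have "\<not> complete_system (model_space \<Theta>) UNIV (\<lambda>n. fn (w n))"
    unfolding complete_system_def image_eq by (rule not_closure[OF h_K h0 wh])
  moreover have "\<forall>n. is_reproducing_kernel \<Theta> (p n) (fn (k n))"
    unfolding k_def using is_reproducing_kernel_ker[OF pD] by blast
  ultimately show ?thesis
    by (intro exI[of _ p] exI[of _ "\<lambda>n. fn (k n)"] exI[of _ "\<lambda>n. fn (w n)"] conjI)
qed

end

theorem theorem4p1:
  fixes \<Theta> :: "complex \<Rightarrow> complex"
  assumes "inner_function \<Theta>"
    and "\<exists>\<zeta>\<in>boundary_spectrum \<Theta>. caratheodory_point \<Theta> \<zeta>"
  shows "\<exists>(p :: nat \<Rightarrow> complex) k w.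
           (\<forall>n. is_reproducing_kernel \<Theta> (p n) (k n)) \<and>
           exact_system (model_space \<Theta>) UNIV k \<and>
           biorthogonal_system (model_space \<Theta>) UNIV k w \<and>
           \<not> complete_system (model_space \<Theta>) UNIV w"
proof -
  interpret model \<Theta> by standard (rule assms(1))
  obtain \<zeta> where \<zeta>: "\<zeta> \<in> boundary_spectrum \<Theta>" "caratheodory_point \<Theta> \<zeta>" using assms(2) by blast
  obtain h where h: "h \<in> K" "\<And>f. f \<in> K \<Longrightarrow> (\<lambda>n. fn f (rad \<zeta> n)) \<longlonglongrightarrow> cinner f h"
    using boundary_kernel[OF \<zeta>(2)] by blast
  interpret model_boundary \<Theta> \<zeta> h by standard (use \<zeta> h in auto)
  obtain w where w: "cmod w = 1" "(\<lambda>n. \<Theta> (rad \<zeta> n)) \<longlonglongrightarrow> w"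
    using caratheodory_radial[OF \<zeta>(2)] by blast
  \<comment> \<open>The radial limit at \<open>\<zeta>\<close> would make the constant unimodular,
    but \<open>\<Theta>\<close> takes values of modulus below 1 near a point of the
    spectrum.\<close>
  have "\<not> \<Theta> constant_on unit_disc"
  proof
    assume "\<Theta> constant_on unit_disc"
    then obtain c where c: "\<And>z. z \<in> unit_disc \<Longrightarrow> \<Theta> z = c" unfolding constant_on_def by blast
    have "(\<lambda>n. \<Theta> (rad \<zeta> n)) \<longlonglongrightarrow> c" using c[OF rad_in_disc[OF cmod_\<zeta>]] by simp
    from LIMSEQ_unique[OF this w(2)] w(1) have "cmod c = 1" by simp
    moreover obtain z where "z \<in> unit_disc" "cmod (\<Theta> z) < 1"
      using small_near_spectrum[OF \<zeta>(1) zero_less_one zero_less_one] by blast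
    ultimately show False using c by simp
  qed
  from frostman[OF this] obtain c where "frostman_value c" by blast
  from good_exists[OF this w] show ?thesis
    using incomplete_biorthogonal_system by blast
qed

end
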